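(* Let $(W,S)$ be a finite Coxeter system realized as a finite reflection group on $\mathbb{R}^n$, and let $\mathcal{A}_W=\{H_t\}_{t\in T}$ be its Coxeter arrangement, where each hyperplane $H$ carries a weight variable $a_H$. Let $E$ be an edge of $\mathcal{A}_W$. Then $l(E)\neq 0$ if and only if there exist an irreducible subset $J\subseteq S$ and an element $w\in W$ such that $E=E_{T_J^w}$. In this case $\mathsf{a}(E_{T_J^w})=\prod_{u\in T_J}a_{H_{u^w}}$. Moreover, let $t_J$ be a reflection with support $J$, let $s_J$ be a simple reflection, and let $v\in W$ be such that a reduced expression of $t_J$ is $s_J^v$. Then $$l(E_{T_J^w})=|\lfloor t_J\rceil|\cdot|[J]|\cdot|X(S,J)|\cdot|X(J,\{s_J\})|.$$
   Context: Let $(W,S)$ be a finite Coxeter system with $S=\{s_1,\dots,s_n\}$, realized as a finite reflection group acting on $\mathbb{R}^n$. - For $a,x\in W$ write $a^x:=x^{-1}ax$, and for $A\subseteq W$ write $A^x:=\{a^x: a\in A\}$. - $T=\{s^x: s\in S, x\in W\}$ is the set of reflections. For $t\in T$, $H_t:=\ker(t-1)$, and $\mathcal{A}_W=\{H_t\}_{t\in T}$. - An edge is a nonempty intersection of some hyperplanes of $\mathcal{A}_W$. For $U\subseteq T$, $E_U:=\bigcap_{u\in U}H_u$. - Each hyperplane $H$ carries a variable $a_H$. The weight of an edge $E$ is $\mathsf{a}(E)=\prod_{H\in\mathcal{A}_W,\,E\subseteq H}a_H$. - A chamber is a connected component of $\mathbb{R}^n\setminus\bigcup_{H}H$. The multiplicity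 $l(E)$ of an edge $E$ is defined as follows: choose a hyperplane $H\in\mathcal{A}_W$ containing $E$; then $l(E)$ is half the number of chambers $C$ such that $E$ is the minimal edge containing $\overline{C}\cap H$. Further notation: - For $J\subseteq S$: $W_J=\langle J\rangle$ and $T_J=T\cap W_J$. $J$ is irreducible if $W_J$ is an irreducible Coxeter group. - $X_K$ is the set of minimal-length coset representatives of $W_K$. - $[J]$ is the set of subsets of $S$ that are $W$-conjugate to $J$. - For $K\subseteq J\subseteq S$: $X(J,K)=\{w\in W_J\cap X_K\cap X_K^{-1}: K^w=K\}$. - The support $J(x)$ of $x\in W$ is the set of simple reflections appearing in a reduced expression of $x$ (this is independent of the expression). - $\lfloor x\rceil=\{y\in W: J(y)=J(x)\text{ and }y\text{ is conjugate to }x\}$. *)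

theory Defs
  imports "HOL-Analysis.Analysis" "HOL-Algebra.Group_Action" "HOL-Algebra.Multiplicative_Group"
begin

section \<open>Coxeter systems\<close>

text \<open>
  Words over \<open>S\<close> are lists. Since the generators of a Coxeter system are involutions, words
  without formal inverses suffice.
\<close>

definition word_prod :: "('g, 'b) monoid_scheme \<Rightarrow> 'g list \<Rightarrow> 'g" where
  "word_prod G ws = foldr (mult G) ws (one G)"

definition coxeter_exponent :: "('g, 'b) monoid_scheme \<Rightarrow> 'g \<Rightarrow> 'g \<Rightarrow> nat" where
  "coxeter_exponent G s t = group.ord G (s \<otimes>\<^bsub>G\<^esub> t)"

text \<open>
  One application of a relation \<open>(s t)\<^sup>m = 1\<close>, \<open>m\<close> the order of \<open>s t\<close>. For \<open>s = t\<close> this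
  deletes \<open>s s\<close>; if \<open>s t\<close> has infinite order then \<open>m = 0\<close> and nothing is deleted.
\<close>

definition coxeter_step :: "('g, 'b) monoid_scheme \<Rightarrow> 'g set \<Rightarrow> ('g list \<times> 'g list) set" where
  "coxeter_step G S =
     {(u @ concat (replicate (coxeter_exponent G s t) [s, t]) @ v, u @ v) | u v s t.
        u \<in> lists S \<and> v \<in> lists S \<and> s \<in> S \<and> t \<in> S}"

text \<open>
  The last clause says that the relations \<open>(s t)\<^sup>m = 1\<close> present the group: every word with
  trivial product is reduced to the empty word by inserting and deleting relators.
\<close>

definition coxeter_system :: "('g, 'b) monoid_scheme \<Rightarrow> 'g set \<Rightarrow> bool" where
  "coxeter_system G S \<longleftrightarrow>
     group G \<and> S \<subseteq> carrier G \<and>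
     (\<forall>s\<in>S. s \<noteq> \<one>\<^bsub>G\<^esub> \<and> s \<otimes>\<^bsub>G\<^esub> s = \<one>\<^bsub>G\<^esub>) \<and>
     generate G S = carrier G \<and>
     (\<forall>ws\<in>lists S. word_prod G ws = \<one>\<^bsub>G\<^esub> \<longrightarrow>
        (ws, []) \<in> (coxeter_step G S \<union> (coxeter_step G S)\<inverse>)\<^sup>*)"

definition conj_by :: "('g, 'b) monoid_scheme \<Rightarrow> 'g \<Rightarrow> 'g \<Rightarrow> 'g" where
  "conj_by G a x = inv\<^bsub>G\<^esub> x \<otimes>\<^bsub>G\<^esub> a \<otimes>\<^bsub>G\<^esub> x"

definition conj_set :: "('g, 'b) monoid_scheme \<Rightarrow> 'g set \<Rightarrow> 'g \<Rightarrow> 'g set" where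
  "conj_set G A x = (\<lambda>a. conj_by G a x) ` A"

definition reflections :: "('g, 'b) monoid_scheme \<Rightarrow> 'g set \<Rightarrow> 'g set" where
  "reflections G S = {conj_by G s x | s x. s \<in> S \<and> x \<in> carrier G}"

definition parabolic_reflections :: "('g, 'b) monoid_scheme \<Rightarrow> 'g set \<Rightarrow> 'g set \<Rightarrow> 'g set" where
  "parabolic_reflections G S J = reflections G S \<inter> generate G J"

definition cox_length :: "('g, 'b) monoid_scheme \<Rightarrow> 'g set \<Rightarrow> 'g \<Rightarrow> nat" where
  "cox_length G S x = (LEAST k. \<exists>ws\<in>lists S. length ws = k \<and> word_prod G ws = x)"

definition reduced_expression :: "('g, 'b) monoid_scheme \<Rightarrow> 'g set \<Rightarrow> 'g \<Rightarrow> 'g list \<Rightarrow> bool" where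
  "reduced_expression G S x ws \<longleftrightarrow>
     ws \<in> lists S \<and> word_prod G ws = x \<and> length ws = cox_length G S x"

definition support :: "('g, 'b) monoid_scheme \<Rightarrow> 'g set \<Rightarrow> 'g \<Rightarrow> 'g set" where
  "support G S x = {s. \<exists>ws. reduced_expression G S x ws \<and> s \<in> set ws}"

definition support_class :: "('g, 'b) monoid_scheme \<Rightarrow> 'g set \<Rightarrow> 'g \<Rightarrow> 'g set" where
  "support_class G S x =
     {y \<in> carrier G. support G S y = support G S x \<and> (\<exists>z\<in>carrier G. y = conj_by G x z)}"

text \<open>
  Irreducibility is connectedness of the (nonempty) Coxeter graph, in which distinct generators
  are adjacent iff their exponent is not 2, i.e. iff they do not commute.
\<close>

definition irreducible_subset :: "('g, 'b) monoid_scheme \<Rightarrow> 'g set \<Rightarrow> bool" where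
  "irreducible_subset G J \<longleftrightarrow>
     J \<noteq> {} \<and>
     (\<forall>s\<in>J. \<forall>t\<in>J.
        (s, t) \<in> {(p, q). p \<in> J \<and> q \<in> J \<and> p \<noteq> q \<and> coxeter_exponent G p q \<noteq> 2}\<^sup>*)"

text \<open>
  Representatives of the cosets \<open>W\<^sub>K x\<close>. For the cosets \<open>x W\<^sub>K\<close> one gets the set of
  inverses; below only the intersection of the two sets is used.
\<close>

definition min_coset_reps :: "('g, 'b) monoid_scheme \<Rightarrow> 'g set \<Rightarrow> 'g set \<Rightarrow> 'g set" where
  "min_coset_reps G S K =
     {x \<in> carrier G. \<forall>y \<in> generate G K #>\<^bsub>G\<^esub> x. cox_length G S x \<le> cox_length G S y}"

definition conj_subsets :: "('g, 'b) monoid_scheme \<Rightarrow> 'g set \<Rightarrow> 'g set \<Rightarrow> 'g set set" where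
  "conj_subsets G S J = {K. K \<subseteq> S \<and> (\<exists>x\<in>carrier G. K = conj_set G J x)}"

definition X_set :: "('g, 'b) monoid_scheme \<Rightarrow> 'g set \<Rightarrow> 'g set \<Rightarrow> 'g set \<Rightarrow> 'g set" where
  "X_set G S J K =
     {w \<in> generate G J \<inter> min_coset_reps G S K \<inter> m_inv G ` min_coset_reps G S K.
        conj_set G K w = K}"


section \<open>Realization and arrangement\<close>

definition reflection_along :: "'v::euclidean_space \<Rightarrow> 'v \<Rightarrow> 'v" where
  "reflection_along r x = x - (2 * (r \<bullet> x) / (r \<bullet> r)) *\<^sub>R r"

text \<open>
  The realization as a finite reflection group: \<open>W\<close> acts faithfully on Euclidean space of
  dimension \<open>|S|\<close>, the elements of \<open>S\<close> acting as the orthogonal reflections in the walls of a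
  chamber. The condition on the walls is expressed through their unit normals \<open>\<alpha> s\<close>; for
  \<open>s = t\<close> the exponent is 1, so the equation gives \<open>\<alpha> s \<bullet> \<alpha> s = 1\<close>.
\<close>

definition reflection_realization ::
  "('g, 'b) monoid_scheme \<Rightarrow> 'g set \<Rightarrow> ('g \<Rightarrow> 'v \<Rightarrow> 'v::euclidean_space) \<Rightarrow> bool" where
  "reflection_realization G S \<rho> \<longleftrightarrow>
     card S = DIM('v) \<and>
     faithful_action G UNIV \<rho> \<and>
     (\<exists>\<alpha>. (\<forall>s\<in>S. \<rho> s = reflection_along (\<alpha> s)) \<and>
          (\<forall>s\<in>S. \<forall>t\<in>S. \<alpha> s \<bullet> \<alpha> t = - cos (pi / real (coxeter_exponent G s t))))"

definition hyperplane :: "('g \<Rightarrow> 'v \<Rightarrow> 'v) \<Rightarrow> 'g \<Rightarrow> 'v set" where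
  "hyperplane \<rho> t = {x. \<rho> t x = x}"

definition coxeter_arrangement ::
  "('g, 'b) monoid_scheme \<Rightarrow> 'g set \<Rightarrow> ('g \<Rightarrow> 'v \<Rightarrow> 'v) \<Rightarrow> 'v set set" where
  "coxeter_arrangement G S \<rho> = hyperplane \<rho> ` reflections G S"

definition edge_cut_by :: "('g \<Rightarrow> 'v \<Rightarrow> 'v) \<Rightarrow> 'g set \<Rightarrow> 'v set" where
  "edge_cut_by \<rho> U = (\<Inter>u\<in>U. hyperplane \<rho> u)"

text \<open>
  The empty family of hyperplanes is excluded: the multiplicity of an edge refers to a hyperplane
  containing it, so the whole space is not an edge.
\<close>

definition edges :: "'v set set \<Rightarrow> 'v set set" where
  "edges A = {\<Inter>B | B. B \<subseteq> A \<and> B \<noteq> {} \<and> \<Inter>B \<noteq> {}}"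

definition edge_weight :: "'v set set \<Rightarrow> ('v set \<Rightarrow> 'r::comm_monoid_mult) \<Rightarrow> 'v set \<Rightarrow> 'r" where
  "edge_weight A a E = (\<Prod>H\<in>{H \<in> A. E \<subseteq> H}. a H)"

definition chambers :: "'v::euclidean_space set set \<Rightarrow> 'v set set" where
  "chambers A = components (UNIV - \<Union>A)"

definition minimal_edge_containing :: "'v set set \<Rightarrow> 'v set \<Rightarrow> 'v set \<Rightarrow> bool" where
  "minimal_edge_containing A X E \<longleftrightarrow>
     E \<in> edges A \<and> X \<subseteq> E \<and> (\<forall>F\<in>edges A. X \<subseteq> F \<longrightarrow> E \<subseteq> F)"

text \<open>
  The multiplicity of \<open>E\<close> computed from the chosen hyperplane \<open>H \<supseteq> E\<close>. The choice is an
  explicit argument, over which statements about multiplicities are to quantify universally.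
\<close>

definition multiplicity_via :: "'v::euclidean_space set set \<Rightarrow> 'v set \<Rightarrow> 'v set \<Rightarrow> real" where
  "multiplicity_via A H E =
     real (card {C \<in> chambers A. minimal_edge_containing A (closure C \<inter> H) E}) / 2"

end

theory Submission
  imports Defs
begin

text \<open>
  A reflection \<open>t\<close> has a root with nonnegative coordinates in the simple roots, its support is the
  set of nonzero coordinates, and the face of the chamber \<open>w D\<close> in \<open>H\<^sub>t\<close> spans \<open>w E\<^sub>K\<close>, where
  \<open>K\<close> is the support of \<open>w\<inverse> t w\<close>. So \<open>2 l(E)\<close> counts the \<open>w\<close> with \<open>w E\<^sub>K = E\<close>, and
  \<open>l(E) \<noteq> 0\<close> because the supports of reflections are the irreducible subsets of \<open>S\<close>. For
  \<open>E = E\<^sub>J\<close> write \<open>w = u x\<close> with \<open>u \<in> W\<^sub>J\<close> and \<open>x\<close> minimal in \<open>W\<^sub>J x\<close>. The condition on \<open>x\<close> is that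
  \<open>J\<close> is conjugated by \<open>x\<close> into \<open>S\<close>, which gives the factor \<open>|[J]| |X(S, J)|\<close>. The condition on
  \<open>u\<close> is that \<open>u\<inverse> t u\<close> has support \<open>J\<close>, and two facts are needed to count these \<open>u\<close>.

  Their number does not depend on the reflection \<open>t \<in> W\<^sub>J\<close>: by inclusion-exclusion over the faces
  in \<open>H\<^sub>t\<close> and the Euler relation it is, up to a sign, the sum over \<open>u \<in> W\<^sub>J\<close> of \<open>(-1)\<close> to the
  power \<open>dim (Fix u \<inter> H\<^sub>t)\<close>. Pairing \<open>u\<close> with \<open>u t\<close>, of which exactly one has its fixed space inside
  \<open>H\<^sub>t\<close>, turns this into \<open>-2\<close> times the sum of \<open>(-1)\<close> to the power \<open>dim (Fix u)\<close> times
  \<open>dim (Fix u)\<close>.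

  Two simple reflections in an irreducible \<open>J\<close> that are conjugate in \<open>W\<close> are conjugate in \<open>W\<^sub>J\<close>: they
  are joined by a path of edges with odd exponent, and the Coxeter graph is a forest.
\<close>

text \<open>The multiplicity is computed from some hyperplane, whose reflection t is unrelated to
  the t_J of the formula. A count that agrees for all reflections of W_J is what allows t to be
  replaced by the simple reflection s_J. For s_J the elements u fibre over the conjugates of s_J
  with full support, each fibre being a coset of the centralizer of s_J in W_J. Half of that
  centralizer is X(J, {s_J}), and the other half reverses the simple root; this 2 cancels the half
  in l(E). The class of t_J is formed by conjugation in all of W while u stays in W_J, and this gap
  is what the statement about conjugate simple reflections closes.

  The realization supplies only an action, a Gram matrix and the dimension. Linear independence of
  the simple roots, on which every notion of positivity rests, has to be extracted from the
  presentation and from finiteness.\<close>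

declare in_listsD [rule del]

lemma rev_in_lists_iff [simp]: "rev ws \<in> lists A \<longleftrightarrow> ws \<in> lists A"
  by (simp add: in_lists_conv_set)

text \<open>The simple roots \<alpha> are a parameter because \<open>reflection_realization\<close>
  only asserts that some exist; the final theorem instantiates the locale with a chosen
  witness.\<close>

locale coxeter_realization = group W for W :: "('g, 'b) monoid_scheme" (structure) +
  fixes S :: "'g set" and \<rho> :: "'g \<Rightarrow> 'v \<Rightarrow> 'v::euclidean_space" and \<alpha> :: "'g \<Rightarrow> 'v"
  assumes coxeter: "coxeter_system W S"
    and finite_W: "finite (carrier W)"
    and card_S: "card S = DIM('v)"
    and action: "faithful_action W UNIV \<rho>"
    and rho_S: "s \<in> S \<Longrightarrow> \<rho> s = reflection_along (\<alpha> s)"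
    and gram: "s \<in> S \<Longrightarrow> t \<in> S \<Longrightarrow> \<alpha> s \<bullet> \<alpha> t = - cos (pi / real (coxeter_exponent W s t))"
begin

section \<open>Words, length and support\<close>

abbreviation len :: "'g \<Rightarrow> nat" where "len \<equiv> cox_length W S"

lemma S_closed: "S \<subseteq> carrier W"
  and S_square: "s \<in> S \<Longrightarrow> s \<otimes> s = \<one>"
  and generate_S: "generate W S = carrier W"
  and presentation: "ws \<in> lists S \<Longrightarrow> word_prod W ws = \<one> \<Longrightarrow>
    (ws, []) \<in> (coxeter_step W S \<union> (coxeter_step W S)\<inverse>)\<^sup>*"
  using coxeter by (auto simp: coxeter_system_def)

lemma S_in_carrier [simp]: "s \<in> S \<Longrightarrow> s \<in> carrier W"
  using S_closed by blast

lemma S_inv [simp]: "s \<in> S \<Longrightarrow> inv s = s"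
  using S_square by (simp add: inv_equality)

lemma S_cancel [simp]: "s \<in> S \<Longrightarrow> x \<in> carrier W \<Longrightarrow> s \<otimes> (s \<otimes> x) = x"
  by (metis S_inv S_in_carrier inv_solve_left m_closed)

lemma S_cancel_right [simp]: "s \<in> S \<Longrightarrow> x \<in> carrier W \<Longrightarrow> x \<otimes> s \<otimes> s = x"
  by (simp add: m_assoc S_square)

lemma finite_S: "finite S"
  using S_closed finite_W finite_subset by blast

lemma word_prod_Nil [simp]: "word_prod W [] = \<one>"
  and word_prod_Cons [simp]: "word_prod W (s # ws) = s \<otimes> word_prod W ws"
  by (simp_all add: word_prod_def)

lemma word_prod_closed [simp]: "ws \<in> lists S \<Longrightarrow> word_prod W ws \<in> carrier W"
  by (induction ws) auto

lemma word_prod_append: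
  "us \<in> lists S \<Longrightarrow> vs \<in> lists S \<Longrightarrow> word_prod W (us @ vs) = word_prod W us \<otimes> word_prod W vs"
  by (induction us) (auto simp: m_assoc)

lemma word_prod_rev: "ws \<in> lists S \<Longrightarrow> word_prod W (rev ws) = inv (word_prod W ws)"
  by (induction ws) (auto simp: word_prod_append inv_mult_group)

text \<open>Words suffice because the generators are their own inverses, so the inverse letters
  allowed by \<open>generate\<close> contribute nothing new.\<close>

lemma generate_eq_words:
  assumes "K \<subseteq> S"
  shows "generate W K = word_prod W ` lists K"
proof
  have sub: "lists K \<subseteq> lists S" using assms by (simp add: lists_mono)
  show "generate W K \<subseteq> word_prod W ` lists K"
  proof
    fix x assume "x \<in> generate W K"
    then show "x \<in> word_prod W ` lists K"
    proof induction
      case one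
      then show ?case by (intro image_eqI[of _ _ "[]"]) auto
    next
      case (incl h)
      then show ?case using assms by (intro image_eqI[of _ _ "[h]"]) auto
    next
      case (inv h)
      then show ?case using assms by (intro image_eqI[of _ _ "[h]"]) auto
    next
      case (eng g h)
      then obtain us vs where "us \<in> lists K" "vs \<in> lists K" "g = word_prod W us" "h = word_prod W vs"
        by auto
      then show ?case using sub
        by (intro image_eqI[of _ _ "us @ vs"]) (auto simp: word_prod_append subset_iff)
    qed
  qed
  have "word_prod W ws \<in> generate W K" if "ws \<in> lists K" for ws
    using that by induction (auto intro: generate.intros)
  then show "word_prod W ` lists K \<subseteq> generate W K" by auto
qed

lemma generate_subgroup: "K \<subseteq> S \<Longrightarrow> subgroup (generate W K) W"
  using S_closed by (intro generate_is_subgroup) auto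

lemma generate_closed: "K \<subseteq> S \<Longrightarrow> x \<in> generate W K \<Longrightarrow> x \<in> carrier W"
  using generate_subgroup subgroup.mem_carrier by metis

lemma generate_inv: "K \<subseteq> S \<Longrightarrow> x \<in> generate W K \<Longrightarrow> inv x \<in> generate W K"
  using generate_subgroup subgroup.m_inv_closed by metis

lemma finite_generate: "K \<subseteq> S \<Longrightarrow> finite (generate W K)"
  using generate_closed finite_W by (meson finite_subset subsetI)

section \<open>Reduced expressions and the length function\<close>

lemma ex_reduced_expression:
  assumes "x \<in> carrier W"
  shows "\<exists>ws. reduced_expression W S x ws"
proof -
  have "x \<in> word_prod W ` lists S"
    using assms generate_eq_words[of S] generate_S by simp
  then have "\<exists>k. \<exists>ws\<in>lists S. length ws = k \<and> word_prod W ws = x" by blast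
  then have "\<exists>ws\<in>lists S. length ws = len x \<and> word_prod W ws = x"
    unfolding cox_length_def by (rule LeastI_ex)
  then show ?thesis by (auto simp: reduced_expression_def)
qed

lemma len_le: "ws \<in> lists S \<Longrightarrow> len (word_prod W ws) \<le> length ws"
  unfolding cox_length_def by (rule Least_le) auto

lemma len_mult:
  assumes "x \<in> carrier W" "y \<in> carrier W"
  shows "len (x \<otimes> y) \<le> len x + len y"
proof -
  obtain us vs where "reduced_expression W S x us" "reduced_expression W S y vs"
    using assms ex_reduced_expression by meson
  then show ?thesis
    using len_le[of "us @ vs"] by (auto simp: reduced_expression_def word_prod_append)
qed

lemma len_inv_le:
  assumes "x \<in> carrier W"
  shows "len (inv x) \<le> len x"
proof -
  obtain us where "reduced_expression W S x us"
    using assms ex_reduced_expression by meson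
  then show ?thesis
    using len_le[of "rev us"] by (auto simp: reduced_expression_def word_prod_rev)
qed

lemma len_inv [simp]: "x \<in> carrier W \<Longrightarrow> len (inv x) = len x"
  using len_inv_le[of x] len_inv_le[of "inv x"] by simp

lemma len_S: "s \<in> S \<Longrightarrow> len s \<le> 1"
  using len_le[of "[s]"] by simp

lemma len_one [simp]: "len \<one> = 0"
  using len_le[of "[]"] by simp

lemma reduced_expression_snocD:
  assumes "reduced_expression W S x (us @ [s])"
  shows "reduced_expression W S (x \<otimes> s) us" "len x = Suc (len (x \<otimes> s))"
proof -
  have *: "us \<in> lists S" "s \<in> S" "x = word_prod W us \<otimes> s" "len x = Suc (length us)"
    using assms by (auto simp: reduced_expression_def word_prod_append)
  then have "len (x \<otimes> s) \<le> length us" using len_le[of us] by simp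
  moreover have "len x \<le> len (x \<otimes> s) + 1"
    using len_mult[of "x \<otimes> s" s] len_S[of s] * by simp
  ultimately show "reduced_expression W S (x \<otimes> s) us" "len x = Suc (len (x \<otimes> s))"
    using * by (auto simp: reduced_expression_def)
qed

lemma reduced_expression_closed: "reduced_expression W S x ws \<Longrightarrow> x \<in> carrier W"
  by (auto simp: reduced_expression_def)

lemma ex_descent:
  assumes "x \<in> carrier W" "x \<noteq> \<one>"
  shows "\<exists>s\<in>S. len x = Suc (len (x \<otimes> s))"
proof -
  obtain ws where ws: "reduced_expression W S x ws" using assms ex_reduced_expression by blast
  show ?thesis
  proof (cases ws rule: rev_cases)
    case Nil
    then show ?thesis using ws assms by (auto simp: reduced_expression_def)
  next
    case (snoc us s)
    then have "s \<in> S" using ws by (simp add: reduced_expression_def)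
    then show ?thesis using ws snoc reduced_expression_snocD(2)[of x us s] by blast
  qed
qed

section \<open>The action\<close>

lemma rho_mult [simp]:
  assumes "x \<in> carrier W" "y \<in> carrier W"
  shows "\<rho> (x \<otimes> y) v = \<rho> x (\<rho> y v)"
proof -
  interpret group_action W UNIV \<rho> using action faithful_action.axioms(1) by blast
  show ?thesis using composition_rule[of v x y] assms by simp
qed

lemma rho_one [simp]: "\<rho> \<one> v = v"
proof -
  interpret group_action W UNIV \<rho> using action faithful_action.axioms(1) by blast
  show ?thesis using id_eq_one by (metis UNIV_I restrict_apply)
qed

lemma rho_inj: "x \<in> carrier W \<Longrightarrow> y \<in> carrier W \<Longrightarrow> (\<And>v. \<rho> x v = \<rho> y v) \<Longrightarrow> x = y"
  using faithful_action.faithful[OF action] by (meson ext inj_onD)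

lemma rho_inv_cancel [simp]:
  "x \<in> carrier W \<Longrightarrow> \<rho> (inv x) (\<rho> x v) = v" "x \<in> carrier W \<Longrightarrow> \<rho> x (\<rho> (inv x) v) = v"
  using rho_mult[of "inv x" x v] rho_mult[of x "inv x" v] by simp_all

lemma alpha_unit [simp]: "s \<in> S \<Longrightarrow> \<alpha> s \<bullet> \<alpha> s = 1"
proof -
  assume s: "s \<in> S"
  then have "coxeter_exponent W s s = 1"
    by (simp add: coxeter_exponent_def S_square ord_eq_1)
  then show ?thesis using gram[OF s s] by simp
qed

lemma rho_gen: "s \<in> S \<Longrightarrow> \<rho> s v = v - (2 * (\<alpha> s \<bullet> v)) *\<^sub>R \<alpha> s"
  by (simp add: rho_S reflection_along_def)

text \<open>\<open>faithful_action\<close> speaks only of permutations of the set of vectors.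
  Linearity and orthogonality hold for the generators and spread to the group by this
  induction.\<close>

lemma rho_induct [consumes 1, case_names one gen]:
  assumes "x \<in> carrier W"
    and "P \<one>"
    and "\<And>s x. s \<in> S \<Longrightarrow> x \<in> carrier W \<Longrightarrow> P x \<Longrightarrow> P (s \<otimes> x)"
  shows "P x"
proof -
  obtain ws where "ws \<in> lists S" "x = word_prod W ws"
    using assms(1) generate_eq_words[of S] generate_S by auto
  moreover have "ws \<in> lists S \<Longrightarrow> P (word_prod W ws)"
    by (induction ws) (auto intro: assms(2,3))
  ultimately show ?thesis by simp
qed

lemma linear_rho [simp]: "x \<in> carrier W \<Longrightarrow> linear (\<rho> x)"
proof (induction rule: rho_induct)
  case one
  show ?case by (auto intro!: linearI)
next
  case (gen s x)
  then show ?case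
    by (auto intro!: linearI simp: rho_gen linear_add linear_cmul algebra_simps inner_right_distrib)
qed

lemma rho_inner [simp]: "x \<in> carrier W \<Longrightarrow> \<rho> x v \<bullet> \<rho> x w = v \<bullet> w"
proof (induction arbitrary: v w rule: rho_induct)
  case (gen s x)
  then show ?case
    by (simp add: rho_gen inner_diff_left inner_diff_right inner_commute algebra_simps)
qed simp

lemma rho_inner_left: "x \<in> carrier W \<Longrightarrow> v \<bullet> \<rho> x w = \<rho> (inv x) v \<bullet> w"
  using rho_inner[of x "\<rho> (inv x) v" w] by simp

lemma rho_zero [simp]: "x \<in> carrier W \<Longrightarrow> \<rho> x 0 = 0"
  and rho_minus [simp]: "x \<in> carrier W \<Longrightarrow> \<rho> x (- v) = - \<rho> x v"
  and rho_add: "x \<in> carrier W \<Longrightarrow> \<rho> x (v + w) = \<rho> x v + \<rho> x w"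
  and rho_diff: "x \<in> carrier W \<Longrightarrow> \<rho> x (v - w) = \<rho> x v - \<rho> x w"
  and rho_scale: "x \<in> carrier W \<Longrightarrow> \<rho> x (c *\<^sub>R v) = c *\<^sub>R \<rho> x v"
  and rho_sum: "x \<in> carrier W \<Longrightarrow> \<rho> x (\<Sum>i\<in>A. f i) = (\<Sum>i\<in>A. \<rho> x (f i))"
  by (simp_all add: linear_0 linear_neg linear_add linear_diff linear_cmul linear_sum)

lemma rho_eq_iff [simp]: "x \<in> carrier W \<Longrightarrow> \<rho> x v = \<rho> x w \<longleftrightarrow> v = w"
  by (metis rho_inv_cancel(1))

lemma alpha_nonzero [simp]: "s \<in> S \<Longrightarrow> \<alpha> s \<noteq> 0"
  using alpha_unit by fastforce

section \<open>The Gram matrix of the simple roots\<close>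

lemma exponent_pos: "s \<in> S \<Longrightarrow> t \<in> S \<Longrightarrow> 0 < coxeter_exponent W s t"
  unfolding coxeter_exponent_def using ord_ge_1[OF finite_W, of "s \<otimes> t"] by simp

lemma exponent_ge_2:
  assumes "s \<in> S" "t \<in> S" "s \<noteq> t"
  shows "2 \<le> coxeter_exponent W s t"
proof -
  have "s \<otimes> t \<noteq> \<one>" using assms S_cancel[of s t] by force
  then have "coxeter_exponent W s t \<noteq> 1"
    using assms ord_eq_1[of "s \<otimes> t"] by (simp add: coxeter_exponent_def)
  then show ?thesis using exponent_pos[of s t] assms by linarith
qed

lemma cos_pi_div_mono:
  fixes k m :: nat
  assumes "1 \<le> k" "k \<le> m"
  shows "cos (pi / real k) \<le> cos (pi / real m)"
  using assms by (intro cos_monotone_0_pi_le) (auto simp: frac_le divide_simps)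

lemma gram_nonpos: "s \<in> S \<Longrightarrow> t \<in> S \<Longrightarrow> s \<noteq> t \<Longrightarrow> \<alpha> s \<bullet> \<alpha> t \<le> 0"
  using cos_pi_div_mono[of 2 "coxeter_exponent W s t"] exponent_ge_2[of s t] by (simp add: gram)

text \<open>An exponent of at least 3 makes the angle between the roots at least 120 degrees. The
  constant 1/2 is what later bounds the norm of sums over connected subgraphs.\<close>

lemma gram_adjacent:
  assumes "s \<in> S" "t \<in> S" "s \<noteq> t" "coxeter_exponent W s t \<noteq> 2"
  shows "\<alpha> s \<bullet> \<alpha> t \<le> - (1/2)"
  using cos_pi_div_mono[of 3 "coxeter_exponent W s t"] exponent_ge_2[of s t] assms
  by (simp add: gram cos_60)

lemma gram_nonadjacent:
  assumes "s \<in> S" "t \<in> S" "coxeter_exponent W s t = 2"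
  shows "\<alpha> s \<bullet> \<alpha> t = 0"
  using assms by (simp add: gram)

lemma alpha_eq_iff: "s \<in> S \<Longrightarrow> t \<in> S \<Longrightarrow> \<alpha> s = \<alpha> t \<longleftrightarrow> s = t"
  by (metis rho_S S_in_carrier rho_inj)

lemma inj_alpha: "inj_on \<alpha> S"
  by (auto simp: inj_on_def alpha_eq_iff)

section \<open>The simple roots form a basis\<close>

text \<open>
  For any \<open>d\<close> the vectors \<open>(\<alpha> s, d s)\<close> have the Gram matrix of the \<open>\<alpha> s\<close> for the form that
  ignores the last coordinate. The corresponding reflections of the space \<open>V \<times> \<real>\<close> satisfy the
  Coxeter relations, so the presentation lifts the action of the group to this space.
\<close>

definition lift_gen :: "('g \<Rightarrow> real) \<Rightarrow> 'g \<Rightarrow> 'v \<times> real \<Rightarrow> 'v \<times> real" where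
  "lift_gen d s z = z - (2 * (\<alpha> s \<bullet> fst z)) *\<^sub>R (\<alpha> s, d s)"

definition lift_word :: "('g \<Rightarrow> real) \<Rightarrow> 'g list \<Rightarrow> 'v \<times> real \<Rightarrow> 'v \<times> real" where
  "lift_word d ws = foldr (lift_gen d) ws"

lemma lift_word_simps [simp]:
  "lift_word d [] z = z"
  "lift_word d (s # ws) z = lift_gen d s (lift_word d ws z)"
  "lift_word d (us @ vs) z = lift_word d us (lift_word d vs z)"
  by (simp_all add: lift_word_def)

lemma linear_lift_gen: "linear (lift_gen d s)"
  by (auto intro!: linearI simp: lift_gen_def algebra_simps inner_right_distrib)

lemma linear_lift_word: "linear (lift_word d ws)"
proof (induction ws)
  case Nil
  show ?case by (auto intro!: linearI)
next
  case (Cons s ws)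
  then have "linear (lift_gen d s \<circ> lift_word d ws)"
    by (intro linear_compose linear_lift_gen)
  then show ?case by (simp add: o_def)
qed

lemma fst_lift_word: "ws \<in> lists S \<Longrightarrow> fst (lift_word d ws z) = \<rho> (word_prod W ws) (fst z)"
  by (induction ws) (auto simp: lift_gen_def rho_gen)

lemma lift_gen_involution: "s \<in> S \<Longrightarrow> lift_gen d s (lift_gen d s z) = z"
  by (cases z) (simp add: lift_gen_def inner_diff_right)

lemma lift_word_fixes: "lift_word d ws (0, y) = (0, y)"
  by (induction ws) (auto simp: lift_gen_def)

text \<open>The product c of two distinct simple roots satisfies |c| < 1, so their Gram matrix is
  invertible and Cramer's rule gives the coefficients of \<open>k\<close>; \<open>e\<close> is the
  inverse determinant.\<close>

lemma ex_inner_pair: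
  assumes "s \<in> S" "t \<in> S"
  shows "\<exists>k. k \<bullet> \<alpha> s = d s \<and> k \<bullet> \<alpha> t = d t"
proof (cases "s = t")
  case True
  then show ?thesis using assms by (intro exI[of _ "d s *\<^sub>R \<alpha> s"]) simp
next
  case False
  define c where "c = \<alpha> s \<bullet> \<alpha> t"
  have "- 1 < c"
  proof -
    have "cos (pi / real (coxeter_exponent W s t)) < cos 0"
      using exponent_ge_2[OF assms False] by (intro cos_monotone_0_pi) (auto simp: divide_simps)
    then show ?thesis unfolding c_def using gram[OF assms] by simp
  qed
  moreover have "c \<le> 0" unfolding c_def using gram_nonpos assms False by blast
  ultimately have "\<bar>c\<bar> < 1" by simp
  then have c: "1 - c * c \<noteq> 0" by (metis abs_square_less_1 less_numeral_extra(4) power2_eq_square right_minus_eq)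
  define e where "e = 1 / (1 - c * c)"
  have e: "e * (1 - c * c) = 1" using c by (simp add: e_def)
  define a where "a = (d s - d t * c) * e"
  define b where "b = (d t - d s * c) * e"
  have "a + b * c = d s * (e * (1 - c * c))" "a * c + b = d t * (e * (1 - c * c))"
    by (simp_all add: a_def b_def algebra_simps)
  then have "a + b * c = d s" "a * c + b = d t" using e by simp_all
  then show ?thesis using assms
    by (intro exI[of _ "a *\<^sub>R \<alpha> s + b *\<^sub>R \<alpha> t"])
      (auto simp: inner_add_left c_def inner_commute[of "\<alpha> t" "\<alpha> s"])
qed

text \<open>On the first coordinate the relator acts through its product, which is one. The last
  coordinate follows because the functional \<open>g\<close> is invariant under both lifted
  reflections: \<open>k\<close> has product \<open>d s\<close> with \<alpha> s and
  \<open>d t\<close> with \<alpha> t.\<close>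

lemma lift_relator:
  assumes "s \<in> S" "t \<in> S"
  shows "lift_word d (concat (replicate (coxeter_exponent W s t) [s, t])) z = z"
proof -
  obtain k where k: "k \<bullet> \<alpha> s = d s" "k \<bullet> \<alpha> t = d t" using ex_inner_pair assms by blast
  define g where "g z = snd z - k \<bullet> fst z" for z :: "'v \<times> real"
  have g: "g (lift_word d ws z) = g z" if "ws \<in> lists {s, t}" for ws
    using that k by (induction ws) (auto simp: g_def lift_gen_def inner_diff_right inner_commute)
  have words: "concat (replicate m [s, t]) \<in> lists {s, t}" for m
    by (induction m) auto
  have prod: "word_prod W (concat (replicate m [s, t])) = (s \<otimes> t) [^] m" for m
  proof (induction m)
    case (Suc m)
    then have "word_prod W (concat (replicate (Suc m) [s, t])) = (s \<otimes> t) \<otimes> (s \<otimes> t) [^] m"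
      using assms by (simp add: m_assoc)
    then show ?case using assms using nat_pow_Suc2[of "s \<otimes> t" m] by (metis S_in_carrier m_closed)
  qed simp
  let ?r = "concat (replicate (coxeter_exponent W s t) [s, t])"
  have rS: "?r \<in> lists S" using words assms by (metis empty_subsetI in_mono insert_subset lists_mono)
  have "word_prod W ?r = \<one>"
    unfolding prod coxeter_exponent_def using assms pow_ord_eq_1 by simp
  then have "fst (lift_word d ?r z) = fst z"
    using fst_lift_word[OF rS] by simp
  moreover have "snd (lift_word d ?r z) = snd z"
    using g[OF words, of "coxeter_exponent W s t"] calculation by (simp add: g_def)
  ultimately show ?thesis by (simp add: prod_eq_iff)
qed

lemma lift_word_one:
  assumes "ws \<in> lists S" "word_prod W ws = \<one>"
  shows "lift_word d ws = id"
proof -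
  have step: "lift_word d us = lift_word d vs" if "(us, vs) \<in> coxeter_step W S" for us vs
    using that by (auto simp only: coxeter_step_def mem_Collect_eq prod.inject lift_word_simps lift_relator fun_eq_iff)
  have "lift_word d us = lift_word d vs"
    if "(us, vs) \<in> (coxeter_step W S \<union> (coxeter_step W S)\<inverse>)\<^sup>*" for us vs
    using that
  proof (induction rule: rtrancl_induct)
    case (step y z)
    then show ?case using \<open>\<And>vs us. (us, vs) \<in> coxeter_step W S \<Longrightarrow> lift_word d us = lift_word d vs\<close> by auto
  qed simp
  then show ?thesis using presentation[OF assms] by (auto simp: fun_eq_iff)
qed

lemma lift_word_rev: "ws \<in> lists S \<Longrightarrow> lift_word d ws (lift_word d (rev ws) z) = z"
  by (induction ws arbitrary: z) (auto simp: lift_gen_involution)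

lemma lift_word_cong:
  assumes "us \<in> lists S" "vs \<in> lists S" "word_prod W us = word_prod W vs"
  shows "lift_word d us z = lift_word d vs z"
proof -
  have "word_prod W (us @ rev vs) = \<one>"
    using assms by (simp add: word_prod_append word_prod_rev)
  then have "lift_word d us (lift_word d (rev vs) z') = z'" for z'
    using fun_cong[OF lift_word_one[of "us @ rev vs" d]] assms by simp
  moreover have "lift_word d (rev vs) (lift_word d vs z) = z"
    using lift_word_rev[of "rev vs"] assms by simp
  ultimately show ?thesis by metis
qed

text \<open>The last coordinate, summed over the lifted group, is an invariant functional
  \<open>F\<close>. A lifted reflection negates the vector (\<alpha> s, d s), so \<open>F\<close>
  kills all these vectors and their combinations. A relation among the \<alpha> s yields the
  combination (0, y), on which \<open>F\<close> is |W| times y.\<close>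

lemma alpha_relation_trivial:
  assumes "(\<Sum>s\<in>S. c s *\<^sub>R \<alpha> s) = 0"
  shows "(\<Sum>s\<in>S. c s * d s) = 0"
proof -
  \<comment> \<open>Any word for x will do: by \<open>lift_word_cong\<close> its lift depends only
    on x.\<close>
  define word where "word x = (SOME ws. ws \<in> lists S \<and> word_prod W ws = x)" for x
  have word: "word x \<in> lists S" "word_prod W (word x) = x" if "x \<in> carrier W" for x
  proof -
    have "\<exists>ws. ws \<in> lists S \<and> word_prod W ws = x"
      using that generate_eq_words[of S] generate_S by auto
    then have "word x \<in> lists S \<and> word_prod W (word x) = x"
      unfolding word_def by (rule someI_ex)
    then show "word x \<in> lists S" "word_prod W (word x) = x" by auto
  qed
  define F where "F z = (\<Sum>x\<in>carrier W. snd (lift_word d (word x) z))" for z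
  have lin: "linear F"
    unfolding F_def
    by (intro linear_compose_sum ballI linear_compose[OF linear_lift_word linear_snd, unfolded o_def])
  have inv: "F (lift_gen d s z) = F z" if s: "s \<in> S" for s z
  proof -
    have "F (lift_gen d s z) = (\<Sum>x\<in>carrier W. snd (lift_word d (word x @ [s]) z))"
      by (simp add: F_def)
    also have "\<dots> = (\<Sum>x\<in>carrier W. snd (lift_word d (word (x \<otimes> s)) z))"
    proof (rule sum.cong)
      fix x assume x: "x \<in> carrier W"
      then have "lift_word d (word x @ [s]) z = lift_word d (word (x \<otimes> s)) z"
        using s word[of x] word[of "x \<otimes> s"] by (intro lift_word_cong) (auto simp: word_prod_append)
      then show "snd (lift_word d (word x @ [s]) z) = snd (lift_word d (word (x \<otimes> s)) z)" by simp
    qed simp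
    also have "\<dots> = F z"
      unfolding F_def using s
      by (intro sum.reindex_bij_witness[of _ "\<lambda>x. x \<otimes> s" "\<lambda>x. x \<otimes> s"]) auto
    finally show ?thesis .
  qed
  have "F (\<alpha> s, d s) = 0" if "s \<in> S" for s
  proof -
    have "lift_gen d s (\<alpha> s, d s) = - (\<alpha> s, d s)"
      using that by (simp add: lift_gen_def scaleR_2)
    then have "F (\<alpha> s, d s) = F (- (\<alpha> s, d s))" using inv[OF that, of "(\<alpha> s, d s)"] by simp
    also have "\<dots> = - F (\<alpha> s, d s)" by (rule linear_neg[OF lin])
    finally show ?thesis by simp
  qed
  then have "F (\<Sum>s\<in>S. c s *\<^sub>R (\<alpha> s, d s)) = 0"
    by (simp add: linear_sum[OF lin] linear_cmul[OF lin] del: scaleR_Pair)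
  moreover have "(\<Sum>s\<in>S. c s *\<^sub>R (\<alpha> s, d s)) = (0, \<Sum>s\<in>S. c s * d s)"
    using assms by (simp add: prod_eq_iff fst_sum snd_sum)
  moreover have "F (0, y) = real (card (carrier W)) * y" for y
    by (simp add: F_def lift_word_fixes)
  moreover have "card (carrier W) \<noteq> 0" using finite_W by auto
  ultimately show ?thesis by simp
qed

text \<open>The free parameter d of the lift is set to c, which turns the conclusion into a
  vanishing sum of squares.\<close>

lemma alpha_coefficients_zero:
  assumes "(\<Sum>s\<in>S. c s *\<^sub>R \<alpha> s) = 0" "s \<in> S"
  shows "c s = 0"
proof -
  have "(\<Sum>s\<in>S. c s * c s) = 0" using alpha_relation_trivial assms by blast
  then show ?thesis using assms finite_S by (simp add: sum_nonneg_eq_0_iff)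
qed

lemma independent_alpha: "independent (\<alpha> ` S)"
proof (rule independent_if_scalars_zero)
  fix f x assume "(\<Sum>x\<in>\<alpha> ` S. f x *\<^sub>R x) = 0" "x \<in> \<alpha> ` S"
  then show "f x = 0"
    using alpha_coefficients_zero[of "\<lambda>s. f (\<alpha> s)"] by (auto simp: sum.reindex[OF inj_alpha])
qed (simp add: finite_S)

text \<open>The equality of |S| with the dimension enters here and makes the independent simple
  roots a basis.\<close>

lemma span_alpha: "span (\<alpha> ` S) = UNIV"
proof -
  have "dim (\<alpha> ` S) = DIM('v)"
    using dim_eq_card_independent[OF independent_alpha] card_S by (simp add: card_image[OF inj_alpha])
  then show ?thesis using dim_eq_full by blast
qed

lemma ex_inner_alpha: "\<exists>x. \<forall>s\<in>S. x \<bullet> \<alpha> s = c s"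
proof -
  obtain f :: "'v \<Rightarrow> real" where f: "linear f" "\<forall>x\<in>\<alpha> ` S. f x = c (the_inv_into S \<alpha> x)"
    using linear_independent_extend[OF independent_alpha, of "\<lambda>x. c (the_inv_into S \<alpha> x)"]
    by blast
  \<comment> \<open>The Riesz vector of the functional \<open>f\<close>, written in
    coordinates.\<close>
  define x where "x = (\<Sum>b\<in>Basis. f b *\<^sub>R b)"
  have "f v = x \<bullet> v" for v
  proof -
    have "f v = f (\<Sum>b\<in>Basis. (v \<bullet> b) *\<^sub>R b)" by (simp add: euclidean_representation)
    also have "\<dots> = x \<bullet> v"
      by (simp add: linear_sum[OF f(1)] linear_cmul[OF f(1)] x_def inner_sum_left inner_commute[of v] mult.commute)
    finally show ?thesis .
  qed
  then have "x \<bullet> \<alpha> s = c s" if "s \<in> S" for s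
    using that f(2) by (simp add: the_inv_into_f_f[OF inj_alpha] flip: \<open>\<And>v. f v = x \<bullet> v\<close>)
  then show ?thesis by blast
qed

text \<open>The basis dual to the simple roots (fundamental weights up to scaling):
  \<open>\<omega> s \<bullet> v\<close> is the coefficient of v at \<alpha> s.\<close>

definition \<omega> :: "'g \<Rightarrow> 'v" where
  "\<omega> s = (SOME x. \<forall>t\<in>S. x \<bullet> \<alpha> t = (if t = s then 1 else 0))"

lemma omega_alpha: "t \<in> S \<Longrightarrow> \<omega> s \<bullet> \<alpha> t = (if t = s then 1 else 0)"
  using someI_ex[OF ex_inner_alpha[of "\<lambda>t. if t = s then 1 else 0"]] unfolding \<omega>_def by blast

lemma alpha_expansion: "v = (\<Sum>s\<in>S. (\<omega> s \<bullet> v) *\<^sub>R \<alpha> s)"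
proof -
  have "v \<in> span (\<alpha> ` S)" by (simp add: span_alpha)
  then obtain c where c: "v = (\<Sum>s\<in>S. c s *\<^sub>R \<alpha> s)"
    using finite_S by (auto simp: span_finite sum.reindex[OF inj_alpha])
  have "\<omega> s \<bullet> v = c s" if "s \<in> S" for s
    using that finite_S by (simp add: c inner_sum_right omega_alpha if_distrib cong: if_cong)
  then show ?thesis using c by simp
qed

lemma inner_expansion: "x \<bullet> v = (\<Sum>s\<in>S. (\<omega> s \<bullet> v) * (x \<bullet> \<alpha> s))"
  using arg_cong[OF alpha_expansion[of v], of "\<lambda>v. x \<bullet> v"] by (simp add: inner_sum_right)


section \<open>Positive and negative roots\<close>

definition nonneg :: "'v \<Rightarrow> bool" where
  "nonneg v \<longleftrightarrow> (\<forall>s\<in>S. 0 \<le> \<omega> s \<bullet> v)"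

lemma nonneg_alpha [simp]: "s \<in> S \<Longrightarrow> nonneg (\<alpha> s)"
  by (auto simp: nonneg_def omega_alpha)

lemma nonneg_zero [simp]: "nonneg 0"
  by (simp add: nonneg_def)

lemma nonneg_add: "nonneg v \<Longrightarrow> nonneg w \<Longrightarrow> nonneg (v + w)"
  by (simp add: nonneg_def inner_add_right)

lemma nonneg_scale: "0 \<le> c \<Longrightarrow> nonneg v \<Longrightarrow> nonneg (c *\<^sub>R v)"
  by (simp add: nonneg_def)

lemma nonneg_sum: "(\<And>i. i \<in> A \<Longrightarrow> nonneg (f i)) \<Longrightarrow> nonneg (\<Sum>i\<in>A. f i)"
  by (auto simp: nonneg_def inner_sum_right intro!: sum_nonneg)

lemma nonneg_scaleD: "0 < c \<Longrightarrow> nonneg (c *\<^sub>R v) \<Longrightarrow> nonneg v"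
  by (auto simp: nonneg_def zero_le_mult_iff)

lemma coefficients_eqI: "(\<And>s. s \<in> S \<Longrightarrow> \<omega> s \<bullet> v = \<omega> s \<bullet> w) \<Longrightarrow> v = w"
  using alpha_expansion[of v] alpha_expansion[of w] by (metis (no_types, lifting) sum.cong)

lemma nonneg_antisym: "nonneg v \<Longrightarrow> nonneg (- v) \<Longrightarrow> v = 0"
  by (rule coefficients_eqI) (force simp: nonneg_def)

text \<open>The alternating product of k letters whose rightmost letter is t. It grows on the left,
  so that it acts by applying t first.\<close>

primrec alt :: "'g \<Rightarrow> 'g \<Rightarrow> nat \<Rightarrow> 'g" where
  "alt s t 0 = \<one>"
| "alt s t (Suc k) = (if even k then t else s) \<otimes> alt s t k"

lemma alt_closed [simp]: "s \<in> S \<Longrightarrow> t \<in> S \<Longrightarrow> alt s t k \<in> carrier W"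
  by (induction k) auto

lemma len_alt: "s \<in> S \<Longrightarrow> t \<in> S \<Longrightarrow> len (alt s t k) \<le> k"
proof (induction k)
  case (Suc k)
  then have "len (alt s t (Suc k)) \<le> len (if even k then t else s) + len (alt s t k)"
    by (auto intro!: len_mult)
  moreover have "len (if even k then t else s) \<le> 1" using len_S Suc.prems by auto
  ultimately show ?case using Suc by linarith
qed simp

lemma alt_Suc_right: "s \<in> S \<Longrightarrow> t \<in> S \<Longrightarrow> alt t s (Suc k) = alt s t k \<otimes> s"
proof (induction k)
  case (Suc k)
  have "alt t s (Suc (Suc k)) = (if even k then t else s) \<otimes> alt t s (Suc k)" by simp
  also have "\<dots> = (if even k then t else s) \<otimes> (alt s t k \<otimes> s)" using Suc by simp
  also have "\<dots> = alt s t (Suc k) \<otimes> s" using Suc.prems by (simp add: m_assoc)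
  finally show ?case .
qed simp

lemma alt_power:
  assumes "s \<in> S" "t \<in> S"
  shows "alt s t (2 * k) = (s \<otimes> t) [^] k"
proof (induction k)
  case (Suc k)
  then have "alt s t (2 * Suc k) = (s \<otimes> t) \<otimes> (s \<otimes> t) [^] k" using assms by (simp add: m_assoc)
  then show ?case using nat_pow_Suc2[of "s \<otimes> t" k] assms by (metis S_in_carrier m_closed)
qed simp

text \<open>The relation \<open>(s t)^m = 1\<close> in its braid form. Half of the power is moved to
  the other side as an inverse; an odd m leaves one letter over.\<close>

lemma alt_braid:
  assumes s: "s \<in> S" and t: "t \<in> S" and m: "m = coxeter_exponent W s t"
  shows "alt s t m = alt t s m"
proof -
  define x where "x = s \<otimes> t"
  have x: "x \<in> carrier W" "inv x = t \<otimes> s" "s \<otimes> x = t"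
    using s t by (auto simp: x_def inv_mult_group)
  have m1: "x [^] m = \<one>"
    unfolding m coxeter_exponent_def x_def using s t by (simp add: pow_ord_eq_1)
  have ts: "alt t s (2 * k) = inv (x [^] k)" for k
    using alt_power[OF t s, of k, folded x(2)] nat_pow_inv[OF x(1)] by simp
  obtain k where "m = 2 * k \<or> m = Suc (2 * k)" by (metis oddE evenE Suc_eq_plus1)
  then show ?thesis
  proof
    assume k: "m = 2 * k"
    then have "x [^] k \<otimes> x [^] k = \<one>" using m1 x by (simp add: nat_pow_mult mult_2)
    then show ?thesis unfolding k ts alt_power[OF s t] x_def[symmetric] using x
      by (simp add: inv_equality)
  next
    assume k: "m = Suc (2 * k)"
    have "x \<otimes> x [^] k \<otimes> x [^] k = x [^] m"
      using x nat_pow_Suc2[of x "k + k"] by (simp add: k nat_pow_mult m_assoc mult_2 del: nat_pow_Suc)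
    then have "inv (x [^] k) = x \<otimes> x [^] k" using x m1 by (intro inv_equality) auto
    then have "s \<otimes> inv (x [^] k) = t \<otimes> x [^] k"
      using x s by (metis S_in_carrier m_assoc nat_pow_closed)
    then show ?thesis unfolding k alt.simps ts alt_power[OF s t] x_def[symmetric] by simp
  qed
qed

text \<open>In the plane of two simple roots the coordinates of the dihedral orbit are quotients of
  sines by sin \<theta>; multiplying by sin \<theta> avoids the division. The induction is the
  recursion expressing sin ((k + 2) \<theta>) by the two preceding sines.\<close>

lemma rho_alt:
  assumes s: "s \<in> S" and t: "t \<in> S" and th: "\<theta> = pi / real (coxeter_exponent W s t)"
  shows "sin \<theta> *\<^sub>R \<rho> (alt s t k) (\<alpha> s) =
    (if even k then sin (real (k + 1) * \<theta>) *\<^sub>R \<alpha> s + sin (real k * \<theta>) *\<^sub>R \<alpha> t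
     else sin (real k * \<theta>) *\<^sub>R \<alpha> s + sin (real (k + 1) * \<theta>) *\<^sub>R \<alpha> t)"
proof (induction k)
  case (Suc k)
  have rec: "sin (real (Suc k + 1) * \<theta>) = 2 * cos \<theta> * sin (real (k + 1) * \<theta>) - sin (real k * \<theta>)"
  proof -
    have "sin (real (Suc k + 1) * \<theta>) = sin (real (k + 1) * \<theta> + \<theta>)" by (simp add: algebra_simps)
    moreover have "sin (real k * \<theta>) = sin (real (k + 1) * \<theta> - \<theta>)" by (simp add: algebra_simps)
    ultimately show ?thesis unfolding sin_add sin_diff by simp
  qed
  have c: "\<alpha> s \<bullet> \<alpha> t = - cos \<theta>" "\<alpha> t \<bullet> \<alpha> s = - cos \<theta>"
    using gram[OF s t] th by (simp_all add: inner_commute)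
  have "sin \<theta> *\<^sub>R \<rho> (alt s t (Suc k)) (\<alpha> s) =
    \<rho> (if even k then t else s) (sin \<theta> *\<^sub>R \<rho> (alt s t k) (\<alpha> s))"
    using s t by (simp add: rho_scale)
  also have "\<dots> = (if even (Suc k) then sin (real (Suc k + 1) * \<theta>) *\<^sub>R \<alpha> s + sin (real (Suc k) * \<theta>) *\<^sub>R \<alpha> t
     else sin (real (Suc k) * \<theta>) *\<^sub>R \<alpha> s + sin (real (Suc k + 1) * \<theta>) *\<^sub>R \<alpha> t)"
    unfolding Suc rec using s t c
    by (simp add: rho_add rho_scale rho_gen algebra_simps) (simp flip: scaleR_left_distrib)
  finally show ?case .
qed (use s t in simp)

text \<open>
  Writing \<open>x = v a\<close> with \<open>a\<close> the longest possible alternating word in \<open>s\<close> and a right descent \<open>t\<close>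
  of \<open>x\<close> reduces the claim to \<open>v\<close> and to the dihedral group generated by \<open>s\<close> and \<open>t\<close>.
\<close>

lemma nonneg_if_len_le:
  "x \<in> carrier W \<Longrightarrow> s \<in> S \<Longrightarrow> len x \<le> len (x \<otimes> s) \<Longrightarrow> nonneg (\<rho> x (\<alpha> s))"
proof (induction "len x" arbitrary: x s rule: less_induct)
  case less
  note x = less.prems(1) and s = less.prems(2) and le = less.prems(3)
  show ?case
  proof (cases "x = \<one>")
    case False
    then obtain t where t: "t \<in> S" "len x = Suc (len (x \<otimes> t))" using ex_descent x by blast
    then have "t \<noteq> s" using le by auto
    define m where "m = coxeter_exponent W s t"
    have m2: "2 \<le> m" unfolding m_def using exponent_ge_2 s t \<open>t \<noteq> s\<close> by blast
    define P where "P k \<longleftrightarrow> (\<exists>v\<in>carrier W. x = v \<otimes> alt s t k \<and> len x = len v + k)" for k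
    have "P 1" unfolding P_def using x t by (intro bexI[of _ "x \<otimes> t"]) auto
    have down: "P k" if PS: "P (Suc k)" for k
    proof -
      obtain v where v: "v \<in> carrier W" "x = v \<otimes> alt s t (Suc k)" "len x = len v + Suc k"
        using PS unfolding P_def by (elim bexE conjE)
      define r where "r = (if even k then t else s)"
      have r: "r \<in> S" using s t by (simp add: r_def)
      have eq: "x = (v \<otimes> r) \<otimes> alt s t k" using v r s t by (simp add: r_def m_assoc)
      have "len x \<le> len (v \<otimes> r) + k"
        unfolding eq using len_mult[of "v \<otimes> r" "alt s t k"] len_alt[OF s t(1), of k] v r s t by simp
      moreover have "len (v \<otimes> r) \<le> len v + 1" using len_mult[of v r] len_S[of r] v r by simp
      ultimately have "len x = len (v \<otimes> r) + k" using v by linarith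
      then show ?thesis unfolding P_def using eq v r by (intro bexI[of _ "v \<otimes> r"]) auto
    qed
    have "\<exists>k. P k \<and> (\<forall>l. P l \<longrightarrow> l \<le> k)"
    proof (rule ex_has_greatest_nat[where P = P and f = "\<lambda>k. k" and k = 1 and b = "Suc (len x)"])
      show "\<forall>y. P y \<longrightarrow> y < Suc (len x)" by (auto simp: P_def)
    qed (fact \<open>P 1\<close>)
    then obtain k where k: "P k" "\<And>l. P l \<Longrightarrow> l \<le> k" by blast
    have "1 \<le> k" using k(2) \<open>P 1\<close> by blast
    then obtain j where j: "k = Suc j" by (cases k) auto
    \<comment> \<open>Were k at least m, the braid relation would let the alternating part of length
      m end in s, and \<open>x \<otimes> s\<close> would be shorter than x.\<close>
    have "k < m"
    proof (rule ccontr)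
      assume "\<not> k < m"
      then have "m \<le> k" by simp
      then have "P m" using k(1)
        by (induction rule: dec_induct) (auto dest: down)
      then obtain v where v: "v \<in> carrier W" "x = v \<otimes> alt s t m" "len x = len v + m"
        unfolding P_def by (elim bexE conjE)
      obtain i where i: "m = Suc i" using m2 by (cases m) auto
      have "x = v \<otimes> (alt s t i \<otimes> s)"
        unfolding v(2) alt_braid[OF s t(1) m_def] unfolding i alt_Suc_right[OF s t(1)] ..
      then have "x \<otimes> s = v \<otimes> alt s t i" using v s t by (simp add: m_assoc S_square)
      then have "len (x \<otimes> s) \<le> len v + i"
        using len_mult[of v "alt s t i"] len_alt[OF s t(1), of i] v s t by simp
      then show False using le v i by simp
    qed
    obtain v where v: "v \<in> carrier W" "x = v \<otimes> alt s t k" "len x = len v + k"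
      using k(1) unfolding P_def by (elim bexE conjE)
    \<comment> \<open>A descent r of v either continues the alternating word, against the maximality
      of k, or cancels against its leftmost letter, against the additivity of lengths.\<close>
    have ge: "len v \<le> len (v \<otimes> r)" if r_mem: "r \<in> {s, t}" for r
    proof (rule ccontr)
      assume "\<not> len v \<le> len (v \<otimes> r)"
      moreover have r: "r \<in> S" using r_mem s t by auto
      moreover have "len v \<le> len (v \<otimes> r) + 1"
        using len_mult[of "v \<otimes> r" r] len_S[of r] v r by simp
      ultimately have len: "len v = Suc (len (v \<otimes> r))" by linarith
      consider "r = (if even k then t else s)" | "r = (if even j then t else s)"
        using r_mem j by (cases "even j") auto
      then show False
      proof cases
        case 1
        then have "x = (v \<otimes> r) \<otimes> alt s t (Suc k)" using v r s t by (simp add: m_assoc)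
        then have "P (Suc k)" unfolding P_def using v r len by (intro bexI[of _ "v \<otimes> r"]) auto
        then show False using k(2) by fastforce
      next
        case 2
        then have "x = (v \<otimes> r) \<otimes> alt s t j" using v r s t j by (simp add: m_assoc)
        then have "len x \<le> len (v \<otimes> r) + j"
          using len_mult[of "v \<otimes> r" "alt s t j"] len_alt[OF s t(1), of j] v r s t by simp
        then show False using v len j by simp
      qed
    qed
    have nn: "nonneg (\<rho> v (\<alpha> s))" "nonneg (\<rho> v (\<alpha> t))"
      using less.hyps[of v s] less.hyps[of v t] ge v s t j by auto
    define \<theta> where "\<theta> = pi / real m"
    \<comment> \<open>The multiples i \<theta> stay in [0, pi] for i \<le> m; only i = k and i = k +
      1 are used below, and k < m.\<close>
    have bound: "0 \<le> sin (real i * \<theta>)" if "i \<le> m" for i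
      unfolding \<theta>_def using that m2 by (intro sin_ge_zero) (auto simp: divide_simps)
    have "0 < sin \<theta>"
      unfolding \<theta>_def using m2 by (intro sin_gt_zero) (auto simp: divide_simps)
    moreover have "nonneg (sin \<theta> *\<^sub>R \<rho> x (\<alpha> s))"
    proof -
      have "sin \<theta> *\<^sub>R \<rho> x (\<alpha> s) = \<rho> v (sin \<theta> *\<^sub>R \<rho> (alt s t k) (\<alpha> s))"
        using v s t by (simp add: rho_scale)
      also have "nonneg \<dots>"
        unfolding rho_alt[OF s t(1) \<theta>_def[unfolded m_def]]
        using v nn bound[of k] bound[of "k + 1"] \<open>k < m\<close>
        by (auto simp: rho_add rho_scale intro!: nonneg_add nonneg_scale)
      finally show ?thesis .
    qed
    ultimately show ?thesis by (rule nonneg_scaleD)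
  qed (use s in simp)
qed

lemma rho_alpha_nonzero: "x \<in> carrier W \<Longrightarrow> s \<in> S \<Longrightarrow> \<rho> x (\<alpha> s) \<noteq> 0"
  by (metis alpha_nonzero rho_eq_iff rho_zero)

lemma rho_gen_alpha [simp]: "s \<in> S \<Longrightarrow> \<rho> s (\<alpha> s) = - \<alpha> s"
  by (simp add: rho_gen scaleR_2)

lemma not_nonneg_if_len_le:
  assumes "x \<in> carrier W" "s \<in> S" "len (x \<otimes> s) \<le> len x"
  shows "nonneg (- \<rho> x (\<alpha> s))"
  using nonneg_if_len_le[of "x \<otimes> s" s] assms by simp

lemma len_greater_iff_nonneg:
  assumes "x \<in> carrier W" "s \<in> S"
  shows "len (x \<otimes> s) < len x \<longleftrightarrow> nonneg (- \<rho> x (\<alpha> s))"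
  using nonneg_if_len_le[OF assms] not_nonneg_if_len_le[OF assms] rho_alpha_nonzero[OF assms]
    nonneg_antisym by fastforce

section \<open>The root system\<close>

definition roots :: "'v set" where
  "roots = {\<rho> x (\<alpha> s) | x s. x \<in> carrier W \<and> s \<in> S}"

lemma root_nonneg_cases: "\<beta> \<in> roots \<Longrightarrow> nonneg \<beta> \<or> nonneg (- \<beta>)"
  unfolding roots_def using nonneg_if_len_le not_nonneg_if_len_le nat_le_linear by blast

lemma root_unit: "\<beta> \<in> roots \<Longrightarrow> \<beta> \<bullet> \<beta> = 1"
  by (auto simp: roots_def)

lemma root_nonzero: "\<beta> \<in> roots \<Longrightarrow> \<beta> \<noteq> 0"
  using root_unit by fastforce

lemma alpha_root [simp]: "s \<in> S \<Longrightarrow> \<alpha> s \<in> roots"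
  unfolding roots_def by (metis (mono_tags, lifting) mem_Collect_eq one_closed rho_one)

lemma rho_root [simp]: "x \<in> carrier W \<Longrightarrow> \<beta> \<in> roots \<Longrightarrow> \<rho> x \<beta> \<in> roots"
  unfolding roots_def by (auto simp flip: rho_mult) (use m_closed in blast)

lemma uminus_root: "\<beta> \<in> roots \<Longrightarrow> - \<beta> \<in> roots"
proof -
  assume "\<beta> \<in> roots"
  then obtain x s where x: "x \<in> carrier W" "s \<in> S" "\<beta> = \<rho> x (\<alpha> s)" by (auto simp: roots_def)
  then have "- \<beta> = \<rho> (x \<otimes> s) (\<alpha> s)" by simp
  then show ?thesis unfolding roots_def using x by (metis (mono_tags, lifting) S_in_carrier m_closed mem_Collect_eq)
qed

lemma finite_roots: "finite roots"
proof -
  have "roots = (\<lambda>(x, s). \<rho> x (\<alpha> s)) ` (carrier W \<times> S)" by (auto simp: roots_def)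
  then show ?thesis using finite_W finite_S by simp
qed

lemma root_proportional:
  assumes "\<beta> \<in> roots" "\<gamma> \<in> roots" "\<beta> = c *\<^sub>R \<gamma>"
  shows "\<beta> = \<gamma> \<or> \<beta> = - \<gamma>"
proof -
  have "c * c = 1" using root_unit[OF assms(1)] root_unit[OF assms(2)] assms(3) by simp
  then have "c = 1 \<or> c = -1" by (metis power2_eq_square power2_eq_1_iff)
  then show ?thesis using assms(3) by auto
qed

section \<open>Parabolic subgroups\<close>

text \<open>\<open>spanned K v\<close> says that \<open>v\<close> lies in the span of the simple roots indexed by \<open>K\<close>.\<close>

definition spanned :: "'g set \<Rightarrow> 'v \<Rightarrow> bool" where
  "spanned K v \<longleftrightarrow> (\<forall>s\<in>S - K. \<omega> s \<bullet> v = 0)"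

lemma spanned_alpha [simp]: "s \<in> K \<Longrightarrow> s \<in> S \<Longrightarrow> spanned K (\<alpha> s)"
  by (auto simp: spanned_def omega_alpha)

lemma spanned_diff: "spanned K v \<Longrightarrow> spanned K w \<Longrightarrow> spanned K (v - w)"
  and spanned_scale: "spanned K v \<Longrightarrow> spanned K (c *\<^sub>R v)"
  and spanned_uminus: "spanned K (- v) \<longleftrightarrow> spanned K v"
  by (simp_all add: spanned_def inner_diff_right)

lemma spanned_expansion:
  assumes "K \<subseteq> S" "spanned K v"
  shows "v = (\<Sum>s\<in>K. (\<omega> s \<bullet> v) *\<^sub>R \<alpha> s)"
proof -
  have "(\<Sum>s\<in>K. (\<omega> s \<bullet> v) *\<^sub>R \<alpha> s) = (\<Sum>s\<in>S. (\<omega> s \<bullet> v) *\<^sub>R \<alpha> s)"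
    using assms finite_S by (intro sum.mono_neutral_left) (auto simp: spanned_def)
  then show ?thesis using alpha_expansion[of v] by simp
qed

lemma spanned_inner:
  assumes "K \<subseteq> S" "spanned K v"
  shows "x \<bullet> v = (\<Sum>s\<in>K. (\<omega> s \<bullet> v) * (x \<bullet> \<alpha> s))"
  using arg_cong[OF spanned_expansion[OF assms], of "\<lambda>v. x \<bullet> v"] by (simp add: inner_sum_right)

lemma generate_induct [consumes 2, case_names one gen]:
  assumes "K \<subseteq> S" "x \<in> generate W K"
    and "P \<one>"
    and "\<And>s x. s \<in> K \<Longrightarrow> x \<in> generate W K \<Longrightarrow> P x \<Longrightarrow> P (s \<otimes> x)"
  shows "P x"
proof -
  obtain ws where "ws \<in> lists K" "x = word_prod W ws"
    using assms(2) generate_eq_words[OF assms(1)] by auto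
  moreover have "ws \<in> lists K \<Longrightarrow> word_prod W ws \<in> generate W K" for ws
    using generate_eq_words[OF assms(1)] by auto
  then have "ws \<in> lists K \<Longrightarrow> P (word_prod W ws)"
    by (induction ws) (auto intro: assms(3,4))
  ultimately show ?thesis by simp
qed

lemma spanned_rho:
  assumes "K \<subseteq> S" "x \<in> generate W K" "spanned K v"
  shows "spanned K (\<rho> x v)"
  using assms(1,2)
proof (induction rule: generate_induct)
  case one
  then show ?case using assms by simp
next
  case (gen s x)
  then show ?case using assms(1) generate_closed[OF assms(1)]
    by (auto simp: rho_gen subset_iff intro!: spanned_diff spanned_scale)
qed

section \<open>Dominant vectors and their stabilizers\<close>

definition dominant :: "'g set \<Rightarrow> 'v \<Rightarrow> bool" where
  "dominant K v \<longleftrightarrow> (\<forall>s\<in>K. 0 \<le> v \<bullet> \<alpha> s)"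

lemma dominant_inner_nonneg:
  assumes "K \<subseteq> S" "dominant K x" "spanned K v" "nonneg v"
  shows "0 \<le> x \<bullet> v"
proof -
  have "0 \<le> (\<Sum>s\<in>K. (\<omega> s \<bullet> v) * (x \<bullet> \<alpha> s))"
    using assms by (intro sum_nonneg mult_nonneg_nonneg) (auto simp: dominant_def nonneg_def)
  then show ?thesis using spanned_inner[OF assms(1,3), of x] by simp
qed

lemma dominant_reduced:
  assumes "K \<subseteq> S" "reduced_expression W S x ws" "ws \<in> lists K" "dominant K v" "dominant K (\<rho> x v)"
  shows "\<forall>s\<in>set ws. v \<bullet> \<alpha> s = 0"
  using assms(2,3,5)
proof (induction ws arbitrary: x rule: rev_induct)
  case (snoc s ws)
  have s: "s \<in> K" and ws: "ws \<in> lists K" using snoc.prems(2) by auto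
  then have s: "s \<in> K" "s \<in> S" using assms(1) by auto
  have x: "x \<in> carrier W" by (rule reduced_expression_closed[OF snoc.prems(1)])
  have xs: "reduced_expression W S (x \<otimes> s) ws" "len (x \<otimes> s) < len x"
    using reduced_expression_snocD[OF snoc.prems(1)] by auto
  have "word_prod W (ws @ [s]) \<in> generate W K"
    unfolding generate_eq_words[OF assms(1)] using snoc.prems(2) by (rule imageI)
  then have "x \<in> generate W K" using snoc.prems(1) by (simp add: reduced_expression_def)
  then have "spanned K (\<rho> x (\<alpha> s))" using spanned_rho[OF assms(1) _ spanned_alpha[OF s]] by blast
  moreover have "nonneg (- \<rho> x (\<alpha> s))" using len_greater_iff_nonneg[OF x s(2)] xs by simp
  ultimately have "0 \<le> \<rho> x v \<bullet> (- \<rho> x (\<alpha> s))"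
    using snoc.prems(3) by (intro dominant_inner_nonneg[OF assms(1)]) (simp_all add: spanned_uminus)
  then have "v \<bullet> \<alpha> s \<le> 0" using x by simp
  then have zero: "v \<bullet> \<alpha> s = 0" using assms(4) s(1) unfolding dominant_def by (simp add: order_antisym)
  then have "\<rho> (x \<otimes> s) v = \<rho> x v" using x s by (simp add: rho_gen inner_commute)
  then have "\<forall>s\<in>set ws. v \<bullet> \<alpha> s = 0" using snoc.IH[OF xs(1) ws] snoc.prems(3) by simp
  then show ?case using zero by simp
qed simp

lemma rho_fixes_if_orthogonal:
  assumes "K \<subseteq> S" "x \<in> generate W K" "\<And>s. s \<in> K \<Longrightarrow> v \<bullet> \<alpha> s = 0"
  shows "\<rho> x v = v"
  using assms(1,2)
proof (induction rule: generate_induct)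
  case (gen s x)
  then have "s \<in> S" using assms by blast
  then show ?case using gen generate_closed[OF assms(1)] assms(3)[of s]
    by (simp add: rho_gen inner_commute)
qed simp

text \<open>A point in the relative interior of the face of the closed fundamental chamber that lies
  on exactly the walls in K. The value 1 on the other walls makes its product with a vector the sum
  of the coefficients outside K, which for empty K is the height.\<close>

definition generic :: "'g set \<Rightarrow> 'v" where
  "generic K = (SOME x. \<forall>s\<in>S. x \<bullet> \<alpha> s = (if s \<in> K then 0 else 1))"

lemma generic_alpha: "s \<in> S \<Longrightarrow> generic K \<bullet> \<alpha> s = (if s \<in> K then 0 else 1)"
  using someI_ex[OF ex_inner_alpha[of "\<lambda>s. if s \<in> K then 0 else 1"]] unfolding generic_def by blast

lemma dominant_generic: "J \<subseteq> S \<Longrightarrow> dominant J (generic K)"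
  unfolding dominant_def using generic_alpha by (simp add: subset_iff)

text \<open>An element of W_K fixes \<open>generic K\<close>, so by \<open>dominant_reduced\<close>
  every letter of its reduced words is orthogonal to that point, and only letters of K are.\<close>

lemma reduced_in_parabolic:
  assumes "K \<subseteq> S" "x \<in> generate W K" "reduced_expression W S x ws"
  shows "ws \<in> lists K"
proof -
  have ws: "ws \<in> lists S" using assms by (simp add: reduced_expression_def)
  have "\<rho> x (generic K) = generic K"
    using assms by (intro rho_fixes_if_orthogonal[of K]) (auto simp: generic_alpha)
  then have "\<forall>s\<in>set ws. generic K \<bullet> \<alpha> s = 0"
    using dominant_generic[of S K] by (intro dominant_reduced[OF _ assms(3) ws]) auto
  then have "s \<in> K" if "s \<in> set ws" for s
    using that ws generic_alpha[of s K] by (auto simp: in_lists_conv_set split: if_splits)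
  then show ?thesis by blast
qed

lemma fixes_generic_iff:
  assumes "K \<subseteq> S" "x \<in> carrier W"
  shows "\<rho> x (generic K) = generic K \<longleftrightarrow> x \<in> generate W K"
proof
  assume eq: "\<rho> x (generic K) = generic K"
  obtain ws where ws: "reduced_expression W S x ws" using ex_reduced_expression assms by blast
  then have S: "ws \<in> lists S" by (simp add: reduced_expression_def)
  then have "\<forall>s\<in>set ws. generic K \<bullet> \<alpha> s = 0"
    using dominant_generic[of S K] eq by (intro dominant_reduced[OF _ ws]) auto
  then have "s \<in> K" if "s \<in> set ws" for s
    using that S generic_alpha[of s K] by (auto simp: in_lists_conv_set split: if_splits)
  then have "ws \<in> lists K" by blast
  then show "x \<in> generate W K"
    using ws generate_eq_words[OF assms(1)] by (auto simp: reduced_expression_def)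
next
  assume "x \<in> generate W K"
  then show "\<rho> x (generic K) = generic K"
    using assms by (intro rho_fixes_if_orthogonal[of K]) (auto simp: generic_alpha)
qed

lemma dominant_orbit_unique:
  assumes "J \<subseteq> S" "x \<in> generate W J" "dominant J v" "dominant J (\<rho> x v)"
  shows "\<rho> x v = v" "x \<in> generate W {s \<in> J. v \<bullet> \<alpha> s = 0}"
proof -
  let ?K = "{s \<in> J. v \<bullet> \<alpha> s = 0}"
  have KS: "?K \<subseteq> S" using assms by auto
  obtain ws where ws: "reduced_expression W S x ws"
    using ex_reduced_expression[OF generate_closed[OF assms(1,2)]] by blast
  then have J: "ws \<in> lists J" by (rule reduced_in_parabolic[OF assms(1,2)])
  then have "ws \<in> lists ?K"
    using dominant_reduced[OF assms(1) ws J assms(3,4)] by (auto simp: in_lists_conv_set)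
  then show "x \<in> generate W ?K"
    using ws generate_eq_words[OF KS] by (auto simp: reduced_expression_def)
  then show "\<rho> x v = v" by (intro rho_fixes_if_orthogonal[OF KS]) auto
qed

text \<open>In the finite W_J-orbit, a vector with the largest product with
  \<open>generic {}\<close> is dominant: reflecting in a simple root with negative product would
  increase the value.\<close>

lemma ex_dominant:
  assumes "J \<subseteq> S"
  shows "\<exists>x\<in>generate W J. dominant J (\<rho> x v)"
proof -
  define f where "f x = \<rho> x v \<bullet> generic {}" for x
  have fin: "finite (generate W J)" using finite_generate assms by blast
  have ne: "generate W J \<noteq> {}" using generate.one by (metis empty_iff)
  obtain x where x: "x \<in> generate W J" "\<And>y. y \<in> generate W J \<Longrightarrow> f y \<le> f x"
  proof -
    have "Max (f ` generate W J) \<in> f ` generate W J" using fin ne by (intro Max_in) auto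
    then obtain x where "x \<in> generate W J" "f x = Max (f ` generate W J)" by auto
    then show ?thesis using that fin by (metis Max_ge finite_imageI imageI)
  qed
  have "0 \<le> \<rho> x v \<bullet> \<alpha> s" if s: "s \<in> J" for s
  proof -
    have sS: "s \<in> S" and xc: "x \<in> carrier W" using s assms generate_closed[OF assms x(1)] by auto
    have "s \<otimes> x \<in> generate W J" by (rule generate.eng[OF generate.incl[OF s] x(1)])
    then have "f (s \<otimes> x) \<le> f x" using x by blast
    moreover have "\<alpha> s \<bullet> generic {} = 1" using generic_alpha[OF sS, of "{}"] by (simp add: inner_commute)
    ultimately show ?thesis
      using sS xc by (simp add: f_def rho_gen inner_diff_left inner_commute[of "\<alpha> s" "\<rho> x v"])
  qed
  then show ?thesis using x(1) by (auto simp: dominant_def)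
qed

lemma support_subset: "support W S x \<subseteq> S"
  by (auto simp: support_def reduced_expression_def in_lists_conv_set)

text \<open>This replaces words by subgroups: the support of x is the least K with x \<in> W_K, and
  this is how supports are computed below.\<close>

lemma support_subset_iff:
  assumes "K \<subseteq> S" "x \<in> carrier W"
  shows "support W S x \<subseteq> K \<longleftrightarrow> x \<in> generate W K"
proof
  obtain ws where ws: "reduced_expression W S x ws" using ex_reduced_expression assms by blast
  assume "support W S x \<subseteq> K"
  then have "ws \<in> lists K" using ws by (auto simp: support_def in_lists_conv_set)
  then show "x \<in> generate W K"
    using ws generate_eq_words[OF assms(1)] by (auto simp: reduced_expression_def)
next
  assume "x \<in> generate W K"
  then show "support W S x \<subseteq> K"
    using reduced_in_parabolic[OF assms(1)] by (auto simp: support_def in_lists_conv_set)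
qed

lemma in_generate_support: "x \<in> carrier W \<Longrightarrow> x \<in> generate W (support W S x)"
  using support_subset_iff[OF support_subset] by blast


section \<open>Reflections and their supports\<close>

abbreviation T :: "'g set" where "T \<equiv> reflections W S"

lemma conj_by_closed [simp]: "x \<in> carrier W \<Longrightarrow> y \<in> carrier W \<Longrightarrow> conj_by W x y \<in> carrier W"
  by (simp add: conj_by_def)

lemma conj_by_one [simp]: "x \<in> carrier W \<Longrightarrow> conj_by W x \<one> = x"
  by (simp add: conj_by_def)

lemma conj_by_mult:
  "x \<in> carrier W \<Longrightarrow> y \<in> carrier W \<Longrightarrow> z \<in> carrier W \<Longrightarrow>
    conj_by W (conj_by W x y) z = conj_by W x (y \<otimes> z)"
  by (simp add: conj_by_def inv_mult_group m_assoc)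

lemma conj_by_inv_cancel [simp]:
  "x \<in> carrier W \<Longrightarrow> y \<in> carrier W \<Longrightarrow> conj_by W (conj_by W x y) (inv y) = x"
  "x \<in> carrier W \<Longrightarrow> y \<in> carrier W \<Longrightarrow> conj_by W (conj_by W x (inv y)) y = x"
  by (simp_all add: conj_by_mult)

lemma conj_by_eq_iff [simp]:
  "x \<in> carrier W \<Longrightarrow> x' \<in> carrier W \<Longrightarrow> y \<in> carrier W \<Longrightarrow> conj_by W x y = conj_by W x' y \<longleftrightarrow> x = x'"
  by (metis conj_by_inv_cancel(1))

lemma T_closed [simp]: "t \<in> T \<Longrightarrow> t \<in> carrier W"
  by (auto simp: reflections_def)

lemma S_subset_T: "s \<in> S \<Longrightarrow> s \<in> T"
proof -
  assume "s \<in> S"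
  then have "s = conj_by W s \<one>" "s \<in> S" by simp_all
  then show ?thesis unfolding reflections_def by blast
qed

lemma reflectionE:
  assumes "t \<in> T"
  obtains s x where "s \<in> S" "x \<in> carrier W" "t = conj_by W s x"
  using assms unfolding reflections_def by blast

lemma conj_by_T [simp]:
  assumes "t \<in> T" "x \<in> carrier W"
  shows "conj_by W t x \<in> T"
proof -
  obtain s y where "s \<in> S" "y \<in> carrier W" "t = conj_by W s y"
    using assms(1) by (rule reflectionE)
  then have "s \<in> S" "y \<otimes> x \<in> carrier W" "conj_by W t x = conj_by W s (y \<otimes> x)"
    using assms(2) by (simp_all add: conj_by_mult)
  then show ?thesis unfolding reflections_def by blast
qed

lemma rho_conj_by: "x \<in> carrier W \<Longrightarrow> y \<in> carrier W \<Longrightarrow> \<rho> (conj_by W x y) v = \<rho> (inv y) (\<rho> x (\<rho> y v))"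
  by (simp add: conj_by_def)

lemma ex_root_of:
  assumes "t \<in> T"
  shows "\<exists>\<beta>. \<beta> \<in> roots \<and> nonneg \<beta> \<and> (\<forall>v. \<rho> t v = v - (2 * (\<beta> \<bullet> v)) *\<^sub>R \<beta>)"
proof -
  obtain s x where t: "s \<in> S" "x \<in> carrier W" "t = conj_by W s x"
    using assms by (rule reflectionE)
  define \<beta> where "\<beta> = \<rho> (inv x) (\<alpha> s)"
  have \<beta>: "\<beta> \<in> roots" using t by (simp add: \<beta>_def)
  have "\<rho> t v = v - (2 * (\<beta> \<bullet> v)) *\<^sub>R \<beta>" for v
    using t rho_inner_left[of "inv x" v "\<alpha> s"]
    by (simp add: \<beta>_def rho_conj_by rho_gen rho_diff rho_scale inner_commute)
  moreover from this have "\<rho> t v = v - (2 * ((- \<beta>) \<bullet> v)) *\<^sub>R (- \<beta>)" for v by simp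
  ultimately show ?thesis using root_nonneg_cases[OF \<beta>] uminus_root[OF \<beta>] \<beta> by blast
qed

definition root_of :: "'g \<Rightarrow> 'v" where
  "root_of t = (SOME \<beta>. \<beta> \<in> roots \<and> nonneg \<beta> \<and> (\<forall>v. \<rho> t v = v - (2 * (\<beta> \<bullet> v)) *\<^sub>R \<beta>))"

lemma root_of_root [simp]: "t \<in> T \<Longrightarrow> root_of t \<in> roots"
  and root_of_nonneg: "t \<in> T \<Longrightarrow> nonneg (root_of t)"
  and rho_reflection: "t \<in> T \<Longrightarrow> \<rho> t v = v - (2 * (root_of t \<bullet> v)) *\<^sub>R root_of t"
  using someI_ex[OF ex_root_of[of t]] unfolding root_of_def by blast+

lemma root_of_eqI:
  assumes "t \<in> T" "\<beta> \<in> roots" "nonneg \<beta>" "\<rho> t \<beta> = - \<beta>"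
  shows "root_of t = \<beta>"
proof -
  have "2 *\<^sub>R \<beta> = 2 *\<^sub>R ((root_of t \<bullet> \<beta>) *\<^sub>R root_of t)"
    using assms(4) rho_reflection[OF assms(1), of \<beta>] by (simp add: scaleR_2 algebra_simps)
  then have "\<beta> = (root_of t \<bullet> \<beta>) *\<^sub>R root_of t" by (simp del: scaleR_scaleR)
  then have "\<beta> = root_of t \<or> \<beta> = - root_of t"
    using root_proportional[OF assms(2) root_of_root[OF assms(1)]] by blast
  then show ?thesis
    using nonneg_antisym[of "root_of t"] root_of_nonneg[OF assms(1)] assms(3) by auto
qed

lemma root_of_S [simp]: "s \<in> S \<Longrightarrow> root_of s = \<alpha> s"
  by (rule root_of_eqI) (auto simp: S_subset_T)

lemma rho_root_of: "t \<in> T \<Longrightarrow> \<rho> t (root_of t) = - root_of t"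
  using rho_reflection[of t "root_of t"] root_unit[OF root_of_root[of t]] by (simp add: scaleR_2)

lemma root_of_conj_by:
  assumes "t \<in> T" "x \<in> carrier W"
  shows "root_of (conj_by W t x) = \<rho> (inv x) (root_of t) \<or> root_of (conj_by W t x) = - \<rho> (inv x) (root_of t)"
proof -
  let ?\<beta> = "\<rho> (inv x) (root_of t)"
  have \<beta>: "?\<beta> \<in> roots" using assms by simp
  have eq: "\<rho> (conj_by W t x) ?\<beta> = - ?\<beta>"
    using assms by (simp add: rho_conj_by rho_root_of)
  show ?thesis
  proof (cases "nonneg ?\<beta>")
    case True
    then show ?thesis using root_of_eqI[OF conj_by_T[OF assms] \<beta> True eq] by simp
  next
    case False
    then have "nonneg (- ?\<beta>)" using root_nonneg_cases[OF \<beta>] by blast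
    then show ?thesis
      using root_of_eqI[OF conj_by_T[OF assms] uminus_root[OF \<beta>]] eq assms by simp
  qed
qed

lemma root_of_inj: "t \<in> T \<Longrightarrow> u \<in> T \<Longrightarrow> root_of t = root_of u \<Longrightarrow> t = u"
  by (rule rho_inj) (simp_all add: rho_reflection)

lemma fixed_by_reflection_iff: "t \<in> T \<Longrightarrow> \<rho> t v = v \<longleftrightarrow> root_of t \<bullet> v = 0"
  using rho_reflection[of t v] root_nonzero[OF root_of_root[of t]] by simp

lemma hyperplane_iff: "t \<in> T \<Longrightarrow> v \<in> hyperplane \<rho> t \<longleftrightarrow> root_of t \<bullet> v = 0"
  by (simp add: hyperplane_def fixed_by_reflection_iff)

lemma hyperplane_conj_by_iff:
  "t \<in> carrier W \<Longrightarrow> x \<in> carrier W \<Longrightarrow> v \<in> hyperplane \<rho> (conj_by W t x) \<longleftrightarrow> \<rho> x v \<in> hyperplane \<rho> t"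
  unfolding hyperplane_def by (simp add: rho_conj_by) (metis rho_inv_cancel)

lemma hyperplane_S_conj_by_iff:
  "s \<in> S \<Longrightarrow> x \<in> carrier W \<Longrightarrow> v \<in> hyperplane \<rho> (conj_by W s x) \<longleftrightarrow> \<rho> x v \<bullet> \<alpha> s = 0"
  using hyperplane_iff[OF S_subset_T] by (simp add: hyperplane_conj_by_iff inner_commute)

text \<open>The projection of the root of u to H_t must lie in H_u as well, which forces the product
  of the two unit roots to be 1 or -1. Injectivity keeps the product of weights over T_J free of
  repetitions.\<close>

lemma hyperplane_inj:
  assumes "t \<in> T" "u \<in> T" "hyperplane \<rho> t = hyperplane \<rho> u"
  shows "t = u"
proof -
  have r: "root_of t \<bullet> root_of t = 1" "root_of u \<bullet> root_of u = 1"
    using assms root_unit by simp_all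
  let ?c = "root_of t \<bullet> root_of u"
  \<comment> \<open>This is the orthogonal projection of the root of u to H_t.\<close>
  have "root_of u - ?c *\<^sub>R root_of t \<in> hyperplane \<rho> t"
    using r assms(1) by (simp add: hyperplane_iff inner_diff_right)
  then have "root_of u \<bullet> (root_of u - ?c *\<^sub>R root_of t) = 0"
    using assms by (simp add: hyperplane_iff)
  then have "root_of u \<bullet> root_of u - ?c * ?c = 0"
    unfolding inner_diff_right inner_scaleR_right by (simp add: inner_commute)
  then have c: "?c * ?c = 1" using r by linarith
  have "(root_of u - ?c *\<^sub>R root_of t) \<bullet> (root_of u - ?c *\<^sub>R root_of t) = 0"
    using r c by (simp add: inner_diff_right inner_diff_left inner_commute[of "root_of u" "root_of t"])
  then have "root_of u = ?c *\<^sub>R root_of t" by simp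
  then have "root_of u = root_of t \<or> root_of u = - root_of t"
    using root_proportional assms root_of_root by blast
  then have "root_of u = root_of t"
    using nonneg_antisym[of "root_of t"] root_of_nonneg[OF assms(1)] root_of_nonneg[OF assms(2)] by auto
  then show ?thesis using root_of_inj assms by metis
qed

text \<open>The edge cut by T_K, already determined by the simple reflections in K.
  \<open>generic K\<close> is a point of it through which no hyperplane passes unless it contains
  the whole flat.\<close>

definition flat :: "'g set \<Rightarrow> 'v set" where
  "flat K = {v. \<forall>s\<in>K. v \<bullet> \<alpha> s = 0}"

lemma generic_in_flat: "K \<subseteq> S \<Longrightarrow> generic K \<in> flat K"
  unfolding flat_def using generic_alpha by auto

lemma inner_generic: "v \<bullet> generic K = (\<Sum>s\<in>S - K. \<omega> s \<bullet> v)"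
proof -
  have "v \<bullet> generic K = (\<Sum>s\<in>S. (\<omega> s \<bullet> v) * (generic K \<bullet> \<alpha> s))"
    using inner_expansion[of "generic K" v] by (simp add: inner_commute)
  also have "\<dots> = (\<Sum>s\<in>S. if s \<in> K then 0 else \<omega> s \<bullet> v)"
    by (rule sum.cong) (simp_all add: generic_alpha)
  also have "\<dots> = (\<Sum>s\<in>S - K. \<omega> s \<bullet> v)"
    using finite_S by (intro sum.mono_neutral_cong_right) auto
  finally show ?thesis .
qed

lemma inner_generic_zero_iff:
  assumes "nonneg v"
  shows "v \<bullet> generic K = 0 \<longleftrightarrow> spanned K v"
  unfolding inner_generic spanned_def using assms finite_S
  by (subst sum_nonneg_eq_0_iff) (auto simp: nonneg_def)

lemma reflection_in_parabolic_iff: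
  assumes "K \<subseteq> S" "t \<in> T"
  shows "t \<in> generate W K \<longleftrightarrow> spanned K (root_of t)"
proof -
  have "t \<in> generate W K \<longleftrightarrow> root_of t \<bullet> generic K = 0"
    using fixes_generic_iff[OF assms(1) T_closed[OF assms(2)]] fixed_by_reflection_iff[OF assms(2)] by simp
  then show ?thesis using inner_generic_zero_iff[OF root_of_nonneg[OF assms(2)]] by simp
qed

lemma flat_subset_hyperplane_iff:
  assumes "K \<subseteq> S" "t \<in> T"
  shows "flat K \<subseteq> hyperplane \<rho> t \<longleftrightarrow> t \<in> generate W K"
proof
  assume "flat K \<subseteq> hyperplane \<rho> t"
  then have "\<rho> t (generic K) = generic K"
    using generic_in_flat[OF assms(1)] by (auto simp: hyperplane_def)
  then show "t \<in> generate W K" using fixes_generic_iff assms by simp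
next
  assume "t \<in> generate W K"
  then show "flat K \<subseteq> hyperplane \<rho> t"
    using rho_fixes_if_orthogonal[OF assms(1), of t] by (auto simp: hyperplane_def flat_def)
qed

lemma support_reflection:
  assumes "t \<in> T"
  shows "support W S t = {s \<in> S. \<omega> s \<bullet> root_of t \<noteq> 0}" (is "_ = ?K")
proof
  have iff: "support W S t \<subseteq> K \<longleftrightarrow> spanned K (root_of t)" if "K \<subseteq> S" for K
    using support_subset_iff[OF that, of t] reflection_in_parabolic_iff[OF that assms] assms by simp
  show "support W S t \<subseteq> ?K" using iff[of ?K] by (auto simp: spanned_def)
  show "?K \<subseteq> support W S t"
    using iff[OF support_subset[of t]] by (auto simp: spanned_def)
qed

lemma support_reflection_nonempty: "t \<in> T \<Longrightarrow> support W S t \<noteq> {}"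
  using coefficients_eqI[of "root_of t" 0] root_nonzero[OF root_of_root[of t]]
  by (auto simp: support_reflection)

text \<open>The inverse comes from the convention for conjugates: the hyperplane of
  \<open>conj_by W t w\<close> is the image of that of t under \<open>inv w\<close>.\<close>

lemma edge_cut_by_parabolic:
  assumes "J \<subseteq> S" "w \<in> carrier W"
  shows "edge_cut_by \<rho> (conj_set W (parabolic_reflections W S J) w) = \<rho> (inv w) ` flat J"
proof -
  have sub: "flat J \<subseteq> hyperplane \<rho> t" if "t \<in> T" "t \<in> generate W J" for t
    using flat_subset_hyperplane_iff assms that by blast
  have "v \<in> edge_cut_by \<rho> (conj_set W (parabolic_reflections W S J) w) \<longleftrightarrow> \<rho> w v \<in> flat J" for v
  proof
    assume v: "v \<in> edge_cut_by \<rho> (conj_set W (parabolic_reflections W S J) w)"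
    have "\<rho> w v \<bullet> \<alpha> s = 0" if s: "s \<in> J" for s
    proof -
      have sS: "s \<in> S" and sT: "s \<in> T" using s assms S_subset_T by auto
      then have "s \<in> parabolic_reflections W S J"
        using s by (simp add: parabolic_reflections_def generate.incl)
      then have "v \<in> hyperplane \<rho> (conj_by W s w)"
        using v by (auto simp: edge_cut_by_def conj_set_def)
      then show ?thesis
        using sS assms by (simp add: hyperplane_S_conj_by_iff)
    qed
    then show "\<rho> w v \<in> flat J" by (simp add: flat_def)
  next
    assume "\<rho> w v \<in> flat J"
    then show "v \<in> edge_cut_by \<rho> (conj_set W (parabolic_reflections W S J) w)"
      using sub assms
      by (auto simp: edge_cut_by_def conj_set_def parabolic_reflections_def hyperplane_conj_by_iff)
  qed
  moreover have "v \<in> \<rho> (inv w) ` flat J \<longleftrightarrow> \<rho> w v \<in> flat J" for v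
    using assms(2) by (metis (no_types, lifting) image_iff rho_inv_cancel)
  ultimately show ?thesis by blast
qed

section \<open>Chambers and multiplicities\<close>

abbreviation arrangement :: "'v set set" where "arrangement \<equiv> coxeter_arrangement W S \<rho>"

definition open_chamber :: "'v set" where
  "open_chamber = {v. \<forall>s\<in>S. 0 < v \<bullet> \<alpha> s}"

lemma open_chamber_eq_Int: "open_chamber = (\<Inter>s\<in>S. {v. 0 < v \<bullet> \<alpha> s})"
  by (auto simp: open_chamber_def)

lemma open_open_chamber: "open open_chamber"
  unfolding open_chamber_eq_Int
  by (intro open_INT finite_S ballI open_Collect_less continuous_intros)

lemma convex_open_chamber: "convex open_chamber"
  unfolding open_chamber_eq_Int
proof (rule convex_INT)
  show "convex {v. 0 < v \<bullet> \<alpha> s}" for s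
    using convex_halfspace_gt[of 0 "\<alpha> s"] by (simp add: inner_commute)
qed

lemma generic_in_open_chamber: "generic {} \<in> open_chamber"
  by (simp add: open_chamber_def generic_alpha)

lemma closure_open_chamber: "closure open_chamber = {v. dominant S v}"
proof
  have "closed {v. dominant S v}"
  proof -
    have "{v. dominant S v} = (\<Inter>s\<in>S. {v. 0 \<le> v \<bullet> \<alpha> s})" by (auto simp: dominant_def)
    then show ?thesis by (auto intro!: closed_INT closed_Collect_le continuous_intros)
  qed
  then show "closure open_chamber \<subseteq> {v. dominant S v}"
    by (intro closure_minimal) (auto simp: open_chamber_def dominant_def less_imp_le)
  show "{v. dominant S v} \<subseteq> closure open_chamber"
  proof
    fix v assume v: "v \<in> {v. dominant S v}"
    define f where "f n = v + inverse (real (Suc n)) *\<^sub>R generic {}" for n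
    have "f n \<in> open_chamber" for n
      using v by (auto simp: f_def open_chamber_def dominant_def inner_add_left generic_alpha intro!: add_nonneg_pos)
    moreover have "f \<longlonglongrightarrow> v + 0 *\<^sub>R generic {}"
      unfolding f_def by (intro tendsto_intros LIMSEQ_inverse_real_of_nat)
    ultimately show "v \<in> closure open_chamber"
      unfolding closure_sequential by auto
  qed
qed

lemma root_inner_open_chamber:
  assumes "v \<in> open_chamber" "\<beta> \<in> roots"
  shows "\<beta> \<bullet> v \<noteq> 0"
proof -
  have pos: "0 < \<gamma> \<bullet> v" if "\<gamma> \<in> roots" "nonneg \<gamma>" for \<gamma>
  proof -
    have "\<exists>s\<in>S. \<omega> s \<bullet> \<gamma> \<noteq> 0"
      using coefficients_eqI[of \<gamma> 0] root_nonzero[OF that(1)] by auto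
    then obtain s where s: "s \<in> S" "\<omega> s \<bullet> \<gamma> \<noteq> 0" by blast
    then have "0 < \<omega> s \<bullet> \<gamma>" using that(2) by (force simp: nonneg_def)
    then have "0 < (\<Sum>s\<in>S. (\<omega> s \<bullet> \<gamma>) * (v \<bullet> \<alpha> s))"
      using assms(1) that(2) s(1) finite_S
      by (intro sum_pos2[of _ s] mult_nonneg_nonneg mult_pos_pos)
        (auto simp: open_chamber_def nonneg_def less_imp_le)
    then show ?thesis using inner_expansion[of v \<gamma>] by (simp add: inner_commute)
  qed
  show ?thesis
    using root_nonneg_cases[OF assms(2)] pos[OF assms(2)] pos[OF uminus_root[OF assms(2)]] by auto
qed

lemma complement_arrangement: "UNIV - \<Union>arrangement = (\<Union>w\<in>carrier W. \<rho> w ` open_chamber)"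
proof
  show "UNIV - \<Union>arrangement \<subseteq> (\<Union>w\<in>carrier W. \<rho> w ` open_chamber)"
  proof
    fix v assume v: "v \<in> UNIV - \<Union>arrangement"
    obtain w where w: "w \<in> carrier W" "dominant S (\<rho> w v)"
      using ex_dominant[of S v] generate_S by auto
    have "\<rho> w v \<bullet> \<alpha> s \<noteq> 0" if "s \<in> S" for s
    proof
      assume "\<rho> w v \<bullet> \<alpha> s = 0"
      then have "v \<in> hyperplane \<rho> (conj_by W s w)"
        using that w by (simp add: hyperplane_S_conj_by_iff)
      then show False using v that w S_subset_T[OF that] by (auto simp: coxeter_arrangement_def)
    qed
    then have "\<rho> w v \<in> open_chamber"
      using w by (force simp: open_chamber_def dominant_def)
    then show "v \<in> (\<Union>w\<in>carrier W. \<rho> w ` open_chamber)"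
      using w by (intro UN_I[of "inv w"] image_eqI[of _ _ "\<rho> w v"]) auto
  qed
  show "(\<Union>w\<in>carrier W. \<rho> w ` open_chamber) \<subseteq> UNIV - \<Union>arrangement"
  proof -
    have False if "w \<in> carrier W" "v \<in> open_chamber" "t \<in> T" "\<rho> w v \<in> hyperplane \<rho> t" for w v t
    proof -
      have "v \<in> hyperplane \<rho> (conj_by W t w)" using that by (simp add: hyperplane_conj_by_iff)
      then have "root_of (conj_by W t w) \<bullet> v = 0" using that by (simp add: hyperplane_iff)
      then show False using root_inner_open_chamber[OF that(2), of "root_of (conj_by W t w)"] that by simp
    qed
    then show ?thesis by (auto simp: coxeter_arrangement_def)
  qed
qed

lemma generate_empty [simp]: "generate W {} = {\<one>}"
  using generate_eq_words[of "{}"] by simp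

lemma open_chamber_orbit_unique:
  assumes "x \<in> carrier W" "y \<in> carrier W" "v \<in> open_chamber" "v' \<in> open_chamber" "\<rho> x v = \<rho> y v'"
  shows "x = y"
proof -
  have dom: "dominant S v" "dominant S v'"
    using assms by (auto simp: open_chamber_def dominant_def less_imp_le)
  have eq: "\<rho> (inv y \<otimes> x) v = v'" using assms by simp
  have e: "{s \<in> S. v \<bullet> \<alpha> s = 0} = {}" using assms(3) by (auto simp: open_chamber_def)
  have "inv y \<otimes> x \<in> generate W {s \<in> S. v \<bullet> \<alpha> s = 0}"
    using dominant_orbit_unique(2)[of S "inv y \<otimes> x" v] dom eq assms generate_S by simp
  then have "inv y \<otimes> x = \<one>" unfolding e by simp
  then show ?thesis using assms by (metis inv_closed inv_equality inv_inv)
qed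

text \<open>The translates of the fundamental chamber are open, connected and pairwise disjoint and
  fill the complement of the arrangement, which makes them its components.\<close>

lemma chambers_eq: "chambers arrangement = (\<lambda>w. \<rho> w ` open_chamber) ` carrier W"
  unfolding chambers_def
proof (rule components_open_unique)
  show "pairwise disjnt ((\<lambda>w. \<rho> w ` open_chamber) ` carrier W)"
    by (auto simp: pairwise_def disjnt_def dest: open_chamber_orbit_unique)
  show "\<Union>((\<lambda>w. \<rho> w ` open_chamber) ` carrier W) = UNIV - \<Union>arrangement"
    by (simp add: complement_arrangement)
  fix X assume "X \<in> (\<lambda>w. \<rho> w ` open_chamber) ` carrier W"
  then obtain w where w: "w \<in> carrier W" "X = \<rho> w ` open_chamber" by blast
  have inv: "\<rho> w ` open_chamber = \<rho> (inv w) -` open_chamber"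
    using w(1) by (auto simp: image_iff) (metis rho_inv_cancel(2))
  have "open X" unfolding w inv
    using w(1) by (intro open_vimage open_open_chamber linear_continuous_on)
      (simp add: linear_conv_bounded_linear[symmetric])
  moreover have "connected X" unfolding w
    using w(1) by (intro convex_connected convex_linear_image convex_open_chamber) simp
  ultimately show "open X \<and> connected X \<and> X \<noteq> {}" using w generic_in_open_chamber by auto
qed

lemma inj_on_chambers: "inj_on (\<lambda>w. \<rho> w ` open_chamber) (carrier W)"
proof (rule inj_onI)
  fix x y assume xy: "x \<in> carrier W" "y \<in> carrier W" "\<rho> x ` open_chamber = \<rho> y ` open_chamber"
  then have "\<rho> x (generic {}) \<in> \<rho> y ` open_chamber" using generic_in_open_chamber by auto
  then show "x = y" using open_chamber_orbit_unique xy generic_in_open_chamber by blast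
qed

lemma flat_translate_edge:
  assumes "K \<subseteq> S" "K \<noteq> {}" "w \<in> carrier W"
  shows "\<rho> w ` flat K \<in> edges arrangement"
proof -
  define B where "B = (\<lambda>s. hyperplane \<rho> (conj_by W s (inv w))) ` K"
  have "v \<in> \<Inter>B \<longleftrightarrow> \<rho> (inv w) v \<in> flat K" for v
    using assms unfolding B_def flat_def by (auto simp: hyperplane_S_conj_by_iff subset_iff)
  moreover have "v \<in> \<rho> w ` flat K \<longleftrightarrow> \<rho> (inv w) v \<in> flat K" for v
    using assms(3) by (metis (no_types, lifting) image_iff rho_inv_cancel)
  ultimately have "\<rho> w ` flat K = \<Inter>B" by blast
  moreover have "B \<subseteq> arrangement"
    using assms S_subset_T by (auto simp: B_def coxeter_arrangement_def)
  moreover have "B \<noteq> {}" using assms by (auto simp: B_def)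
  moreover have "\<rho> w ` flat K \<noteq> {}" using generic_in_flat[OF assms(1)] by blast
  ultimately have "\<rho> w ` flat K = \<Inter>B \<and> B \<subseteq> arrangement \<and> B \<noteq> {} \<and> \<Inter>B \<noteq> {}" by simp
  then show ?thesis unfolding edges_def by blast
qed

text \<open>For dominant v the product with the root of \<open>conj_by W t w\<close> is a sum of
  nonnegative terms, one for each simple root. It vanishes only if v is orthogonal to every simple
  root in the support.\<close>

lemma closed_chamber_Int_hyperplane:
  assumes "t \<in> T" "w \<in> carrier W"
  shows "closure (\<rho> w ` open_chamber) \<inter> hyperplane \<rho> t =
    \<rho> w ` ({v. dominant S v} \<inter> flat (support W S (conj_by W t w)))"
proof -
  let ?t = "conj_by W t w"
  have tT: "?t \<in> T" using assms by simp
  have *: "v \<in> hyperplane \<rho> ?t \<longleftrightarrow> v \<in> flat (support W S ?t)" if "dominant S v" for v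
  proof -
    have "v \<in> hyperplane \<rho> ?t \<longleftrightarrow> (\<Sum>s\<in>S. (\<omega> s \<bullet> root_of ?t) * (v \<bullet> \<alpha> s)) = 0"
      using hyperplane_iff[OF tT] inner_expansion[of v "root_of ?t"] by (simp add: inner_commute)
    also have "\<dots> \<longleftrightarrow> (\<forall>s\<in>S. (\<omega> s \<bullet> root_of ?t) * (v \<bullet> \<alpha> s) = 0)"
      using finite_S that root_of_nonneg[OF tT]
      by (intro sum_nonneg_eq_0_iff) (auto simp: dominant_def nonneg_def)
    also have "\<dots> \<longleftrightarrow> v \<in> flat (support W S ?t)"
      by (auto simp: flat_def support_reflection[OF tT])
    finally show ?thesis .
  qed
  have inj: "inj (\<rho> w)" using assms by (simp add: inj_def)
  have "closure (\<rho> w ` open_chamber) = \<rho> w ` {v. dominant S v}"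
    using closure_injective_linear_image[OF linear_rho[OF assms(2)] inj, of open_chamber]
    by (simp add: closure_open_chamber)
  then show ?thesis using assms * by (auto simp: hyperplane_conj_by_iff)
qed

text \<open>The generic point of the face decides minimality: a hyperplane through this single point
  contains the whole flat, so an edge containing the face contains the flat.\<close>

lemma minimal_edge_chamber_iff:
  assumes "t \<in> T" "w \<in> carrier W"
  shows "minimal_edge_containing arrangement (closure (\<rho> w ` open_chamber) \<inter> hyperplane \<rho> t) E \<longleftrightarrow>
    \<rho> w ` flat (support W S (conj_by W t w)) = E" (is "?min E \<longleftrightarrow> ?E = E")
proof -
  let ?K = "support W S (conj_by W t w)"
  have K: "?K \<subseteq> S" "?K \<noteq> {}" using assms support_subset support_reflection_nonempty by simp_all
  have gen: "\<rho> w (generic ?K) \<in> closure (\<rho> w ` open_chamber) \<inter> hyperplane \<rho> t"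
    unfolding closed_chamber_Int_hyperplane[OF assms]
    using dominant_generic[of S ?K] generic_in_flat[OF K(1)] by blast
  have min: "?min ?E"
    unfolding minimal_edge_containing_def
  proof (intro conjI ballI impI)
    show "?E \<in> edges arrangement" using flat_translate_edge K assms by blast
    show "closure (\<rho> w ` open_chamber) \<inter> hyperplane \<rho> t \<subseteq> ?E"
      unfolding closed_chamber_Int_hyperplane[OF assms] by blast
    fix F assume F: "F \<in> edges arrangement" "closure (\<rho> w ` open_chamber) \<inter> hyperplane \<rho> t \<subseteq> F"
    then obtain B where B: "B \<subseteq> arrangement" "F = \<Inter>B" by (auto simp: edges_def)
    have "?E \<subseteq> H" if H: "H \<in> B" for H
    proof -
      obtain u where u: "u \<in> T" "H = hyperplane \<rho> u" using H B by (auto simp: coxeter_arrangement_def)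
      have "\<rho> w (generic ?K) \<in> hyperplane \<rho> u" using gen F(2) B(2) H u by blast
      then have "generic ?K \<in> hyperplane \<rho> (conj_by W u w)"
        using u assms by (simp add: hyperplane_conj_by_iff)
      then have "root_of (conj_by W u w) \<bullet> generic ?K = 0" using u assms by (simp add: hyperplane_iff)
      then have "spanned ?K (root_of (conj_by W u w))"
        using inner_generic_zero_iff root_of_nonneg u assms by simp
      then have "flat ?K \<subseteq> hyperplane \<rho> (conj_by W u w)"
        using flat_subset_hyperplane_iff reflection_in_parabolic_iff K u assms by simp
      then show ?thesis using u assms by (auto simp: hyperplane_conj_by_iff)
    qed
    then show "?E \<subseteq> F" unfolding B by blast
  qed
  show ?thesis
  proof
    assume "?min E"
    then show "?E = E" using min unfolding minimal_edge_containing_def by blast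
  qed (use min in simp)
qed

lemma multiplicity_via_eq:
  assumes "t \<in> T"
  shows "multiplicity_via arrangement (hyperplane \<rho> t) E =
    real (card {w \<in> carrier W. \<rho> w ` flat (support W S (conj_by W t w)) = E}) / 2"
proof -
  have "{C \<in> chambers arrangement. minimal_edge_containing arrangement (closure C \<inter> hyperplane \<rho> t) E}
    = (\<lambda>w. \<rho> w ` open_chamber) ` {w \<in> carrier W. \<rho> w ` flat (support W S (conj_by W t w)) = E}"
    unfolding chambers_eq using minimal_edge_chamber_iff[OF assms] by auto
  moreover have "card \<dots> = card {w \<in> carrier W. \<rho> w ` flat (support W S (conj_by W t w)) = E}"
    by (intro card_image inj_on_subset[OF inj_on_chambers]) auto
  ultimately show ?thesis by (simp add: multiplicity_via_def)
qed

end

section \<open>The Euler relation for sign cells\<close>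

text \<open>The value 0 off A makes cells plain functions determined on A, so that enlarging A by
  one vector is a function update.\<close>

definition sign_vector :: "'v::euclidean_space set \<Rightarrow> 'v \<Rightarrow> 'v \<Rightarrow> real" where
  "sign_vector A x = (\<lambda>a. if a \<in> A then sgn (a \<bullet> x) else 0)"

text \<open>For a sign vector c that occurs, this is the linear span of its cell: by
  \<open>sign_vector_perturb\<close> the cell is open in it.\<close>

definition cell_span :: "'v::euclidean_space set \<Rightarrow> ('v \<Rightarrow> real) \<Rightarrow> 'v set" where
  "cell_span A c = {y. \<forall>a\<in>A. c a = 0 \<longrightarrow> a \<bullet> y = 0}"

lemma subspace_cell_span: "subspace (cell_span A c)"
  by (auto simp: cell_span_def subspace_def inner_add_right)

lemma sign_vector_eq_iff:
  "sign_vector A x = sign_vector A y \<longleftrightarrow> (\<forall>a\<in>A. sgn (a \<bullet> x) = sgn (a \<bullet> y))"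
  by (auto simp: sign_vector_def fun_eq_iff)

lemma sign_vector_insert:
  "a \<notin> A \<Longrightarrow> sign_vector (insert a A) x = (sign_vector A x)(a := sgn (a \<bullet> x))"
  by (auto simp: sign_vector_def fun_eq_iff)

lemma sgn_add_small:
  fixes p q :: real
  assumes "p \<noteq> 0 \<Longrightarrow> \<bar>q\<bar> < \<bar>p\<bar>" "p = 0 \<Longrightarrow> q = 0"
  shows "sgn (p + q) = sgn p"
  using assms by (cases "p = 0") (auto simp: sgn_if abs_if split: if_splits)

lemma sgn_pos_combination:
  fixes p q r s :: real
  assumes "0 < p" "0 < q" "sgn r = sgn s"
  shows "sgn (p * r + q * s) = sgn s"
proof (cases s "0 :: real" rule: linorder_cases)
  case less
  then have "r < 0" using assms(3) by (simp add: sgn_if split: if_splits)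
  then have "p * r + q * s < 0" using less assms by (intro add_neg_neg mult_pos_neg)
  then show ?thesis using less by simp
next
  case greater
  then have "0 < r" using assms(3) by (simp add: sgn_if split: if_splits)
  then have "0 < p * r + q * s" using greater assms by (intro add_pos_pos mult_pos_pos)
  then show ?thesis using greater by simp
qed (use assms(3) in \<open>simp add: sgn_if split: if_splits\<close>)

lemma sign_vector_perturb:
  assumes "finite A" "y \<in> cell_span A (sign_vector A x)"
  shows "\<exists>e>0. sign_vector A (x + e *\<^sub>R y) = sign_vector A x \<and> sign_vector A (x - e *\<^sub>R y) = sign_vector A x"
proof -
  have "\<exists>e>0. \<forall>a\<in>A. a \<bullet> x \<noteq> 0 \<longrightarrow> e * \<bar>a \<bullet> y\<bar> < \<bar>a \<bullet> x\<bar>"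
    using assms(1)
  proof induction
    case (insert a A)
    then obtain e where e: "e > 0" "\<forall>a\<in>A. a \<bullet> x \<noteq> 0 \<longrightarrow> e * \<bar>a \<bullet> y\<bar> < \<bar>a \<bullet> x\<bar>" by blast
    \<comment> \<open>The + 1 in the denominator covers a \<bullet> y = 0 and keeps the inequality
      for a strict.\<close>
    define e' where "e' = (if a \<bullet> x = 0 then e else min e (\<bar>a \<bullet> x\<bar> / (\<bar>a \<bullet> y\<bar> + 1)))"
    have "e' > 0" using e(1) by (simp add: e'_def add_nonneg_pos)
    moreover have "e' * \<bar>b \<bullet> y\<bar> < \<bar>b \<bullet> x\<bar>" if b: "b \<in> insert a A" "b \<bullet> x \<noteq> 0" for b
    proof (cases "b = a")
      case True
      then have "e' * \<bar>b \<bullet> y\<bar> \<le> \<bar>a \<bullet> x\<bar> / (\<bar>a \<bullet> y\<bar> + 1) * \<bar>a \<bullet> y\<bar>"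
        using b by (intro mult_mono) (auto simp: e'_def)
      also have "\<dots> < \<bar>a \<bullet> x\<bar>"
      proof -
        have "\<bar>a \<bullet> x\<bar> * \<bar>a \<bullet> y\<bar> < \<bar>a \<bullet> x\<bar> * (\<bar>a \<bullet> y\<bar> + 1)" using b True by simp
        then show ?thesis using pos_divide_less_eq[of "\<bar>a \<bullet> y\<bar> + 1"] by (simp add: add_nonneg_pos)
      qed
      finally show ?thesis using True by simp
    next
      case False
      have "e' * \<bar>b \<bullet> y\<bar> \<le> e * \<bar>b \<bullet> y\<bar>" by (intro mult_right_mono) (auto simp: e'_def)
      then show ?thesis using e(2) b False by fastforce
    qed
    ultimately show ?case by blast
  qed (auto intro: exI[of _ 1])
  then obtain e where e: "e > 0" "\<And>a. a \<in> A \<Longrightarrow> a \<bullet> x \<noteq> 0 \<Longrightarrow> e * \<bar>a \<bullet> y\<bar> < \<bar>a \<bullet> x\<bar>" by blast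
  have z: "a \<bullet> y = 0" if "a \<in> A" "a \<bullet> x = 0" for a
    using assms(2) that by (simp add: cell_span_def sign_vector_def)
  have "sgn (a \<bullet> x + e * (a \<bullet> y)) = sgn (a \<bullet> x) \<and> sgn (a \<bullet> x + (- e) * (a \<bullet> y)) = sgn (a \<bullet> x)"
    if a: "a \<in> A" for a
    using e(1) e(2)[OF a] z[OF a] sgn_add_small[of "a \<bullet> x" "e * (a \<bullet> y)"]
      sgn_add_small[of "a \<bullet> x" "- e * (a \<bullet> y)"] by (auto simp: abs_mult)
  then show ?thesis using e(1)
    by (intro exI[of _ e]) (simp add: sign_vector_eq_iff inner_add_right inner_diff_right)
qed

lemma dim_Int_hyperplane:
  fixes a y :: "'v::euclidean_space"
  assumes "subspace L" "y \<in> L" "a \<bullet> y \<noteq> 0"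
  shows "dim L = Suc (dim (L \<inter> {v. a \<bullet> v = 0}))"
proof -
  let ?M = "L \<inter> {v. a \<bullet> v = 0}"
  have M: "subspace ?M" using assms(1) by (intro subspace_inter subspace_hyperplane)
  have "L \<subseteq> span (insert y ?M)"
  proof
    fix z assume z: "z \<in> L"
    have "z - (a \<bullet> z / (a \<bullet> y)) *\<^sub>R y \<in> ?M"
      using assms z by (simp add: subspace_diff subspace_scale inner_diff_right)
    then show "z \<in> span (insert y ?M)" by (auto simp: span_insert intro: span_base)
  qed
  moreover have "span (insert y ?M) \<subseteq> L" using assms by (intro span_minimal) auto
  ultimately have "dim L = dim (insert y ?M)" by (metis dim_span subset_antisym)
  also have "\<dots> = Suc (dim ?M)"
  proof -
    have "span ?M = ?M" using M by simp
    moreover have "y \<notin> ?M" using assms(3) by simp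
    ultimately have "y \<notin> span ?M" by metis
    then show ?thesis by (simp add: dim_insert[of y ?M])
  qed
  finally show ?thesis .
qed

text \<open>Hyperplanes are added one at a time, and each old cell keeps its contribution. A cell
  that is cut yields two pieces of its own dimension d and one of dimension d - 1, whose signs add
  up to (-1)^d; a cell inside the hyperplane or disjoint from it stays one piece of the same
  dimension.\<close>

lemma euler_relation:
  fixes A :: "'v::euclidean_space set"
  assumes "finite A" "subspace X"
  shows "(\<Sum>c\<in>sign_vector A ` X. (-1 :: real) ^ dim (X \<inter> cell_span A c)) = (-1) ^ dim X"
  using assms(1)
proof induction
  case empty
  have "X \<noteq> {}" using subspace_0[OF assms(2)] by blast
  then have "sign_vector {} ` X = {\<lambda>a. 0}" by (auto simp: sign_vector_def fun_eq_iff)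
  then show ?case by (simp add: cell_span_def)
next
  case (insert a A)
  define Q where "Q c = {x \<in> X. sign_vector A x = c}" for c
  define E where "E c = (\<lambda>x. sgn (a \<bullet> x)) ` Q c" for c
  let ?I = "insert a A"
  have split: "sign_vector ?I ` X = (\<lambda>(c, e). c(a := e)) ` (SIGMA c:sign_vector A ` X. E c)"
    unfolding E_def Q_def sign_vector_insert[OF insert.hyps(2)] by force
  have a0: "sign_vector A x a = 0" for x
    using insert.hyps(2) by (simp add: sign_vector_def)
  have inj: "inj_on (\<lambda>(c, e). c(a := e)) (SIGMA c:sign_vector A ` X. E c)"
  proof (rule inj_onI, clarsimp)
    fix x y :: 'v and e f :: real
    assume xy: "x \<in> X" "y \<in> X" and eq: "(sign_vector A x)(a := e) = (sign_vector A y)(a := f)"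
    have "sign_vector A x b = sign_vector A y b" for b
      using fun_cong[OF eq, of b] a0 by (cases "b = a") auto
    then show "sign_vector A x = sign_vector A y \<and> e = f" using fun_cong[OF eq, of a] by auto
  qed
  have fibre: "(\<Sum>e\<in>E c. (-1 :: real) ^ dim (X \<inter> cell_span ?I (c(a := e)))) = (-1) ^ dim (X \<inter> cell_span A c)"
    if c: "c \<in> sign_vector A ` X" for c
  proof -
    let ?L = "X \<inter> cell_span A c"
    have L: "subspace ?L" using assms(2) subspace_cell_span by (intro subspace_inter)
    have QL: "Q c \<subseteq> ?L" by (auto simp: Q_def cell_span_def sign_vector_def sgn_0_0)
    have sub: "E c \<subseteq> {-1, 0, 1}" by (auto simp: E_def sgn_if)
    then have finE: "finite (E c)" using finite_subset by blast
    obtain x0 where x0: "x0 \<in> Q c" using c by (auto simp: Q_def)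
    have nz: "X \<inter> cell_span ?I (c(a := e)) = ?L" if "e \<noteq> 0" for e
      using that insert.hyps(2) by (auto simp: cell_span_def)
    have zr: "X \<inter> cell_span ?I (c(a := 0)) = ?L \<inter> {v. a \<bullet> v = 0}"
      using insert.hyps(2) by (auto simp: cell_span_def)
    have perturb: "\<exists>e>0. x + e *\<^sub>R y \<in> Q c \<and> x - e *\<^sub>R y \<in> Q c" if "x \<in> Q c" "y \<in> ?L" for x y
    proof -
      have "y \<in> cell_span A (sign_vector A x)" "sign_vector A x = c" using that by (auto simp: Q_def)
      then obtain e where "e > 0" "sign_vector A (x + e *\<^sub>R y) = c" "sign_vector A (x - e *\<^sub>R y) = c"
        using sign_vector_perturb[OF insert.hyps(1)] by metis
      moreover have "x + e *\<^sub>R y \<in> X" "x - e *\<^sub>R y \<in> X"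
        using that assms(2) by (auto simp: Q_def subspace_add subspace_diff subspace_scale)
      ultimately show ?thesis by (auto simp: Q_def)
    qed
    show ?thesis
    proof (cases "0 \<in> E c")
      case True
      then obtain x where x: "x \<in> Q c" "a \<bullet> x = 0" by (auto simp: E_def sgn_0_0)
      show ?thesis
      proof (cases "\<exists>y\<in>?L. a \<bullet> y \<noteq> 0")
        case True
        then obtain y where y: "y \<in> ?L" "a \<bullet> y \<noteq> 0" by blast
        obtain e where e: "e > 0" "x + e *\<^sub>R y \<in> Q c" "x - e *\<^sub>R y \<in> Q c" using perturb x y by blast
        have "sgn (a \<bullet> (x + e *\<^sub>R y)) \<in> E c" "sgn (a \<bullet> (x - e *\<^sub>R y)) \<in> E c"
          unfolding E_def using e by blast+
        then have "sgn (a \<bullet> y) \<in> E c" "- sgn (a \<bullet> y) \<in> E c"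
          using x e by (simp_all add: inner_add_right inner_diff_right sgn_mult)
        then have "E c = {-1, 0, 1}" using sub \<open>0 \<in> E c\<close> y(2) by (auto simp: sgn_if split: if_splits)
        then show ?thesis using dim_Int_hyperplane[OF L y] by (simp add: nz zr)
      next
        case False
        then have "a \<bullet> v = 0" if "v \<in> Q c" for v using QL that by blast
        then have "E c \<subseteq> {0}" by (auto simp: E_def)
        then have "E c = {0}" using \<open>0 \<in> E c\<close> by blast
        moreover have "?L \<inter> {v. a \<bullet> v = 0} = ?L" using False by blast
        ultimately show ?thesis by (simp add: zr)
      qed
    next
      case False
      have "sgn (a \<bullet> x) = sgn (a \<bullet> x0)" if x: "x \<in> Q c" for x
      proof (rule ccontr)
        assume ne: "sgn (a \<bullet> x) \<noteq> sgn (a \<bullet> x0)"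
        have z: "a \<bullet> x \<noteq> 0" "a \<bullet> x0 \<noteq> 0" using False x x0 by (auto simp: E_def image_iff)
        \<comment> \<open>With these weights the positive combination of x and x0, which have
          opposite signs at a, lies on the new hyperplane and still in the cell.\<close>
        define p where "p = \<bar>a \<bullet> x0\<bar>"
        define q where "q = \<bar>a \<bullet> x\<bar>"
        have pq: "p > 0" "q > 0" using z by (auto simp: p_def q_def)
        have "sgn (b \<bullet> (p *\<^sub>R x + q *\<^sub>R x0)) = sgn (b \<bullet> x0)" if b: "b \<in> A" for b
        proof -
          have "sgn (b \<bullet> x) = sgn (b \<bullet> x0)"
            using x x0 b by (auto simp: Q_def sign_vector_eq_iff)
          then show ?thesis using sgn_pos_combination[OF pq, of "b \<bullet> x" "b \<bullet> x0"]
            by (simp add: inner_add_right)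
        qed
        then have "p *\<^sub>R x + q *\<^sub>R x0 \<in> Q c"
          using x x0 assms(2) by (auto simp: Q_def sign_vector_eq_iff subspace_add subspace_scale)
        moreover have "a \<bullet> (p *\<^sub>R x + q *\<^sub>R x0) = 0"
          using ne z by (auto simp: p_def q_def inner_add_right sgn_if abs_if split: if_splits)
        ultimately show False using False by (auto simp: E_def image_iff)
      qed
      then have "E c \<subseteq> {sgn (a \<bullet> x0)}" unfolding E_def by blast
      moreover have "sgn (a \<bullet> x0) \<in> E c" unfolding E_def using x0 by blast
      ultimately have "E c = {sgn (a \<bullet> x0)}" by blast
      moreover have "sgn (a \<bullet> x0) \<noteq> 0" using False x0 by (metis E_def image_eqI)
      ultimately show ?thesis by (simp add: nz)
    qed
  qed
  have fin: "finite (sign_vector A ` X)"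
  proof (rule finite_subset)
    show "sign_vector A ` X \<subseteq> {f. \<forall>a. (a \<in> A \<longrightarrow> f a \<in> {-1, 0, 1}) \<and> (a \<notin> A \<longrightarrow> f a = 0)}"
      by (auto simp: sign_vector_def sgn_if split: if_splits)
    show "finite {f. \<forall>a. (a \<in> A \<longrightarrow> f a \<in> {-1, 0, 1 :: real}) \<and> (a \<notin> A \<longrightarrow> f a = 0)}"
      using insert.hyps(1) by (intro finite_set_of_finite_funs) auto
  qed
  have finE: "finite (E c)" for c
    by (rule finite_subset[of _ "{-1, 0, 1}"]) (auto simp: E_def sgn_if)
  have "(\<Sum>c\<in>sign_vector ?I ` X. (-1 :: real) ^ dim (X \<inter> cell_span ?I c)) =
    (\<Sum>c\<in>sign_vector A ` X. \<Sum>e\<in>E c. (-1) ^ dim (X \<inter> cell_span ?I (c(a := e))))"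
    unfolding split using fin finE
    by (subst sum.reindex[OF inj]) (simp add: sum.Sigma o_def case_prod_unfold)
  also have "\<dots> = (\<Sum>c\<in>sign_vector A ` X. (-1) ^ dim (X \<inter> cell_span A c))"
    using fibre by (intro sum.cong) auto
  finally show ?case using insert.IH by simp
qed

text \<open>Adding or removing a fixed element of J - B reverses the sign and cancels everything
  unless B = J.\<close>

lemma alternating_sum_supersets:
  assumes "finite J" "B \<subseteq> J"
  shows "(\<Sum>K | B \<subseteq> K \<and> K \<subseteq> J. (-1 :: real) ^ card K) = (if B = J then (-1) ^ card J else 0)"
proof (cases "B = J")
  case True
  then have "{K. B \<subseteq> K \<and> K \<subseteq> J} = {J}" by blast
  then show ?thesis using True by simp
next
  case False
  then obtain j where j: "j \<in> J" "j \<notin> B" using assms by blast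
  define f where "f K = (if j \<in> K then K - {j} else insert j K)" for K
  have sgn: "(-1 :: real) ^ card (f K) = - ((-1) ^ card K)" if "K \<subseteq> J" for K
  proof -
    have fin: "finite K" using that assms(1) finite_subset by blast
    show ?thesis
    proof (cases "j \<in> K")
      case True
      define n where "n = card (K - {j})"
      have "card K = Suc n" unfolding n_def using fin True by (rule card.remove)
      moreover have "card (f K) = n" using True by (simp add: f_def n_def)
      ultimately show ?thesis by simp
    qed (simp add: f_def fin)
  qed
  have "(\<Sum>K | B \<subseteq> K \<and> K \<subseteq> J. (-1 :: real) ^ card K) = (\<Sum>K | B \<subseteq> K \<and> K \<subseteq> J. (-1) ^ card (f K))"
  proof (rule sum.reindex_bij_witness[of _ f f])
    have ff: "f (f K) = K" for K by (auto simp: f_def)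
    have mem: "f K \<in> {K. B \<subseteq> K \<and> K \<subseteq> J}" if "K \<in> {K. B \<subseteq> K \<and> K \<subseteq> J}" for K
      using that j by (auto simp: f_def)
    show "f (f K) = K" "f (f K) = K" "(-1 :: real) ^ card (f (f K)) = (-1) ^ card K" for K by (simp_all add: ff)
    show "f K \<in> {K. B \<subseteq> K \<and> K \<subseteq> J}" "f K \<in> {K. B \<subseteq> K \<and> K \<subseteq> J}"
      if "K \<in> {K. B \<subseteq> K \<and> K \<subseteq> J}" for K using mem[OF that] by blast+
  qed
  also have "\<dots> = (\<Sum>K | B \<subseteq> K \<and> K \<subseteq> J. - ((-1) ^ card K))"
    by (rule sum.cong) (auto simp: sgn)
  also have "\<dots> = - (\<Sum>K | B \<subseteq> K \<and> K \<subseteq> J. (-1) ^ card K)" by (rule sum_negf)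
  finally show ?thesis using False by simp
qed

context coxeter_realization begin

section \<open>Faces of the arrangement of a parabolic subgroup\<close>

lemma dim_flat:
  assumes "K \<subseteq> S"
  shows "dim (flat K) + card K = DIM('v)"
proof -
  have inj: "inj_on \<alpha> K" using inj_alpha assms inj_on_subset by blast
  have "independent (\<alpha> ` K)" using independent_alpha independent_mono assms by (meson image_mono)
  then have "dim (span (\<alpha> ` K)) = card K"
    using dim_eq_card_independent[OF \<open>independent (\<alpha> ` K)\<close>] card_image[OF inj] by (simp add: dim_span)
  moreover have "dim {y \<in> UNIV. \<forall>x \<in> span (\<alpha> ` K). orthogonal x y} + dim (span (\<alpha> ` K)) = dim (UNIV :: 'v set)"
    by (intro dim_subspace_orthogonal_to_vectors subspace_span subspace_UNIV) auto
  moreover have "{y \<in> UNIV. \<forall>x \<in> span (\<alpha> ` K). orthogonal x y} = flat K"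
  proof -
    have "orthogonal x y" if "y \<in> flat K" "x \<in> span (\<alpha> ` K)" for x y
      using that(2,1) by (induction rule: span_induct)
        (auto simp: subspace_def orthogonal_def flat_def inner_add_left inner_add_right inner_commute)
    moreover have "y \<in> flat K" if "\<forall>x \<in> span (\<alpha> ` K). orthogonal x y" for y
    proof -
      have "\<alpha> s \<in> span (\<alpha> ` K)" if "s \<in> K" for s using that by (intro span_base) simp
      then show ?thesis using that by (auto simp: flat_def orthogonal_def inner_commute)
    qed
    ultimately show ?thesis by blast
  qed
  ultimately show ?thesis by simp
qed

definition parabolic_roots :: "'g set \<Rightarrow> 'v set" where
  "parabolic_roots J = {\<beta> \<in> roots. spanned J \<beta>}"

lemma finite_parabolic_roots: "finite (parabolic_roots J)"
  using finite_roots by (simp add: parabolic_roots_def)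

lemma alpha_parabolic_root: "J \<subseteq> S \<Longrightarrow> s \<in> J \<Longrightarrow> \<alpha> s \<in> parabolic_roots J"
  by (auto simp: parabolic_roots_def subset_iff)

lemma rho_parabolic_root:
  "J \<subseteq> S \<Longrightarrow> w \<in> generate W J \<Longrightarrow> \<beta> \<in> parabolic_roots J \<Longrightarrow> \<rho> w \<beta> \<in> parabolic_roots J"
  using spanned_rho[of J w \<beta>] generate_closed[of J w] by (simp add: parabolic_roots_def)

lemma sign_vector_rho:
  assumes "J \<subseteq> S" "w \<in> generate W J"
    and "sign_vector (parabolic_roots J) x = sign_vector (parabolic_roots J) y"
  shows "sign_vector (parabolic_roots J) (\<rho> w x) = sign_vector (parabolic_roots J) (\<rho> w y)"
proof -
  have w: "w \<in> carrier W" using generate_closed assms by blast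
  have "sgn (a \<bullet> \<rho> w x) = sgn (a \<bullet> \<rho> w y)" if "a \<in> parabolic_roots J" for a
    using assms(3) rho_parabolic_root[OF assms(1) generate_inv[OF assms(1,2)] that]
    unfolding sign_vector_eq_iff rho_inner_left[OF w] by blast
  then show ?thesis by (simp add: sign_vector_eq_iff)
qed

lemma sign_vector_dominant:
  assumes J: "J \<subseteq> S" and dom: "dominant J x" "dominant J y"
    and zero: "\<And>s. s \<in> J \<Longrightarrow> x \<bullet> \<alpha> s = 0 \<longleftrightarrow> y \<bullet> \<alpha> s = 0"
  shows "sign_vector (parabolic_roots J) x = sign_vector (parabolic_roots J) y"
proof -
  have finJ: "finite J" using finite_S J finite_subset by blast
  have pos: "sgn (a \<bullet> x) = sgn (a \<bullet> y)" if a: "spanned J a" "nonneg a" for a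
  proof -
    have *: "a \<bullet> z = 0 \<longleftrightarrow> (\<forall>s\<in>J. \<omega> s \<bullet> a = 0 \<or> z \<bullet> \<alpha> s = 0)" if z: "dominant J z" for z
    proof -
      have "a \<bullet> z = (\<Sum>s\<in>J. (\<omega> s \<bullet> a) * (z \<bullet> \<alpha> s))"
        using spanned_inner[OF J a(1), of z] by (simp add: inner_commute)
      moreover have "(\<Sum>s\<in>J. (\<omega> s \<bullet> a) * (z \<bullet> \<alpha> s)) = 0 \<longleftrightarrow> (\<forall>s\<in>J. (\<omega> s \<bullet> a) * (z \<bullet> \<alpha> s) = 0)"
        using z a(2) J finJ by (intro sum_nonneg_eq_0_iff) (auto simp: dominant_def nonneg_def)
      ultimately show ?thesis by simp
    qed
    have "a \<bullet> x = 0 \<longleftrightarrow> a \<bullet> y = 0" using *[OF dom(1)] *[OF dom(2)] zero by simp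
    moreover have "0 \<le> a \<bullet> x" "0 \<le> a \<bullet> y"
      using dominant_inner_nonneg[OF J dom(1) a] dominant_inner_nonneg[OF J dom(2) a]
      by (simp_all add: inner_commute)
    ultimately show ?thesis by (auto simp: sgn_if)
  qed
  have "sgn (a \<bullet> x) = sgn (a \<bullet> y)" if a: "a \<in> parabolic_roots J" for a
  proof (cases "nonneg a")
    case True
    then show ?thesis using pos a by (simp add: parabolic_roots_def)
  next
    case False
    then have "nonneg (- a)" using a root_nonneg_cases by (auto simp: parabolic_roots_def)
    then show ?thesis using pos[of "- a"] a by (simp add: parabolic_roots_def spanned_uminus sgn_minus)
  qed
  then show ?thesis by (simp add: sign_vector_eq_iff)
qed

lemma sign_vector_eq_dominantD:
  assumes J: "J \<subseteq> S" and dom: "dominant J x"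
    and eq: "sign_vector (parabolic_roots J) x = sign_vector (parabolic_roots J) y"
  shows "dominant J y" "s \<in> J \<Longrightarrow> x \<bullet> \<alpha> s = 0 \<longleftrightarrow> y \<bullet> \<alpha> s = 0"
proof -
  have sgn: "sgn (x \<bullet> \<alpha> s) = sgn (y \<bullet> \<alpha> s)" if "s \<in> J" for s
    using eq alpha_parabolic_root[OF J that] unfolding sign_vector_eq_iff by (metis inner_commute)
  show "dominant J y"
    using dom sgn unfolding dominant_def by (metis sgn_less less_eq_real_def not_less sgn_0_0 zero_le_sgn_iff)
  show "s \<in> J \<Longrightarrow> x \<bullet> \<alpha> s = 0 \<longleftrightarrow> y \<bullet> \<alpha> s = 0" using sgn by (metis sgn_0_0)
qed

lemma generic_alpha_zero_iff: "s \<in> S \<Longrightarrow> generic K \<bullet> \<alpha> s = 0 \<longleftrightarrow> s \<in> K"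
  by (simp add: generic_alpha)

text \<open>This is the Coxeter complex of W_J: its faces correspond to the cosets v W_K with K
  \<subseteq> J, because a face has only one dominant translate, and the stabilizer of that one is
  W_K.\<close>

lemma sign_vector_generic_eq_iff:
  assumes J: "J \<subseteq> S" and K: "K \<subseteq> J" "L \<subseteq> J" and w: "v \<in> generate W J" "w \<in> generate W J"
  shows "sign_vector (parabolic_roots J) (\<rho> v (generic K)) = sign_vector (parabolic_roots J) (\<rho> w (generic L))
    \<longleftrightarrow> K = L \<and> inv v \<otimes> w \<in> generate W K" (is "?sg (\<rho> v (generic K)) = _ \<longleftrightarrow> _")
proof
  let ?u = "inv v \<otimes> w"
  have vw: "v \<in> carrier W" "w \<in> carrier W" using w generate_closed J by blast+
  have u: "?u \<in> generate W J" using w generate_inv[OF J] by (blast intro: generate.eng)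
  assume "?sg (\<rho> v (generic K)) = ?sg (\<rho> w (generic L))"
  then have "?sg (\<rho> (inv v) (\<rho> v (generic K))) = ?sg (\<rho> (inv v) (\<rho> w (generic L)))"
    by (rule sign_vector_rho[OF J generate_inv[OF J w(1)]])
  then have eq: "?sg (generic K) = ?sg (\<rho> ?u (generic L))" using vw by simp
  have dom: "dominant J (generic K)" "dominant J (generic L)" using dominant_generic J by blast+
  have fixL: "\<rho> ?u (generic L) = generic L"
    using dominant_orbit_unique(1)[OF J u dom(2)] sign_vector_eq_dominantD(1)[OF J dom(1) eq] by blast
  have "s \<in> K \<longleftrightarrow> s \<in> L" if "s \<in> J" for s
    using sign_vector_eq_dominantD(2)[OF J dom(1) eq that] J that fixL generic_alpha_zero_iff[of s] by auto
  then have "K = L" using K by blast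
  moreover have "?u \<in> generate W L" using fixes_generic_iff[of L ?u] fixL vw J K by auto
  ultimately show "K = L \<and> ?u \<in> generate W K" by simp
next
  assume KL: "K = L \<and> inv v \<otimes> w \<in> generate W K"
  have vw: "v \<in> carrier W" "w \<in> carrier W" using w generate_closed J by blast+
  have "\<rho> (inv v \<otimes> w) (generic K) = generic K"
    using fixes_generic_iff[of K "inv v \<otimes> w"] KL vw J K by auto
  then have "\<rho> w (generic K) = \<rho> v (generic K)"
    using vw by (metis inv_closed rho_inv_cancel(2) rho_mult)
  then show "?sg (\<rho> v (generic K)) = ?sg (\<rho> w (generic L))" using KL by simp
qed

lemma cell_span_generic:
  assumes J: "J \<subseteq> S" and K: "K \<subseteq> J" and w: "w \<in> generate W J"
  shows "cell_span (parabolic_roots J) (sign_vector (parabolic_roots J) (\<rho> w (generic K))) = \<rho> w ` flat K"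
    (is "?C = _")
proof -
  have wc: "w \<in> carrier W" using generate_closed J w by blast
  have KS: "K \<subseteq> S" using K J by blast
  have C: "y \<in> ?C \<longleftrightarrow> (\<forall>a\<in>parabolic_roots J. a \<bullet> \<rho> w (generic K) = 0 \<longrightarrow> a \<bullet> y = 0)" for y
    by (simp add: cell_span_def sign_vector_def sgn_0_0)
  have "\<rho> (inv w) y \<in> flat K" if y: "y \<in> ?C" for y
  proof -
    have "\<rho> (inv w) y \<bullet> \<alpha> s = 0" if s: "s \<in> K" for s
    proof -
      have sS: "s \<in> S" using s KS by blast
      have "\<rho> w (\<alpha> s) \<in> parabolic_roots J"
        using rho_parabolic_root[OF J w] alpha_parabolic_root[OF J] s K by blast
      moreover have "\<rho> w (\<alpha> s) \<bullet> \<rho> w (generic K) = 0"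
        using wc s generic_alpha[OF sS, of K] by (simp add: inner_commute)
      ultimately have "\<rho> w (\<alpha> s) \<bullet> y = 0" using y C by blast
      then show ?thesis using wc by (metis inner_commute rho_inner_left)
    qed
    then show ?thesis by (simp add: flat_def)
  qed
  moreover have "\<rho> w z \<in> ?C" if z: "z \<in> flat K" for z
  proof -
    have "a \<bullet> \<rho> w z = 0" if a: "a \<in> parabolic_roots J" "a \<bullet> \<rho> w (generic K) = 0" for a
    proof -
      let ?b = "\<rho> (inv w) a"
      have b: "?b \<in> roots" "?b \<bullet> generic K = 0"
        using a wc rho_inner_left[OF wc, of a "generic K"] by (simp_all add: parabolic_roots_def)
      have "spanned K ?b"
        using root_nonneg_cases[OF b(1)] inner_generic_zero_iff[of ?b K] inner_generic_zero_iff[of "- ?b" K] b(2)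
        by (auto simp: spanned_uminus)
      then have "z \<bullet> ?b = 0"
        using spanned_inner[OF KS, of ?b z] z by (simp add: flat_def)
      then show ?thesis using rho_inner_left[OF wc, of a z] by (simp add: inner_commute)
    qed
    then show ?thesis using C by blast
  qed
  ultimately show ?thesis using wc by (auto simp: image_iff) (metis rho_inv_cancel(2))
qed

section \<open>Faces inside fixed spaces\<close>

definition fixed_space :: "'g \<Rightarrow> 'v set" where
  "fixed_space u = {v. \<rho> u v = v}"

lemma subspace_fixed_space: "u \<in> carrier W \<Longrightarrow> subspace (fixed_space u)"
  by (auto simp: fixed_space_def subspace_def rho_add rho_scale)

lemma fixes_translate_iff:
  assumes "u \<in> carrier W" "w \<in> carrier W"
  shows "\<rho> u (\<rho> w v) = \<rho> w v \<longleftrightarrow> \<rho> (conj_by W u w) v = v"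
  using assms by (simp add: rho_conj_by) (metis rho_inv_cancel)

lemma fixes_translated_generic_iff:
  assumes "K \<subseteq> S" "u \<in> carrier W" "w \<in> carrier W"
  shows "\<rho> u (\<rho> w (generic K)) = \<rho> w (generic K) \<longleftrightarrow> conj_by W u w \<in> generate W K"
  using assms fixes_translate_iff fixes_generic_iff by simp

text \<open>
  The pairs \<open>(K, w)\<close> enumerate the faces of the arrangement of the parabolic subgroup, the face
  of \<open>(K, w)\<close> being hit as often as its stabiliser has elements.
\<close>

lemma euler_relation_fixed_space:
  assumes J: "J \<subseteq> S" and U: "U \<subseteq> generate W J"
  defines "X \<equiv> \<Inter>u\<in>U. fixed_space u"
  shows "(\<Sum>(K, w) | K \<subseteq> J \<and> w \<in> generate W J \<and> \<rho> w (generic K) \<in> X.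
      (-1 :: real) ^ (DIM('v) + card K) / real (card (generate W K))) = (-1) ^ dim X"
proof -
  let ?A = "parabolic_roots J"
  define P where "P = {(K, w). K \<subseteq> J \<and> w \<in> generate W J \<and> \<rho> w (generic K) \<in> X}"
  define g where "g = (\<lambda>(K, w). sign_vector ?A (\<rho> w (generic K)))"
  define h where "h = (\<lambda>(K, w :: 'g). (-1 :: real) ^ (DIM('v) + card K) / real (card (generate W K)))"
  have finJ: "finite J" using finite_S J finite_subset by blast
  have "P \<subseteq> Pow J \<times> generate W J" by (auto simp: P_def)
  then have finP: "finite P" using finJ finite_generate[OF J] finite_subset by (metis finite_Pow_iff finite_SigmaI)
  have Uc: "u \<in> carrier W" if "u \<in> U" for u using that U generate_closed[OF J] by blast
  have X: "subspace X" unfolding X_def using Uc by (intro subspace_Int subspace_fixed_space) auto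
  have XI: "v \<in> X \<longleftrightarrow> (\<forall>u\<in>U. \<rho> u v = v)" for v by (simp add: X_def fixed_space_def)
  have image: "g ` P = sign_vector ?A ` X"
  proof
    show "g ` P \<subseteq> sign_vector ?A ` X" by (auto simp: g_def P_def)
    show "sign_vector ?A ` X \<subseteq> g ` P"
    proof
      fix c assume "c \<in> sign_vector ?A ` X"
      then obtain x where x: "x \<in> X" "c = sign_vector ?A x" by blast
      obtain w where w: "w \<in> generate W J" "dominant J (\<rho> w x)" using ex_dominant[OF J] by blast
      have wc: "w \<in> carrier W" using w(1) generate_closed[OF J] by blast
      define K where "K = {s \<in> J. \<rho> w x \<bullet> \<alpha> s = 0}"
      have K: "K \<subseteq> J" "K \<subseteq> S" using J by (auto simp: K_def)
      have "sign_vector ?A (\<rho> w x) = sign_vector ?A (generic K)"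
      proof (rule sign_vector_dominant[OF J w(2) dominant_generic[OF J]])
        show "\<rho> w x \<bullet> \<alpha> s = 0 \<longleftrightarrow> generic K \<bullet> \<alpha> s = 0" if "s \<in> J" for s
          using that J generic_alpha_zero_iff[of s K] by (auto simp: K_def)
      qed
      then have "sign_vector ?A (\<rho> (inv w) (\<rho> w x)) = sign_vector ?A (\<rho> (inv w) (generic K))"
        by (rule sign_vector_rho[OF J generate_inv[OF J w(1)]])
      then have "sign_vector ?A x = sign_vector ?A (\<rho> (inv w) (generic K))" using wc by simp
      \<comment> \<open>An element u fixing x fixes the generic point of the face of x, since both
        points have the same stabilizer in W_J.\<close>
      moreover have "\<rho> u (\<rho> (inv w) (generic K)) = \<rho> (inv w) (generic K)" if u: "u \<in> U" for u
      proof -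
        have uc: "u \<in> carrier W" using Uc u by blast
        have "\<rho> u (\<rho> (inv w) (\<rho> w x)) = \<rho> (inv w) (\<rho> w x)" using x(1) u wc XI by simp
        then have fx: "\<rho> (conj_by W u (inv w)) (\<rho> w x) = \<rho> w x"
          using fixes_translate_iff[OF uc inv_closed[OF wc], of "\<rho> w x"] by blast
        have "conj_by W u (inv w) \<in> generate W J"
          unfolding conj_by_def using u U w(1) wc generate_inv[OF J w(1)]
          by (auto intro!: generate.eng)
        then have "conj_by W u (inv w) \<in> generate W K"
          using dominant_orbit_unique(2)[OF J _ w(2)] fx w(2) unfolding K_def by simp
        then show ?thesis using fixes_translated_generic_iff[OF K(2) uc, of "inv w"] wc by simp
      qed
      then have "\<rho> (inv w) (generic K) \<in> X" using XI by blast
      ultimately show "c \<in> g ` P"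
        using x K generate_inv[OF J w(1)] by (intro image_eqI[of _ _ "(K, inv w)"]) (auto simp: g_def P_def)
    qed
  qed
  have fibre: "sum h {p \<in> P. g p = c} = (-1) ^ dim (X \<inter> cell_span ?A c)" if c: "c \<in> g ` P" for c
  proof -
    obtain K w where Kw: "K \<subseteq> J" "w \<in> generate W J" "\<rho> w (generic K) \<in> X" "c = sign_vector ?A (\<rho> w (generic K))"
      using c by (auto simp: g_def P_def)
    have KS: "K \<subseteq> S" using Kw J by blast
    have wc: "w \<in> carrier W" using Kw(2) generate_closed[OF J] by blast
    have WK: "generate W K \<subseteq> generate W J" using Kw(1) by (rule mono_generate)
    have eq: "{p \<in> P. g p = c} = (\<lambda>x. (K, w \<otimes> x)) ` generate W K" (is "?F = ?G")
    proof
      show "?F \<subseteq> ?G"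
      proof
        fix p assume p: "p \<in> ?F"
        obtain L v where Lv: "p = (L, v)" "(L, v) \<in> P" "g (L, v) = c" using p by (cases p) simp
        then have *: "L \<subseteq> J" "v \<in> generate W J" by (auto simp: P_def)
        have "sign_vector ?A (\<rho> w (generic K)) = sign_vector ?A (\<rho> v (generic L))"
          using Lv(3) Kw(4) by (simp add: g_def)
        then have m: "K = L" "inv w \<otimes> v \<in> generate W K"
          using sign_vector_generic_eq_iff[OF J Kw(1) *(1) Kw(2) *(2)] by blast+
        have "w \<otimes> (inv w \<otimes> v) = v"
          using wc generate_closed[OF J *(2)] by (simp add: m_assoc[symmetric])
        then show "p \<in> ?G" using m unfolding Lv(1) by (intro image_eqI[of _ _ "inv w \<otimes> v"]) simp_all
      qed
      show "?G \<subseteq> ?F"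
      proof
        fix p assume "p \<in> ?G"
        then obtain x where p: "p = (K, w \<otimes> x)" and x: "x \<in> generate W K" by blast
        have xc: "x \<in> carrier W" using generate_closed[OF KS x] .
        have "\<rho> (w \<otimes> x) (generic K) = \<rho> w (generic K)"
          using fixes_generic_iff[OF KS xc] x wc xc by simp
        moreover have "w \<otimes> x \<in> generate W J" using x WK Kw(2) by (blast intro: generate.eng)
        ultimately show "p \<in> ?F"
          using Kw unfolding p by (simp add: P_def g_def)
      qed
    qed
    have inj: "inj_on (\<lambda>x. (K, w \<otimes> x)) (generate W K)"
      using wc generate_closed[OF KS] by (auto simp: inj_on_def)
    have "generate W K \<noteq> {}" using generate.one by blast
    then have "card (generate W K) \<noteq> 0" using finite_generate[OF KS] by simp
    then have "sum h {p \<in> P. g p = c} = (-1) ^ (DIM('v) + card K)"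
      unfolding eq by (simp add: sum.reindex[OF inj] h_def)
    \<comment> \<open>The flat has dimension DIM - card K; the exponent with the sum has the same
      parity and avoids subtraction.\<close>
    also have "\<dots> = (-1) ^ dim (flat K)"
      using dim_flat[OF KS] by (simp add: minus_one_power_iff flip: dim_flat[OF KS])
    also have "dim (flat K) = dim (X \<inter> cell_span ?A c)"
    proof -
      have "\<rho> w ` flat K \<subseteq> X"
      proof clarify
        fix z assume z: "z \<in> flat K"
        have "\<rho> u (\<rho> w z) = \<rho> w z" if u: "u \<in> U" for u
        proof -
          have "conj_by W u w \<in> generate W K"
            using fixes_translated_generic_iff[OF KS Uc[OF u] wc] Kw(3) XI u by blast
          then have "\<rho> (conj_by W u w) z = z"
            using z by (intro rho_fixes_if_orthogonal[OF KS]) (auto simp: flat_def)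
          then show ?thesis using fixes_translate_iff[OF Uc[OF u] wc] by simp
        qed
        then show "\<rho> w z \<in> X" using XI by blast
      qed
      then have "X \<inter> cell_span ?A c = \<rho> w ` flat K"
        unfolding Kw(4) cell_span_generic[OF J Kw(1,2)] by blast
      then show ?thesis
        using dim_image_eq[OF linear_rho[OF wc], of "flat K"] wc by (simp add: inj_on_def)
    qed
    finally show ?thesis .
  qed
  have "sum h P = (\<Sum>c\<in>g ` P. sum h {p \<in> P. g p = c})" by (rule sum.image_gen[OF finP])
  also have "\<dots> = (\<Sum>c\<in>sign_vector ?A ` X. (-1) ^ dim (X \<inter> cell_span ?A c))"
    using fibre unfolding image[symmetric] by (intro sum.cong) auto
  also have "\<dots> = (-1) ^ dim X" by (rule euler_relation[OF finite_parabolic_roots X])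
  finally show ?thesis unfolding P_def h_def .
qed

section \<open>The number of conjugates with full support\<close>

lemma fixed_space_reflection: "t \<in> T \<Longrightarrow> fixed_space t = {v. root_of t \<bullet> v = 0}"
  by (simp add: fixed_space_def fixed_by_reflection_iff)

text \<open>
  The left side says that the root \<open>\<beta>\<close> lies in the image of \<open>x \<mapsto> x - u\<inverse> x\<close>, and \<open>\<beta> = x - u\<inverse> x\<close> makes
  \<open>x\<close> a fixed point of \<open>u t\<close> with \<open>\<beta> \<bullet> x = 1/2\<close>.
\<close>

lemma fixed_space_subset_iff_not:
  assumes u: "u \<in> carrier W" and t: "t \<in> T"
  shows "fixed_space u \<subseteq> fixed_space t \<longleftrightarrow> \<not> fixed_space (u \<otimes> t) \<subseteq> fixed_space t"
proof
  let ?\<beta> = "root_of t"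
  have unit: "?\<beta> \<bullet> ?\<beta> = 1" using root_unit t by simp
  have ut: "\<rho> (u \<otimes> t) x = \<rho> u (x - (2 * (?\<beta> \<bullet> x)) *\<^sub>R ?\<beta>)" for x
    using u t by (simp add: rho_reflection)
  {
    assume sub: "fixed_space u \<subseteq> fixed_space t"
    define f where "f x = \<rho> u x - x" for x
    define f' where "f' x = \<rho> (inv u) x - x" for x
    have lin: "linear f" "linear f'"
      unfolding f_def f'_def using u by (auto intro!: linear_compose_sub linear_rho linear_id[unfolded id_def])
    have "f x \<bullet> y = x \<bullet> f' y" for x y
      using u rho_inner_left[of "inv u" x y] by (simp add: f_def f'_def inner_diff_left inner_diff_right)
    \<comment> \<open>The range of \<open>f'\<close> is the orthogonal complement of the kernel of
      its adjoint \<open>f\<close>, which is the fixed space of u; this puts \<beta> into the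
      range.\<close>
    then have "adjoint f = f'" by (intro adjoint_unique) simp
    have "f -` {0} = (range f')\<^sup>\<bottom>"
      using ker_orthogonal_comp_adjoint[OF lin(1)] \<open>adjoint f = f'\<close> by simp
    moreover have "f -` {0} = fixed_space u" by (auto simp: f_def fixed_space_def)
    moreover have "?\<beta> \<in> (fixed_space u)\<^sup>\<bottom>"
      using sub by (auto simp: orthogonal_comp_def orthogonal_def fixed_space_reflection[OF t] inner_commute)
    moreover have "subspace (range f')" using lin(2) by (simp add: linear_subspace_image)
    ultimately have "?\<beta> \<in> range f'" by (metis orthogonal_comp_self)
    then obtain y where "?\<beta> = f' y" by blast
    then obtain x where x: "?\<beta> = x - \<rho> (inv u) x"
      using u rho_minus[of "inv u" y] by (metis f'_def diff_minus_eq_add uminus_add_conv_diff inv_closed)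
    have "1 = (x - \<rho> (inv u) x) \<bullet> (x - \<rho> (inv u) x)" using unit x by simp
    also have "\<dots> = 2 * ((x - \<rho> (inv u) x) \<bullet> x)"
      using u rho_inner[of "inv u" x x] by (simp add: inner_diff_left inner_diff_right inner_commute)
    finally have half: "2 * (?\<beta> \<bullet> x) = 1" using x by simp
    have "\<rho> (u \<otimes> t) x = \<rho> u (x - ?\<beta>)" unfolding ut half by simp
    also have "\<dots> = x" using u x by simp
    finally have "x \<in> fixed_space (u \<otimes> t)" by (simp add: fixed_space_def)
    moreover have "x \<notin> fixed_space t" using half by (auto simp: fixed_space_reflection[OF t])
    ultimately show "\<not> fixed_space (u \<otimes> t) \<subseteq> fixed_space t" by blast
  }
  {
    assume "\<not> fixed_space (u \<otimes> t) \<subseteq> fixed_space t"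
    then obtain x where x: "\<rho> (u \<otimes> t) x = x" "?\<beta> \<bullet> x \<noteq> 0"
      by (auto simp: fixed_space_def[of "u \<otimes> t"] fixed_space_reflection[OF t])
    let ?c = "2 * (?\<beta> \<bullet> x)"
    have "\<rho> (inv u) x = x - ?c *\<^sub>R ?\<beta>" using x(1) u unfolding ut by (metis rho_inv_cancel(1))
    then have \<beta>: "?c *\<^sub>R ?\<beta> = x - \<rho> (inv u) x" by simp
    have "?\<beta> \<bullet> z = 0" if z: "\<rho> u z = z" for z
    proof -
      have "?c * (?\<beta> \<bullet> z) = (x - \<rho> (inv u) x) \<bullet> z" unfolding \<beta>[symmetric] by simp
      also have "\<dots> = 0" using rho_inner_left[OF u, of x z] z by (simp add: inner_diff_left)
      finally show ?thesis using x(2) by simp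
    qed
    then show "fixed_space u \<subseteq> fixed_space t"
      by (auto simp: fixed_space_def[of u] fixed_space_reflection[OF t])
  }
qed

lemma T_square: "t \<in> T \<Longrightarrow> t \<otimes> t = \<one>"
  by (rule rho_inj) (simp_all add: rho_reflection inner_diff_right root_unit)

text \<open>With d = dim (Fix u \<inter> H_t), the fixed spaces of u and u t have dimensions d and d
  + 1 in some order, and (-1)^d d + (-1)^(d+1) (d + 1) = - (-1)^d. Weighting the sign by the
  dimension is thus what eliminates t.\<close>

lemma sum_fixed_space_Int_hyperplane:
  assumes J: "J \<subseteq> S" and t: "t \<in> T" "t \<in> generate W J"
  shows "(\<Sum>u\<in>generate W J. (-1 :: real) ^ dim (fixed_space u \<inter> fixed_space t)) =
    - 2 * (\<Sum>u\<in>generate W J. (-1) ^ dim (fixed_space u) * real (dim (fixed_space u)))"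
proof -
  define g where "g u = (-1 :: real) ^ dim (fixed_space u) * real (dim (fixed_space u))" for u
  have tc: "t \<in> carrier W" using t by simp
  have step: "(-1) ^ dim (fixed_space u \<inter> fixed_space t) = - (g u + g (u \<otimes> t))"
    if uJ: "u \<in> generate W J" for u
  proof -
    have u: "u \<in> carrier W" using uJ generate_closed[OF J] by blast
    let ?d = "dim (fixed_space u \<inter> fixed_space t)"
    have big: "dim (fixed_space x) = (if fixed_space x \<subseteq> fixed_space t then
      dim (fixed_space x \<inter> fixed_space t) else Suc (dim (fixed_space x \<inter> fixed_space t)))"
      if x: "x \<in> carrier W" for x
    proof (cases "fixed_space x \<subseteq> fixed_space t")
      case False
      then obtain y where "y \<in> fixed_space x" "root_of t \<bullet> y \<noteq> 0"
        by (auto simp: fixed_space_reflection[OF t(1)])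
      then show ?thesis
        using dim_Int_hyperplane[OF subspace_fixed_space[OF x]] False
        by (simp add: fixed_space_reflection[OF t(1)])
    qed (simp add: Int_absorb2)
    have "fixed_space (u \<otimes> t) \<inter> fixed_space t = fixed_space u \<inter> fixed_space t"
      using u tc by (auto simp: fixed_space_def)
    then show ?thesis
      using big[OF u] big[of "u \<otimes> t"] fixed_space_subset_iff_not[OF u t(1)] u tc
      by (cases "fixed_space u \<subseteq> fixed_space t") (simp_all add: g_def algebra_simps)
  qed
  have "(\<Sum>u\<in>generate W J. (-1 :: real) ^ dim (fixed_space u \<inter> fixed_space t)) =
    - ((\<Sum>u\<in>generate W J. g u) + (\<Sum>u\<in>generate W J. g (u \<otimes> t)))"
    by (simp add: step sum.distrib sum_negf sum_subtractf)
  also have "(\<Sum>u\<in>generate W J. g (u \<otimes> t)) = (\<Sum>u\<in>generate W J. g u)"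
    using t generate_closed[OF J] T_square[OF t(1)] tc
    by (intro sum.reindex_bij_witness[of _ "\<lambda>u. u \<otimes> t" "\<lambda>u. u \<otimes> t"])
      (auto simp: m_assoc intro: generate.eng)
  finally show ?thesis by (simp add: g_def)
qed

text \<open>Conjugating elements are counted rather than conjugates, because the chambers counted by
  2 l(E) correspond to group elements.\<close>

definition full_support_count :: "'g set \<Rightarrow> 'g \<Rightarrow> nat" where
  "full_support_count J t = card {u \<in> generate W J. support W S (conj_by W t u) = J}"

lemma card_translated_stabilizer:
  assumes J: "J \<subseteq> S" and K: "K \<subseteq> J" and w: "w \<in> generate W J"
  shows "card {u \<in> generate W J. conj_by W u w \<in> generate W K} = card (generate W K)"
proof (rule bij_betw_same_card)
  have wc: "w \<in> carrier W" using generate_closed J w by blast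
  have KS: "K \<subseteq> S" using K J by blast
  have KJ: "generate W K \<subseteq> generate W J" using K by (rule mono_generate)
  show "bij_betw (\<lambda>u. conj_by W u w) {u \<in> generate W J. conj_by W u w \<in> generate W K} (generate W K)"
  proof (rule bij_betwI[of _ _ _ "\<lambda>x. conj_by W x (inv w)"])
    have "conj_by W x (inv w) \<in> generate W J" if "x \<in> generate W K" for x
      unfolding conj_by_def using that KJ w wc generate_inv[OF J w] by (auto intro!: generate.eng)
    then show "(\<lambda>x. conj_by W x (inv w)) \<in> generate W K \<rightarrow> {u \<in> generate W J. conj_by W u w \<in> generate W K}"
      using wc generate_closed[OF KS] by auto
  qed (use wc generate_closed[OF KS] generate_closed[OF J] in auto)
qed

text \<open>The point is that t has disappeared from the right side.\<close>

lemma full_support_count_eq: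
  assumes J: "J \<subseteq> S" and t: "t \<in> T" "t \<in> generate W J"
  shows "(-1) ^ (DIM('v) + card J) * real (full_support_count J t) =
    - 2 * (\<Sum>u\<in>generate W J. (-1) ^ dim (fixed_space u) * real (dim (fixed_space u)))"
proof -
  let ?n = "DIM('v)"
  let ?G = "generate W J"
  have finJ: "finite J" using finite_S J finite_subset by blast
  have finG: "finite ?G" using finite_generate J by blast
  have tc: "t \<in> carrier W" using t by simp
  have Gc: "w \<in> carrier W" if "w \<in> ?G" for w using that generate_closed[OF J] by blast
  have fix_iff: "\<rho> w (generic K) \<in> fixed_space u \<longleftrightarrow> conj_by W u w \<in> generate W K"
    if "K \<subseteq> J" "w \<in> ?G" "u \<in> ?G" for K w u
    using fixes_translated_generic_iff[of K u w] that J Gc unfolding fixed_space_def by auto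
  have supp: "support W S (conj_by W t w) \<subseteq> K \<longleftrightarrow> conj_by W t w \<in> generate W K"
    if "K \<subseteq> J" "w \<in> ?G" for K w
    using support_subset_iff[of K "conj_by W t w"] that J Gc tc by auto
  have suppJ: "support W S (conj_by W t w) \<subseteq> J" if w: "w \<in> ?G" for w
  proof -
    have "conj_by W t w \<in> ?G"
      unfolding conj_by_def using t w generate_inv[OF J w] by (auto intro!: generate.eng)
    then show ?thesis using supp[of J w] w by simp
  qed
  define e where "e K w = (if conj_by W t w \<in> generate W K then (-1 :: real) ^ (?n + card K) else 0)" for K w
  define c where "c K = real (card (generate W K))" for K
  have c0: "c K \<noteq> 0" if "K \<subseteq> J" for K
  proof -
    have "generate W K \<noteq> {}" using generate.one by blast
    then show ?thesis using finite_generate[of K] that J by (auto simp: c_def)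
  qed
  have "(-1) ^ (?n + card J) * real (full_support_count J t) =
    (\<Sum>w\<in>?G. if support W S (conj_by W t w) = J then (-1) ^ (?n + card J) else 0)"
    unfolding full_support_count_def using finG
    by (simp add: sum.If_cases Int_def mult.commute)
  also have "\<dots> = (\<Sum>w\<in>?G. \<Sum>K\<in>Pow J. e K w)"
  proof (rule sum.cong)
    fix w assume w: "w \<in> ?G"
    let ?B = "support W S (conj_by W t w)"
    have "(\<Sum>K\<in>Pow J. e K w) = (\<Sum>K\<in>Pow J. if ?B \<subseteq> K then (-1) ^ ?n * (-1) ^ card K else 0)"
      using supp w by (intro sum.cong) (auto simp: e_def power_add)
    also have "\<dots> = (\<Sum>K | ?B \<subseteq> K \<and> K \<subseteq> J. (-1) ^ ?n * (-1) ^ card K)"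
      using finJ by (intro sum.mono_neutral_cong_right) auto
    also have "\<dots> = (-1) ^ ?n * (if ?B = J then (-1) ^ card J else 0)"
      using alternating_sum_supersets[OF finJ suppJ[OF w]] by (simp flip: sum_distrib_left)
    finally show "(if ?B = J then (-1) ^ (?n + card J) else 0) = (\<Sum>K\<in>Pow J. e K w)"
      by (simp add: power_add)
  qed simp
  \<comment> \<open>A factor 1 is written as the number of u \<in> W_J fixing the face of (K, w),
    divided by |W_K|. Once the sums are exchanged, the faces that are fixed by u and lie in H_t form
    an Euler relation for Fix u \<inter> H_t.\<close>
  also have "\<dots> = (\<Sum>w\<in>?G. \<Sum>K\<in>Pow J. \<Sum>u\<in>?G. if conj_by W u w \<in> generate W K then e K w / c K else 0)"
  proof (intro sum.cong refl)
    fix w K assume wK: "w \<in> ?G" "K \<in> Pow J"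
    have "(\<Sum>u\<in>?G. if conj_by W u w \<in> generate W K then e K w / c K else 0) =
      real (card {u \<in> ?G. conj_by W u w \<in> generate W K}) * (e K w / c K)"
      using finG by (simp add: sum.If_cases Int_def)
    then show "e K w = (\<Sum>u\<in>?G. if conj_by W u w \<in> generate W K then e K w / c K else 0)"
      using card_translated_stabilizer[OF J, of K w] wK c0[of K] by (simp add: c_def)
  qed
  also have "\<dots> = (\<Sum>(w, K)\<in>?G \<times> Pow J. \<Sum>u\<in>?G. if conj_by W u w \<in> generate W K then e K w / c K else 0)"
    by (rule sum.cartesian_product)
  also have "\<dots> = (\<Sum>u\<in>?G. \<Sum>(w, K)\<in>?G \<times> Pow J. if conj_by W u w \<in> generate W K then e K w / c K else 0)"
    unfolding case_prod_unfold by (rule sum.swap)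
  also have "\<dots> = (\<Sum>u\<in>?G. (-1) ^ dim (fixed_space u \<inter> fixed_space t))"
  proof (rule sum.cong)
    fix u assume u: "u \<in> ?G"
    have X: "(\<Inter>x\<in>{u, t}. fixed_space x) = fixed_space u \<inter> fixed_space t" by simp
    have "(\<Sum>(w, K)\<in>?G \<times> Pow J. if conj_by W u w \<in> generate W K then e K w / c K else 0) =
      (\<Sum>(K, w) | K \<subseteq> J \<and> w \<in> ?G \<and> \<rho> w (generic K) \<in> fixed_space u \<inter> fixed_space t.
        (-1 :: real) ^ (?n + card K) / c K)"
    proof -
      have "(\<Sum>(w, K)\<in>?G \<times> Pow J. if conj_by W u w \<in> generate W K then e K w / c K else 0) =
        (\<Sum>(K, w)\<in>Pow J \<times> ?G. if conj_by W u w \<in> generate W K then e K w / c K else 0)"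
        by (rule sum.reindex_bij_witness[of _ "\<lambda>(a, b). (b, a)" "\<lambda>(a, b). (b, a)"]) auto
      also have "\<dots> = (\<Sum>(K, w) | K \<subseteq> J \<and> w \<in> ?G \<and> \<rho> w (generic K) \<in> fixed_space u \<inter> fixed_space t.
        (-1 :: real) ^ (?n + card K) / c K)"
        using finJ finG fix_iff u t(2)
        by (intro sum.mono_neutral_cong_right) (auto simp: e_def split: if_splits)
      finally show ?thesis .
    qed
    also have "\<dots> = (-1) ^ dim (fixed_space u \<inter> fixed_space t)"
      using euler_relation_fixed_space[OF J, of "{u, t}"] u t(2) unfolding X c_def by simp
    finally show "(\<Sum>(w, K)\<in>?G \<times> Pow J. if conj_by W u w \<in> generate W K then e K w / c K else 0) =
      (-1) ^ dim (fixed_space u \<inter> fixed_space t)" .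
  qed simp
  also have "\<dots> = - 2 * (\<Sum>u\<in>?G. (-1) ^ dim (fixed_space u) * real (dim (fixed_space u)))"
    by (rule sum_fixed_space_Int_hyperplane[OF J t])
  finally show ?thesis .
qed

lemma full_support_count_indep:
  assumes "J \<subseteq> S" "t \<in> T" "t \<in> generate W J" "t' \<in> T" "t' \<in> generate W J"
  shows "full_support_count J t = full_support_count J t'"
proof -
  have "(-1) ^ (DIM('v) + card J) * real (full_support_count J t) =
    (-1) ^ (DIM('v) + card J) * real (full_support_count J t')"
    using full_support_count_eq assms by simp
  then show ?thesis by simp
qed


section \<open>Irreducible subsets\<close>

definition graph :: "'g set \<Rightarrow> ('g \<times> 'g) set" where
  "graph K = {(p, q). p \<in> K \<and> q \<in> K \<and> p \<noteq> q \<and> coxeter_exponent W p q \<noteq> 2}"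

lemma irreducible_subset_iff:
  "irreducible_subset W K \<longleftrightarrow> K \<noteq> {} \<and> (\<forall>s\<in>K. \<forall>t\<in>K. (s, t) \<in> (graph K)\<^sup>*)"
  by (simp add: irreducible_subset_def graph_def)

lemma exponent_commute:
  assumes "p \<in> S" "q \<in> S"
  shows "coxeter_exponent W p q = coxeter_exponent W q p"
proof -
  have pq: "p \<otimes> q \<in> carrier W" and inv: "q \<otimes> p = inv (p \<otimes> q)"
    using assms by (simp_all add: inv_mult_group)
  then show ?thesis using ord_inv[OF pq] by (simp add: coxeter_exponent_def)
qed

lemma sym_graph: "K \<subseteq> S \<Longrightarrow> sym (graph K)"
  using exponent_commute by (auto simp: sym_def graph_def subset_iff)

lemma irreducible_cut:
  assumes "irreducible_subset W J" "B \<subseteq> J" "B \<noteq> {}" "B \<noteq> J"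
  shows "\<exists>p\<in>B. \<exists>q\<in>J - B. coxeter_exponent W p q \<noteq> 2"
proof (rule ccontr)
  assume none: "\<not> ?thesis"
  obtain s t where s: "s \<in> B" and t: "t \<in> J" "t \<notin> B" using assms by blast
  have "(s, t) \<in> (graph J)\<^sup>*" using assms s t by (auto simp: irreducible_subset_iff)
  then have "t \<in> B"
  proof induction
    case (step y z)
    then show ?case using none by (auto simp: graph_def)
  qed (rule s)
  then show False using t by blast
qed

text \<open>Allowing any symmetric part R of the graph covers both components of the Coxeter graph
  and components formed with odd exponents only.\<close>

lemma component_irreducible:
  assumes R: "sym R" "R \<subseteq> graph S" and s: "s \<in> S"
  shows "irreducible_subset W (R\<^sup>* `` {s})" "R\<^sup>* `` {s} \<subseteq> S"
proof -
  let ?C = "R\<^sup>* `` {s}"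
  have sub: "?C \<subseteq> S"
  proof
    fix x assume "x \<in> ?C"
    then have "(s, x) \<in> R\<^sup>*" by simp
    then show "x \<in> S" by cases (use s R(2) in \<open>auto simp: graph_def\<close>)
  qed
  have reach: "(s, x) \<in> (graph ?C)\<^sup>*" if "(s, x) \<in> R\<^sup>*" for x
    using that
  proof induction
    case (step y z)
    then have "z \<in> ?C" "y \<in> ?C" by (auto intro: rtrancl_into_rtrancl)
    then have "(y, z) \<in> graph ?C" using step.hyps(2) R(2) by (auto simp: graph_def)
    then show ?case using step.IH by (rule rtrancl_into_rtrancl[rotated])
  qed simp
  have "sym ((graph ?C)\<^sup>*)" using sym_graph[OF sub] by (rule sym_rtrancl)
  then have "(x, y) \<in> (graph ?C)\<^sup>*" if "x \<in> ?C" "y \<in> ?C" for x y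
    using reach[of x] reach[of y] that by (auto dest: symD intro: rtrancl_trans)
  moreover have "s \<in> ?C" by simp
  ultimately show "irreducible_subset W ?C" unfolding irreducible_subset_iff by blast
  show "?C \<subseteq> S" by (rule sub)
qed

lemma support_conj_by:
  assumes "t \<in> T" "x \<in> carrier W"
  shows "support W S (conj_by W t x) = {s \<in> S. \<omega> s \<bullet> \<rho> (inv x) (root_of t) \<noteq> 0}"
  unfolding support_reflection[OF conj_by_T[OF assms]] using root_of_conj_by[OF assms] by auto

lemma conj_by_in_generate:
  assumes "J \<subseteq> S" "t \<in> generate W J" "u \<in> generate W J"
  shows "conj_by W t u \<in> generate W J"
  unfolding conj_by_def using assms generate_inv[OF assms(1,3)] by (auto intro!: generate.eng)

lemma omega_rho_gen: "q \<in> S \<Longrightarrow> \<omega> s \<bullet> \<rho> q v = \<omega> s \<bullet> v - (if s = q then 2 * (\<alpha> q \<bullet> v) else 0)"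
  using omega_alpha[of q s] by (simp add: rho_gen inner_diff_right)

text \<open>For u with the largest support of \<open>conj_by W t u\<close>, a simple q outside this
  support but adjacent to it would have negative product with the root. Reflecting in q would then
  add q with a positive coefficient and leave the other coefficients alone.\<close>

lemma ex_full_support:
  assumes J: "J \<subseteq> S" "irreducible_subset W J" and t: "t \<in> T" "t \<in> generate W J"
  shows "\<exists>u\<in>generate W J. support W S (conj_by W t u) = J"
proof -
  define f where "f u = card (support W S (conj_by W t u))" for u
  have fin: "finite (generate W J)" using finite_generate J by blast
  have "generate W J \<noteq> {}" using generate.one by blast
  then have "Max (f ` generate W J) \<in> f ` generate W J" using fin by (intro Max_in) auto
  then obtain u where u: "u \<in> generate W J" "f u = Max (f ` generate W J)" by auto
  have max: "f v \<le> f u" if "v \<in> generate W J" for v using that u fin by simp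
  have uc: "u \<in> carrier W" using u J generate_closed by blast
  let ?t = "conj_by W t u"
  let ?B = "support W S ?t"
  have tT: "?t \<in> T" using t uc by simp
  have "?B \<subseteq> J"
    using support_subset_iff[OF J(1), of ?t] conj_by_in_generate[OF J(1) t(2) u(1)] tT by simp
  moreover have "?B = J"
  proof (rule ccontr)
    assume "?B \<noteq> J"
    then obtain p q where pq: "p \<in> ?B" "q \<in> J" "q \<notin> ?B" "coxeter_exponent W p q \<noteq> 2"
      using irreducible_cut[OF J(2) \<open>?B \<subseteq> J\<close> support_reflection_nonempty[OF tT]] by blast
    have q: "q \<in> S" and p: "p \<in> S" using pq J support_subset by blast+
    have neg: "\<alpha> q \<bullet> root_of ?t < 0"
    proof -
      have "(\<Sum>s\<in>S. (\<omega> s \<bullet> root_of ?t) * (\<alpha> q \<bullet> \<alpha> s)) < 0"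
      proof (rule sum_strict_mono_ex1[where g = "\<lambda>_. 0", simplified])
        show "finite S" by (rule finite_S)
        show "\<forall>s\<in>S. (\<omega> s \<bullet> root_of ?t) * (\<alpha> q \<bullet> \<alpha> s) \<le> 0"
        proof
          fix s assume s: "s \<in> S"
          have "0 \<le> \<omega> s \<bullet> root_of ?t" using root_of_nonneg[OF tT] s by (simp add: nonneg_def)
          moreover have "s = q \<Longrightarrow> \<omega> s \<bullet> root_of ?t = 0"
            using pq q support_reflection[OF tT] by auto
          moreover have "s \<noteq> q \<Longrightarrow> \<alpha> q \<bullet> \<alpha> s \<le> 0" using gram_nonpos s q by blast
          ultimately show "(\<omega> s \<bullet> root_of ?t) * (\<alpha> q \<bullet> \<alpha> s) \<le> 0"
            by (cases "s = q") (simp_all add: mult_nonneg_nonpos)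
        qed
        have "0 < \<omega> p \<bullet> root_of ?t"
          using pq(1) root_of_nonneg[OF tT] support_reflection[OF tT] p
          by (force simp: nonneg_def)
        moreover have "\<alpha> q \<bullet> \<alpha> p < 0"
          using gram_adjacent[OF p q _ pq(4)] pq by (force simp: inner_commute)
        ultimately show "\<exists>s\<in>S. (\<omega> s \<bullet> root_of ?t) * (\<alpha> q \<bullet> \<alpha> s) < 0"
          using p by (intro bexI[of _ p] mult_pos_neg)
      qed
      then show ?thesis using inner_expansion[of "\<alpha> q" "root_of ?t"] by simp
    qed
    have "support W S (conj_by W ?t q) = insert q ?B"
      using support_conj_by[OF tT, of q] support_reflection[OF tT] q neg pq(3)
      by (auto simp: omega_rho_gen)
    then have "f (u \<otimes> q) = Suc (f u)"
      using t uc q pq(3) finite_subset[OF support_subset finite_S] by (simp add: f_def conj_by_mult)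
    moreover have "u \<otimes> q \<in> generate W J" by (rule generate.eng[OF u(1) generate.incl[OF pq(2)]])
    ultimately show False using max by fastforce
  qed
  ultimately show ?thesis using u by blast
qed

text \<open>Take the conjugate whose positive root has least height. Its product with itself is 1,
  so some simple s with positive coefficient has positive product with it, and reflecting in s
  lowers the height unless the root is \<alpha> s.\<close>

lemma reflection_conj_simple:
  assumes J: "J \<subseteq> S" and t: "t \<in> T" "t \<in> generate W J"
  shows "\<exists>u\<in>generate W J. \<exists>s\<in>J. conj_by W t u = s"
proof -
  define h where "h u = root_of (conj_by W t u) \<bullet> generic {}" for u
  have fin: "finite (generate W J)" using finite_generate J by blast
  have "generate W J \<noteq> {}" using generate.one by blast
  then have "Min (h ` generate W J) \<in> h ` generate W J" using fin by (intro Min_in) auto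
  then obtain u where u: "u \<in> generate W J" "h u = Min (h ` generate W J)" by auto
  have min: "h u \<le> h v" if "v \<in> generate W J" for v using that u fin by simp
  have uc: "u \<in> carrier W" using u J generate_closed by blast
  let ?t = "conj_by W t u"
  let ?\<beta> = "root_of ?t"
  have tT: "?t \<in> T" using t uc by simp
  have sp: "spanned J ?\<beta>"
    using reflection_in_parabolic_iff[OF J tT] conj_by_in_generate[OF J t(2) u(1)] by simp
  have "\<exists>s\<in>J. 0 < (\<omega> s \<bullet> ?\<beta>) * (?\<beta> \<bullet> \<alpha> s)"
  proof (rule ccontr)
    assume "\<not> ?thesis"
    then have "(\<Sum>s\<in>J. (\<omega> s \<bullet> ?\<beta>) * (?\<beta> \<bullet> \<alpha> s)) \<le> 0" by (intro sum_nonpos) (auto simp: not_less)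
    then show False using spanned_inner[OF J sp, of ?\<beta>] root_unit[OF root_of_root[OF tT]] by simp
  qed
  then obtain s where s: "s \<in> J" "0 < (\<omega> s \<bullet> ?\<beta>) * (?\<beta> \<bullet> \<alpha> s)" by blast
  have sS: "s \<in> S" using s J by blast
  have "0 \<le> \<omega> s \<bullet> ?\<beta>" using root_of_nonneg[OF tT] sS by (simp add: nonneg_def)
  then have pos: "0 < ?\<beta> \<bullet> \<alpha> s" using s(2) by (simp add: zero_less_mult_iff)
  have "?t = s"
  proof (rule ccontr)
    assume "?t \<noteq> s"
    then have ne: "?\<beta> \<noteq> \<alpha> s" using root_of_inj[OF tT S_subset_T[OF sS]] sS by auto
    define \<gamma> where "\<gamma> = \<rho> s ?\<beta>"
    have \<gamma>: "\<gamma> \<in> roots" using tT sS by (simp add: \<gamma>_def)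
    \<comment> \<open>A coefficient at r \<noteq> s is untouched by the reflection in s, so the
      reflected root stays positive and is the chosen root of the new conjugate.\<close>
    have "\<exists>r\<in>S. r \<noteq> s \<and> \<omega> r \<bullet> ?\<beta> \<noteq> 0"
    proof (rule ccontr)
      assume "\<not> ?thesis"
      then have "?\<beta> = (\<omega> s \<bullet> ?\<beta>) *\<^sub>R \<alpha> s"
        using sS by (intro coefficients_eqI) (auto simp: omega_alpha)
      then have "?\<beta> = - \<alpha> s" using root_proportional[OF root_of_root[OF tT] alpha_root[OF sS]] ne by blast
      then show False using nonneg_antisym[of "\<alpha> s"] root_of_nonneg[OF tT] sS by simp
    qed
    then obtain r where r: "r \<in> S" "r \<noteq> s" "\<omega> r \<bullet> ?\<beta> \<noteq> 0" by blast
    have "0 < \<omega> r \<bullet> ?\<beta>" using r root_of_nonneg[OF tT] by (force simp: nonneg_def)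
    then have "0 < \<omega> r \<bullet> \<gamma>" using r sS by (simp add: \<gamma>_def omega_rho_gen)
    then have "\<not> nonneg (- \<gamma>)" using r by (force simp: nonneg_def)
    moreover have "nonneg (root_of (conj_by W ?t s))"
      using tT sS by (intro root_of_nonneg conj_by_T[OF tT]) simp
    ultimately have "root_of (conj_by W ?t s) = \<gamma>"
      using root_of_conj_by[OF tT, of s] sS by (auto simp: \<gamma>_def)
    then have "h (u \<otimes> s) = \<gamma> \<bullet> generic {}"
      using t uc sS by (simp add: h_def conj_by_mult)
    also have "\<dots> = h u - 2 * (?\<beta> \<bullet> \<alpha> s)"
    proof -
      have "\<alpha> s \<bullet> generic {} = 1" using generic_alpha[OF sS, of "{}"] by (simp add: inner_commute)
      then show ?thesis
        using sS by (simp add: \<gamma>_def h_def rho_gen inner_diff_left inner_commute[of "\<alpha> s" ?\<beta>])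
    qed
    finally have "h (u \<otimes> s) < h u" using pos by simp
    moreover have "u \<otimes> s \<in> generate W J" by (rule generate.eng[OF u(1) generate.incl[OF s(1)]])
    ultimately show False using min by fastforce
  qed
  then show ?thesis using u s by blast
qed

text \<open>For the support K of t, some simple s \<in> K is conjugate to t in W_K. The span of the
  component A of s in K is preserved by W_K, since simple reflections in K - A fix it pointwise. So
  the root of t is spanned by A, and A = K.\<close>

lemma support_irreducible:
  assumes t: "t \<in> T"
  shows "irreducible_subset W (support W S t)"
proof -
  let ?K = "support W S t"
  have K: "?K \<subseteq> S" by (rule support_subset)
  have tK: "t \<in> generate W ?K" using in_generate_support t by simp
  obtain u s where u: "u \<in> generate W ?K" and s: "s \<in> ?K" "conj_by W t u = s"
    using reflection_conj_simple[OF K t tK] by blast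
  have uc: "u \<in> carrier W" using u K generate_closed by blast
  have sS: "s \<in> S" using s K by blast
  define A where "A = {x \<in> ?K. (s, x) \<in> (graph ?K)\<^sup>*}"
  have "A \<subseteq> S" using K by (auto simp: A_def)
  have sA: "s \<in> A" using s by (simp add: A_def)
  have "spanned A (\<rho> x (\<alpha> s))" if "x \<in> generate W ?K" for x
    using K that
  proof (induction rule: generate_induct)
    case one
    then show ?case using sA sS by simp
  next
    case (gen q x)
    have q: "q \<in> S" and x: "x \<in> carrier W" using gen K generate_closed[OF K] by blast+
    have "\<rho> q (\<rho> x (\<alpha> s)) = \<rho> x (\<alpha> s) - (2 * (\<alpha> q \<bullet> \<rho> x (\<alpha> s))) *\<^sub>R \<alpha> q" using q by (rule rho_gen)
    moreover have "spanned A ((2 * (\<alpha> q \<bullet> \<rho> x (\<alpha> s))) *\<^sub>R \<alpha> q)"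
    proof (cases "q \<in> A")
      case True
      then show ?thesis using q by (intro spanned_scale) simp
    next
      case False
      have "\<alpha> q \<bullet> \<alpha> a = 0" if a: "a \<in> A" for a
      proof (rule gram_nonadjacent[OF q])
        show "a \<in> S" using a \<open>A \<subseteq> S\<close> by blast
        show "coxeter_exponent W q a = 2"
        proof (rule ccontr)
          assume "coxeter_exponent W q a \<noteq> 2"
          then have "(a, q) \<in> graph ?K"
            using a False gen.hyps(1) exponent_commute[OF q, of a] \<open>A \<subseteq> S\<close> by (auto simp: graph_def A_def)
          then have "q \<in> A" using a gen.hyps(1) by (auto simp: A_def intro: rtrancl_into_rtrancl)
          then show False using False by blast
        qed
      qed
      then have "\<alpha> q \<bullet> \<rho> x (\<alpha> s) = 0"
        using spanned_inner[OF \<open>A \<subseteq> S\<close> gen.IH, of "\<alpha> q"] by simp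
      then show ?thesis by (simp add: spanned_def)
    qed
    ultimately show ?case using gen.IH q x by (simp add: spanned_diff)
  qed
  then have "spanned A (\<rho> u (\<alpha> s))" using u by blast
  moreover have "t = conj_by W s (inv u)" using s t uc by auto
  then have "root_of t = \<rho> u (\<alpha> s) \<or> root_of t = - \<rho> u (\<alpha> s)"
    using root_of_conj_by[OF S_subset_T[OF sS], of "inv u"] uc sS by simp
  ultimately have "spanned A (root_of t)" by (auto simp: spanned_uminus)
  then have "?K \<subseteq> A"
    using reflection_in_parabolic_iff[OF \<open>A \<subseteq> S\<close> t] support_subset_iff[OF \<open>A \<subseteq> S\<close>] t by simp
  then have reach: "(s, x) \<in> (graph ?K)\<^sup>*" if "x \<in> ?K" for x using that by (auto simp: A_def)
  have "sym ((graph ?K)\<^sup>*)" using sym_graph[OF K] by (rule sym_rtrancl)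
  then have "(x, y) \<in> (graph ?K)\<^sup>*" if "x \<in> ?K" "y \<in> ?K" for x y
    using reach[of x] reach[of y] that by (auto dest: symD intro: rtrancl_trans)
  then show ?thesis using s unfolding irreducible_subset_iff by blast
qed

section \<open>Fusion of reflections\<close>

definition odd_graph :: "'g set \<Rightarrow> ('g \<times> 'g) set" where
  "odd_graph K = {(p, q). p \<in> K \<and> q \<in> K \<and> p \<noteq> q \<and> odd (coxeter_exponent W p q)}"

lemma odd_graph_subset: "K \<subseteq> S \<Longrightarrow> odd_graph K \<subseteq> graph S"
  by (auto simp: odd_graph_def graph_def)

lemma sym_odd_graph: "K \<subseteq> S \<Longrightarrow> sym (odd_graph K)"
  using exponent_commute by (auto simp: sym_def odd_graph_def subset_iff)

lemma alt_in_generate: "p \<in> J \<Longrightarrow> q \<in> J \<Longrightarrow> alt p q k \<in> generate W J"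
  by (induction k) (auto intro: generate.intros)

text \<open>For an odd exponent m the braid relation reads p a = a q, with a an alternating word of
  m - 1 letters.\<close>

lemma odd_graph_conj:
  assumes "J \<subseteq> S" "(p, q) \<in> odd_graph J"
  shows "\<exists>u\<in>generate W J. conj_by W p u = q"
proof -
  have pq: "p \<in> J" "q \<in> J" "p \<in> S" "q \<in> S"
    using assms by (auto simp: odd_graph_def)
  have odd: "odd (coxeter_exponent W q p)"
    using assms(2) exponent_commute[OF pq(3,4)] by (simp add: odd_graph_def)
  then obtain j where j: "coxeter_exponent W q p = Suc j" "even j" by (metis even_Suc odd_pos gr0_implies_Suc)
  let ?a = "alt q p j"
  have "p \<otimes> ?a = alt q p (Suc j)" using j(2) by simp
  also have "\<dots> = alt p q (Suc j)" using alt_braid[OF pq(4,3), of "Suc j"] j by simp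
  also have "\<dots> = ?a \<otimes> q" using alt_Suc_right[OF pq(4,3)] .
  finally have "conj_by W p ?a = q"
    using pq by (simp add: conj_by_def m_assoc) (simp add: m_assoc[symmetric])
  then show ?thesis using alt_in_generate pq by blast
qed

text \<open>Deleting or inserting a relator does not change the parity of the number of letters in \<open>C\<close>.\<close>

lemma conj_simple_odd_closed:
  assumes C: "\<And>p q. p \<in> C \<Longrightarrow> p \<in> S \<Longrightarrow> q \<in> S \<Longrightarrow> odd (coxeter_exponent W p q) \<Longrightarrow> q \<in> C"
    and st: "s \<in> S" "t \<in> S" "z \<in> carrier W" "t = conj_by W s z" "s \<in> C"
  shows "t \<in> C"
proof -
  define c where "c ws = length (filter (\<lambda>x. x \<in> C) ws)" for ws
  have c: "c (us @ vs) = c us + c vs" for us vs by (simp add: c_def)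
  have rel: "even (c (concat (replicate (coxeter_exponent W p q) [p, q])))" if pq: "p \<in> S" "q \<in> S" for p q
  proof -
    have "c (concat (replicate m [p, q])) = m * c [p, q]" for m
      by (induction m) (auto simp: c_def)
    moreover have "even (coxeter_exponent W p q * c [p, q])"
      using C[of p q] C[of q p] pq exponent_commute[OF pq] by (auto simp: c_def)
    ultimately show ?thesis by simp
  qed
  have step: "even (c us) = even (c vs)" if "(us, vs) \<in> coxeter_step W S" for us vs
    using that rel by (auto simp: coxeter_step_def c)
  have chain: "even (c us) = even (c vs)"
    if "(us, vs) \<in> (coxeter_step W S \<union> (coxeter_step W S)\<inverse>)\<^sup>*" for us vs
    using that
  proof induction
    case (step y w)
    then show ?case using \<open>\<And>vs us. (us, vs) \<in> coxeter_step W S \<Longrightarrow> even (c us) = even (c vs)\<close> by blast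
  qed simp
  have "z \<in> word_prod W ` lists S" using st(3) generate_eq_words[of S] generate_S by simp
  then obtain zs where zs: "zs \<in> lists S" "z = word_prod W zs" by blast
  \<comment> \<open>The product of this word is one, and the letters of \<open>zs\<close> occur
    twice, so the parity compares s with t.\<close>
  let ?w = "rev zs @ [s] @ zs @ [t]"
  have "word_prod W ?w = conj_by W s z \<otimes> t"
    using zs st(1,2,3) by (simp add: word_prod_append word_prod_rev conj_by_def m_assoc)
  also have "\<dots> = \<one>" using st S_square by simp
  finally have "even (c ?w)" using chain[OF presentation[of ?w]] zs st by (simp add: c_def)
  moreover have "c (rev zs) = c zs" by (simp add: c_def rev_filter[symmetric])
  ultimately have "even (c zs + (c [s] + (c zs + c [t])))" unfolding c by simp
  moreover have "c zs + (c [s] + (c zs + c [t])) = 2 * c zs + (c [s] + c [t])" by simp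
  ultimately have "even (2 * c zs + (c [s] + c [t]))" by (simp only:)
  then have "even (c [s] + c [t])" by simp
  then show ?thesis using st(5) by (auto simp: c_def split: if_splits)
qed

text \<open>A subset of A is grown from one vertex by adding neighbours. A new vertex has product at
  most -1/2 with the current sum, so the squared norm changes by at most 1 - 1 = 0.\<close>

lemma irreducible_sum_norm:
  assumes A: "A \<subseteq> S" "irreducible_subset W A"
  shows "(\<Sum>a\<in>A. \<alpha> a) \<bullet> (\<Sum>a\<in>A. \<alpha> a) \<le> 1"
proof -
  let ?x = "\<lambda>B. \<Sum>a\<in>B. \<alpha> a"
  have finA: "finite A" using finite_S A finite_subset by blast
  define P where "P B \<longleftrightarrow> B \<subseteq> A \<and> B \<noteq> {} \<and> ?x B \<bullet> ?x B \<le> 1" for B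
  obtain a where "a \<in> A" using A by (auto simp: irreducible_subset_iff)
  then have "P {a}" using A by (auto simp: P_def subset_iff)
  moreover have "\<forall>B. P B \<longrightarrow> card B \<le> card A" using finA by (auto simp: P_def intro: card_mono)
  ultimately obtain B where B: "P B" "\<And>C. P C \<Longrightarrow> card C \<le> card B"
    using ex_has_greatest_nat[of P "{a}" card "Suc (card A)"] by (metis less_Suc_eq_le)
  have "B = A"
  proof (rule ccontr)
    assume "B \<noteq> A"
    then obtain p q where pq: "p \<in> B" "q \<in> A" "q \<notin> B" "coxeter_exponent W p q \<noteq> 2"
      using irreducible_cut[OF A(2), of B] B(1) by (auto simp: P_def)
    have BS: "B \<subseteq> S" and q: "q \<in> S" and p: "p \<in> S" using B(1) pq A by (auto simp: P_def)
    have finB: "finite B" using BS finite_S finite_subset by blast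
    have "?x B \<bullet> \<alpha> q = (\<Sum>b\<in>B. \<alpha> b \<bullet> \<alpha> q)" by (simp add: inner_sum_left)
    also have "\<dots> = \<alpha> p \<bullet> \<alpha> q + (\<Sum>b\<in>B - {p}. \<alpha> b \<bullet> \<alpha> q)" using finB pq(1) by (rule sum.remove)
    also have "\<dots> \<le> - (1/2) + 0"
    proof (rule add_mono)
      show "\<alpha> p \<bullet> \<alpha> q \<le> - (1/2)" using gram_adjacent[OF p q _ pq(4)] pq by blast
      have "\<alpha> b \<bullet> \<alpha> q \<le> 0" if "b \<in> B" for b
      proof -
        have "b \<in> S" "b \<noteq> q" using that BS pq by auto
        then show ?thesis using gram_nonpos q by blast
      qed
      then show "(\<Sum>b\<in>B - {p}. \<alpha> b \<bullet> \<alpha> q) \<le> 0" by (intro sum_nonpos) blast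
    qed
    finally have "?x (insert q B) \<bullet> ?x (insert q B) \<le> 1"
      using B(1) finB pq(3) q by (simp add: P_def inner_add_left inner_add_right inner_commute)
    then have "P (insert q B)" using B(1) pq by (simp add: P_def)
    then show False using B(2)[of "insert q B"] finB pq(3) by simp
  qed
  then show ?thesis using B(1) by (simp add: P_def)
qed

text \<open>The Coxeter graph of a finite group is a forest.\<close>

lemma irreducible_unique_edge:
  assumes A: "A \<subseteq> S" "irreducible_subset W A" and B: "B \<subseteq> S" "irreducible_subset W B"
    and disj: "A \<inter> B = {}"
    and e: "p \<in> A" "q \<in> B" "coxeter_exponent W p q \<noteq> 2"
    and e': "p' \<in> A" "q' \<in> B" "coxeter_exponent W p' q' \<noteq> 2"
  shows "(p, q) = (p', q')"
proof (rule ccontr)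
  assume ne: "(p, q) \<noteq> (p', q')"
  let ?x = "\<lambda>B. \<Sum>a\<in>B. \<alpha> a"
  have fin: "finite A" "finite B" using A B finite_S finite_subset by blast+
  have np: "\<alpha> a \<bullet> \<alpha> b \<le> 0" if "a \<in> A" "b \<in> B" for a b
  proof -
    have "a \<in> S" "b \<in> S" "a \<noteq> b" using that A B disj by auto
    then show ?thesis by (rule gram_nonpos)
  qed
  have adj: "\<alpha> a \<bullet> \<alpha> b \<le> - (1/2)" if "a \<in> A" "b \<in> B" "coxeter_exponent W a b \<noteq> 2" for a b
  proof -
    have "a \<in> S" "b \<in> S" "a \<noteq> b" using that A B disj by auto
    then show ?thesis using that(3) by (rule gram_adjacent)
  qed
  have "?x A \<bullet> ?x B = (\<Sum>(a, b)\<in>A \<times> B. \<alpha> a \<bullet> \<alpha> b)"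
  proof -
    have "?x A \<bullet> ?x B = (\<Sum>a\<in>A. \<Sum>b\<in>B. \<alpha> a \<bullet> \<alpha> b)"
      unfolding inner_sum_left by (simp add: inner_sum_right)
    also have "\<dots> = (\<Sum>(a, b)\<in>A \<times> B. \<alpha> a \<bullet> \<alpha> b)" by (rule sum.cartesian_product)
    finally show ?thesis .
  qed
  also have "\<dots> \<le> (\<Sum>(a, b)\<in>{(p, q), (p', q')}. \<alpha> a \<bullet> \<alpha> b)"
  proof -
    have "(\<Sum>(a, b)\<in>{(p, q), (p', q')}. - (\<alpha> a \<bullet> \<alpha> b)) \<le> (\<Sum>(a, b)\<in>A \<times> B. - (\<alpha> a \<bullet> \<alpha> b))"
      using fin e e' np by (intro sum_mono2) auto
    then show ?thesis by (simp add: case_prod_unfold sum_negf)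
  qed
  also have "\<dots> = \<alpha> p \<bullet> \<alpha> q + \<alpha> p' \<bullet> \<alpha> q'" using ne by simp
  also have "\<dots> \<le> - 1" using adj[OF e] adj[OF e'] by simp
  \<comment> \<open>The bound is 1 + 1 - 2; a vanishing squared norm would be a linear relation
    among simple roots.\<close>
  finally have "(?x A + ?x B) \<bullet> (?x A + ?x B) \<le> 0"
    using irreducible_sum_norm[OF A] irreducible_sum_norm[OF B]
    by (simp add: inner_add_left inner_add_right inner_commute)
  then have "?x A + ?x B = 0" by (metis inner_ge_zero inner_eq_zero_iff order_antisym)
  moreover have "?x A + ?x B = (\<Sum>s\<in>S. (if s \<in> A \<union> B then 1 else 0) *\<^sub>R \<alpha> s)"
  proof -
    have "?x A + ?x B = ?x (A \<union> B)" using fin disj by (rule sum.union_disjoint[symmetric])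
    also have "\<dots> = (\<Sum>s\<in>S. (if s \<in> A \<union> B then 1 else 0) *\<^sub>R \<alpha> s)"
      using A B finite_S by (intro sum.mono_neutral_cong_left) auto
    finally show ?thesis .
  qed
  ultimately have "(if p \<in> A \<union> B then 1 else 0 :: real) = 0"
    using A e by (intro alpha_coefficients_zero) auto
  then show False using e by simp
qed

text \<open>If s' is outside the component A of s for odd edges in J, two disjoint connected sets
  arise: B, around s' in J - A, and G, containing A, reached from s by odd edges outside B.
  Connectedness of J joins A to B by an even edge, conjugacy in W joins G to B by an odd one, and in
  a forest these would have to be the same edge.\<close>

lemma fusion_controlled:
  assumes J: "J \<subseteq> S" "irreducible_subset W J" and s: "s \<in> J" "s' \<in> J"
    and z: "z \<in> carrier W" "s' = conj_by W s z"
  shows "\<exists>u\<in>generate W J. conj_by W s u = s'"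
proof -
  have sS: "s \<in> S" "s' \<in> S" using s J by auto
  define A where "A = (odd_graph J)\<^sup>* `` {s}"
  have conj: "\<exists>u\<in>generate W J. conj_by W s u = x" if "(s, x) \<in> (odd_graph J)\<^sup>*" for x
    using that
  proof induction
    case base
    then show ?case using sS generate.one by (intro bexI[of _ \<one>]) auto
  next
    case (step y x)
    then obtain u v where uv: "u \<in> generate W J" "conj_by W s u = y" "v \<in> generate W J" "conj_by W y v = x"
      using odd_graph_conj[OF J(1) step.hyps(2)] by blast
    then have "conj_by W s (u \<otimes> v) = x" using conj_by_mult[of s u v] sS generate_closed[OF J(1)] by auto
    then show ?case using uv by (blast intro: generate.eng)
  qed
  have "s' \<in> A"
  proof (rule ccontr)
    assume s'A: "s' \<notin> A"
    have AJ: "A \<subseteq> J"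
    proof
      fix x assume "x \<in> A"
      then have "(s, x) \<in> (odd_graph J)\<^sup>*" by (simp add: A_def)
      then show "x \<in> J" by cases (use s in \<open>auto simp: odd_graph_def\<close>)
    qed
    define B where "B = (graph (J - A))\<^sup>* `` {s'}"
    have JAS: "J - A \<subseteq> S" using J by blast
    have B: "irreducible_subset W B" "B \<subseteq> S"
      unfolding B_def using J sS
      by (intro component_irreducible sym_graph[OF JAS]; auto simp: graph_def)+
    have BJ: "B \<subseteq> J - A"
    proof
      fix x assume "x \<in> B"
      then have "(s', x) \<in> (graph (J - A))\<^sup>*" by (simp add: B_def)
      then show "x \<in> J - A" by cases (use s s'A in \<open>auto simp: graph_def\<close>)
    qed
    have s'B: "s' \<in> B" by (simp add: B_def)
    define G where "G = (odd_graph (S - B))\<^sup>* `` {s}"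
    have SB: "S - B \<subseteq> S" by blast
    have G: "irreducible_subset W G" "G \<subseteq> S"
      unfolding G_def using sS by (intro component_irreducible sym_odd_graph[OF SB] odd_graph_subset[OF SB]; simp)+
    have sA: "s \<in> A" by (simp add: A_def)
    then have sB: "s \<notin> B" using BJ by blast
    have GB: "G \<inter> B = {}"
    proof -
      have "x \<notin> B" if "(s, x) \<in> (odd_graph (S - B))\<^sup>*" for x
        using that by cases (use sB in \<open>auto simp: odd_graph_def\<close>)
      then show ?thesis by (auto simp: G_def)
    qed
    have AG: "A \<subseteq> G"
    proof
      fix x assume "x \<in> A"
      then have "(s, x) \<in> (odd_graph J)\<^sup>*" by (simp add: A_def)
      then show "x \<in> G"
      proof induction
        case base
        then show ?case by (simp add: G_def)
      next
        case (step y x)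
        have "y \<in> A" using step.hyps(1) by (simp add: A_def)
        moreover have "x \<in> A" using step.hyps by (auto simp: A_def intro: rtrancl_into_rtrancl)
        ultimately have "(y, x) \<in> odd_graph (S - B)"
          using step.hyps(2) BJ J(1) by (auto simp: odd_graph_def)
        then show ?case using step.IH by (auto simp: G_def intro: rtrancl_into_rtrancl)
      qed
    qed
    \<comment> \<open>Otherwise G would be closed under odd edges in all of S, and conjugation in W
      could not lead from s to s'.\<close>
    have "\<exists>r\<in>G. \<exists>b\<in>B. odd (coxeter_exponent W r b)"
    proof (rule ccontr)
      assume none: "\<not> ?thesis"
      have "s' \<in> G"
      proof (rule conj_simple_odd_closed[OF _ sS z])
        fix p q assume pq: "p \<in> G" "p \<in> S" "q \<in> S" "odd (coxeter_exponent W p q)"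
        show "q \<in> G"
        proof (cases "p = q")
          case False
          have "q \<notin> B" using none pq by blast
          then have "(p, q) \<in> odd_graph (S - B)" using pq False GB by (auto simp: odd_graph_def)
          then show ?thesis using pq(1) by (auto simp: G_def intro: rtrancl_into_rtrancl)
        qed (use pq in simp)
      qed (simp add: G_def)
      then show False using GB s'B by blast
    qed
    then obtain r b where rb: "r \<in> G" "b \<in> B" "odd (coxeter_exponent W r b)" by blast
    obtain q p where qp: "q \<in> B" "p \<in> J - B" "coxeter_exponent W q p \<noteq> 2"
      using irreducible_cut[OF J(2), of B] BJ s'B sB s by blast
    have pS: "p \<in> S" "q \<in> S" using qp J B by auto
    have ex: "coxeter_exponent W p q \<noteq> 2" using qp(3) exponent_commute[OF pS] by simp
    \<comment> \<open>A neighbour of B in J - A would already belong to B.\<close>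
    have pA: "p \<in> A"
    proof (rule ccontr)
      assume "p \<notin> A"
      then have "(q, p) \<in> graph (J - A)" using qp BJ by (auto simp: graph_def)
      then have "p \<in> B" using qp(1) by (auto simp: B_def intro: rtrancl_into_rtrancl)
      then show False using qp by blast
    qed
    have "even (coxeter_exponent W p q)"
    proof (rule ccontr)
      assume "\<not> even (coxeter_exponent W p q)"
      then have "(p, q) \<in> odd_graph J" using qp BJ by (auto simp: odd_graph_def)
      then have "q \<in> A" using pA by (auto simp: A_def intro: rtrancl_into_rtrancl)
      then show False using qp BJ by blast
    qed
    moreover have "(p, q) = (r, b)"
    proof (rule irreducible_unique_edge[OF G(2,1) B(2,1) GB])
      show "p \<in> G" using pA AG by blast
      show "coxeter_exponent W r b \<noteq> 2" using rb(3) by auto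
    qed (use qp rb ex in auto)
    ultimately show False using rb by simp
  qed
  then show ?thesis using conj by (simp add: A_def)
qed

end

section \<open>Minimal coset representatives\<close>

lemma card_constant_fibres:
  assumes "finite A" "finite B" "f ` A \<subseteq> B" "\<And>b. b \<in> B \<Longrightarrow> card {a \<in> A. f a = b} = n"
  shows "card A = card B * n"
proof -
  have "card A = (\<Sum>b\<in>B. \<Sum>a | a \<in> A \<and> f a = b. 1)"
    using sum.group[OF assms(1-3), of "\<lambda>_. 1 :: nat"] by simp
  also have "\<dots> = (\<Sum>b\<in>B. n)" using assms(4) by (intro sum.cong) auto
  finally show ?thesis by simp
qed

context coxeter_realization begin

text \<open>The root form of being shortest in the coset W_K x; see
  \<open>min_coset_reps_iff\<close>. The inverse appears because W_K multiplies x on the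
  left.\<close>

definition positive_on :: "'g set \<Rightarrow> 'g \<Rightarrow> bool" where
  "positive_on K x \<longleftrightarrow> (\<forall>s\<in>K. nonneg (\<rho> (inv x) (\<alpha> s)))"

lemma rho_nonneg_if_positive_on:
  assumes K: "K \<subseteq> S" and x: "x \<in> carrier W" "positive_on K x" and v: "spanned K v" "nonneg v"
  shows "nonneg (\<rho> (inv x) v)"
proof -
  have "\<rho> (inv x) v = (\<Sum>s\<in>K. (\<omega> s \<bullet> v) *\<^sub>R \<rho> (inv x) (\<alpha> s))"
    using arg_cong[OF spanned_expansion[OF K v(1)], of "\<rho> (inv x)"] x
    by (simp add: rho_sum rho_scale)
  also have "nonneg \<dots>"
    using x(2) v(2) K by (intro nonneg_sum nonneg_scale) (auto simp: positive_on_def nonneg_def[of v])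
  finally show ?thesis .
qed

lemma descent_in_parabolic:
  assumes K: "K \<subseteq> S" and h: "h \<in> generate W K" "h \<noteq> \<one>"
  shows "\<exists>s\<in>K. nonneg (- \<rho> h (\<alpha> s))"
proof -
  have hc: "h \<in> carrier W" using generate_closed[OF K h(1)] .
  obtain ws where ws: "reduced_expression W S h ws" using ex_reduced_expression[OF hc] by blast
  then have "ws \<noteq> []" using h(2) by (auto simp: reduced_expression_def)
  then obtain us s where us: "ws = us @ [s]" by (metis rev_exhaust)
  have "ws \<in> lists K" by (rule reduced_in_parabolic[OF K h(1) ws])
  then have s: "s \<in> K" using us by simp
  then have "len (h \<otimes> s) < len h" using reduced_expression_snocD(2)[of h us s] ws us by simp
  then have "nonneg (- \<rho> h (\<alpha> s))" using len_greater_iff_nonneg[OF hc, of s] s K by auto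
  then show ?thesis using s by blast
qed

text \<open>For h \<noteq> 1 some s \<in> K has \<open>- \<rho> h (\<alpha> s)\<close> nonnegative
  and spanned by K. Since \<open>h \<otimes> x\<close> is positive on K, its inverse sends this to a
  nonnegative vector, namely \<open>- \<rho> (inv x) (\<alpha> s)\<close>, against positivity of
  x.\<close>

lemma positive_on_unique:
  assumes K: "K \<subseteq> S" and x: "x \<in> carrier W" "positive_on K x"
    and h: "h \<in> generate W K" "positive_on K (h \<otimes> x)"
  shows "h = \<one>"
proof (rule ccontr)
  assume "h \<noteq> \<one>"
  then obtain s where s: "s \<in> K" "nonneg (- \<rho> h (\<alpha> s))" using descent_in_parabolic[OF K h(1)] by blast
  have sS: "s \<in> S" using s K by blast
  have hc: "h \<in> carrier W" using generate_closed[OF K h(1)] .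
  have "spanned K (- \<rho> h (\<alpha> s))"
    unfolding spanned_uminus using spanned_rho[OF K h(1)] s sS by simp
  then have "nonneg (\<rho> (inv (h \<otimes> x)) (- \<rho> h (\<alpha> s)))"
    using rho_nonneg_if_positive_on[OF K _ h(2) _ s(2)] hc x by simp
  moreover have "\<rho> (inv (h \<otimes> x)) (- \<rho> h (\<alpha> s)) = - \<rho> (inv x) (\<alpha> s)"
    using hc x by (simp add: inv_mult_group)
  moreover have "nonneg (\<rho> (inv x) (\<alpha> s))" using x(2) s(1) by (simp add: positive_on_def)
  ultimately show False using nonneg_antisym rho_alpha_nonzero[of "inv x" s] x sS by auto
qed

lemma positive_on_if_len_le:
  assumes "K \<subseteq> S" "x \<in> carrier W" "\<And>s. s \<in> K \<Longrightarrow> len x \<le> len (s \<otimes> x)"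
  shows "positive_on K x"
  unfolding positive_on_def
proof
  fix s assume s: "s \<in> K"
  then have sS: "s \<in> S" using assms by blast
  have "len (inv x) \<le> len (inv x \<otimes> s)"
    using assms(3)[OF s] assms(2) sS len_inv[of "s \<otimes> x"] by (simp add: inv_mult_group)
  then show "nonneg (\<rho> (inv x) (\<alpha> s))" using nonneg_if_len_le[of "inv x" s] assms sS by simp
qed

lemma ex_positive_on:
  assumes K: "K \<subseteq> S" and y: "y \<in> carrier W"
  shows "\<exists>h\<in>generate W K. positive_on K (h \<otimes> y) \<and> (\<forall>g\<in>generate W K. len (h \<otimes> y) \<le> len (g \<otimes> y))"
proof -
  have "\<exists>h. h \<in> generate W K \<and> (\<forall>g. g \<in> generate W K \<longrightarrow> len (h \<otimes> y) \<le> len (g \<otimes> y))"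
    using generate.one by (rule ex_has_least_nat)
  then obtain h where h: "h \<in> generate W K" "\<And>g. g \<in> generate W K \<Longrightarrow> len (h \<otimes> y) \<le> len (g \<otimes> y)" by blast
  have hc: "h \<in> carrier W" using generate_closed[OF K h(1)] .
  have "positive_on K (h \<otimes> y)"
  proof (rule positive_on_if_len_le[OF K])
    show "h \<otimes> y \<in> carrier W" using hc y by simp
    fix s assume s: "s \<in> K"
    then have sS: "s \<in> S" using K by blast
    have "len (h \<otimes> y) \<le> len ((s \<otimes> h) \<otimes> y)" by (rule h(2)[OF generate.eng[OF generate.incl[OF s] h(1)]])
    then show "len (h \<otimes> y) \<le> len (s \<otimes> (h \<otimes> y))" using hc y sS by (simp add: m_assoc)
  qed
  then show ?thesis using h by blast
qed

lemma parabolic_decomposition: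
  assumes K: "K \<subseteq> S" and y: "y \<in> carrier W"
  obtains u x where "u \<in> generate W K" "x \<in> carrier W" "positive_on K x" "y = u \<otimes> x"
proof -
  obtain h where h: "h \<in> generate W K" "positive_on K (h \<otimes> y)" using ex_positive_on[OF K y] by blast
  have hc: "h \<in> carrier W" using generate_closed[OF K h(1)] .
  have "y = inv h \<otimes> (h \<otimes> y)" using hc y by (simp add: m_assoc[symmetric])
  then show ?thesis using that[of "inv h" "h \<otimes> y"] generate_inv[OF K h(1)] h(2) hc y by simp
qed

lemma min_coset_reps_iff:
  assumes K: "K \<subseteq> S"
  shows "x \<in> min_coset_reps W S K \<longleftrightarrow> x \<in> carrier W \<and> positive_on K x"
proof
  assume x: "x \<in> min_coset_reps W S K"
  then have xc: "x \<in> carrier W" by (simp add: min_coset_reps_def)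
  have "len x \<le> len (s \<otimes> x)" if s: "s \<in> K" for s
    using x generate.incl[OF s] by (auto simp: min_coset_reps_def r_coset_def)
  then show "x \<in> carrier W \<and> positive_on K x" using xc positive_on_if_len_le[OF K xc] by blast
next
  assume x: "x \<in> carrier W \<and> positive_on K x"
  then obtain h where h: "h \<in> generate W K" "positive_on K (h \<otimes> x)"
    "\<And>g. g \<in> generate W K \<Longrightarrow> len (h \<otimes> x) \<le> len (g \<otimes> x)"
    using ex_positive_on[OF K, of x] by blast
  have "h = \<one>" using positive_on_unique[OF K _ _ h(1,2)] x by blast
  then have "len x \<le> len (g \<otimes> x)" if "g \<in> generate W K" for g using h(3)[OF that] x by simp
  then show "x \<in> min_coset_reps W S K" using x by (auto simp: min_coset_reps_def r_coset_def)
qed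

section \<open>Conjugate parabolic subgroups\<close>

lemma spanned_iff_orthogonal_flat:
  assumes K: "K \<subseteq> S"
  shows "spanned K v \<longleftrightarrow> (\<forall>z\<in>flat K. z \<bullet> v = 0)"
proof
  assume "spanned K v"
  then show "\<forall>z\<in>flat K. z \<bullet> v = 0"
    using spanned_inner[OF K] by (auto simp: flat_def)
next
  assume orth: "\<forall>z\<in>flat K. z \<bullet> v = 0"
  have "\<omega> s \<in> flat K" if "s \<in> S - K" for s
    using that K by (auto simp: flat_def omega_alpha subset_iff)
  then show "spanned K v" using orth by (simp add: spanned_def)
qed

lemma spanned_rho_inv_iff:
  assumes K: "K \<subseteq> S" "J \<subseteq> S" and x: "x \<in> carrier W" and flat: "\<rho> x ` flat K = flat J"
  shows "spanned K (\<rho> (inv x) v) \<longleftrightarrow> spanned J v"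
proof -
  have "z \<bullet> \<rho> (inv x) v = \<rho> x z \<bullet> v" for z using rho_inner_left[of "inv x" z v] x by simp
  then have "spanned K (\<rho> (inv x) v) \<longleftrightarrow> (\<forall>z\<in>\<rho> x ` flat K. z \<bullet> v = 0)"
    unfolding spanned_iff_orthogonal_flat[OF K(1)] by simp
  then show ?thesis unfolding flat spanned_iff_orthogonal_flat[OF K(2)] .
qed

text \<open>A simple root spans an extreme ray of the cone of nonnegative vectors: a term with
  nonzero coefficient can have no coordinate besides s, and the only nonnegative root of that kind
  is \<alpha> s.\<close>

lemma simple_root_indecomposable:
  assumes s: "s \<in> S" and K: "finite K" "\<And>k. k \<in> K \<Longrightarrow> 0 \<le> c k" "\<And>k. k \<in> K \<Longrightarrow> \<beta> k \<in> roots"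
    "\<And>k. k \<in> K \<Longrightarrow> nonneg (\<beta> k)" and eq: "\<alpha> s = (\<Sum>k\<in>K. c k *\<^sub>R \<beta> k)"
  shows "\<exists>k\<in>K. \<beta> k = \<alpha> s"
proof -
  have "\<exists>k\<in>K. c k \<noteq> 0"
  proof (rule ccontr)
    assume "\<not> ?thesis"
    then have "\<alpha> s = 0" unfolding eq by (intro sum.neutral) auto
    then show False using s by simp
  qed
  then obtain k where k: "k \<in> K" "c k \<noteq> 0" by blast
  have zero: "\<omega> r \<bullet> \<beta> k = 0" if r: "r \<in> S" "r \<noteq> s" for r
  proof -
    have "(\<Sum>k\<in>K. c k * (\<omega> r \<bullet> \<beta> k)) = \<omega> r \<bullet> \<alpha> s" unfolding eq by (simp add: inner_sum_right)
    also have "\<dots> = 0" using r s omega_alpha[OF s, of r] by simp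
    finally have "\<forall>k\<in>K. c k * (\<omega> r \<bullet> \<beta> k) = 0"
      using K(1,2,4) r(1) by (subst (asm) sum_nonneg_eq_0_iff) (auto simp: nonneg_def)
    then show ?thesis using k by auto
  qed
  have "\<beta> k = (\<omega> s \<bullet> \<beta> k) *\<^sub>R \<alpha> s"
    using zero s by (intro coefficients_eqI) (auto simp: omega_alpha)
  then have "\<beta> k = \<alpha> s \<or> \<beta> k = - \<alpha> s"
    using root_proportional[OF K(3)[OF k(1)] alpha_root[OF s]] by blast
  then have "\<beta> k = \<alpha> s" using K(4)[OF k(1)] nonneg_antisym[of "\<alpha> s"] s by auto
  then show ?thesis using k(1) by blast
qed

text \<open>Equality of the flats matches the spans of the two sets of simple roots, and minimality
  of x preserves positivity in both directions. Simple roots are the indecomposable positive roots,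
  hence correspond.\<close>

lemma simple_roots_transport:
  assumes J: "J \<subseteq> S" and K: "K \<subseteq> S" and x: "x \<in> carrier W" "positive_on J x"
    and flat: "\<rho> x ` flat K = flat J"
  shows "\<rho> (inv x) ` \<alpha> ` J = \<alpha> ` K"
proof -
  have fin: "finite J" "finite K" using J K finite_S finite_subset by blast+
  note sp = spanned_rho_inv_iff[OF K J x(1) flat]
  have nn: "nonneg (\<rho> (inv x) (\<alpha> s))" if "s \<in> J" for s using x(2) that by (simp add: positive_on_def)
  have spJ: "spanned J (\<rho> x (\<alpha> k))" if k: "k \<in> K" for k
    using sp[of "\<rho> x (\<alpha> k)"] k K x by auto
  have nnK: "nonneg (\<rho> x (\<alpha> k))" if k: "k \<in> K" for k
  proof (rule ccontr)
    have kS: "k \<in> S" using k K by blast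
    assume "\<not> nonneg (\<rho> x (\<alpha> k))"
    then have "nonneg (- \<rho> x (\<alpha> k))" using root_nonneg_cases[of "\<rho> x (\<alpha> k)"] x kS by simp
    moreover have "spanned J (- \<rho> x (\<alpha> k))" unfolding spanned_uminus by (rule spJ[OF k])
    ultimately have "nonneg (\<rho> (inv x) (- \<rho> x (\<alpha> k)))" using rho_nonneg_if_positive_on[OF J x] by blast
    then show False using x kS nonneg_antisym[of "\<alpha> k"] by simp
  qed
  show ?thesis
  proof
    show "\<rho> (inv x) ` \<alpha> ` J \<subseteq> \<alpha> ` K"
    proof clarify
      fix s assume s: "s \<in> J"
      then have sS: "s \<in> S" using J by blast
      let ?v = "\<rho> (inv x) (\<alpha> s)"
      have "spanned K ?v" using sp s sS by simp
      then have "\<rho> x ?v = (\<Sum>k\<in>K. (\<omega> k \<bullet> ?v) *\<^sub>R \<rho> x (\<alpha> k))"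
        using arg_cong[OF spanned_expansion[OF K, of ?v], of "\<rho> x"] x by (simp add: rho_sum rho_scale)
      then have eq: "\<alpha> s = (\<Sum>k\<in>K. (\<omega> k \<bullet> ?v) *\<^sub>R \<rho> x (\<alpha> k))" using x by simp
      have "\<exists>k\<in>K. \<rho> x (\<alpha> k) = \<alpha> s"
      proof (rule simple_root_indecomposable[OF sS fin(2) _ _ nnK eq])
        show "0 \<le> \<omega> k \<bullet> ?v" if "k \<in> K" for k using nn[OF s] that K by (auto simp: nonneg_def)
        show "\<rho> x (\<alpha> k) \<in> roots" if "k \<in> K" for k using that K x by auto
      qed
      then obtain k where k: "k \<in> K" "\<rho> x (\<alpha> k) = \<alpha> s" by blast
      then have "?v = \<alpha> k" using x by (metis rho_inv_cancel(1))
      then show "?v \<in> \<alpha> ` K" using k by blast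
    qed
    show "\<alpha> ` K \<subseteq> \<rho> (inv x) ` \<alpha> ` J"
    proof clarify
      fix k assume k: "k \<in> K"
      then have kS: "k \<in> S" using K by blast
      let ?v = "\<rho> x (\<alpha> k)"
      have "\<rho> (inv x) ?v = (\<Sum>s\<in>J. (\<omega> s \<bullet> ?v) *\<^sub>R \<rho> (inv x) (\<alpha> s))"
        using arg_cong[OF spanned_expansion[OF J spJ[OF k]], of "\<rho> (inv x)"] x by (simp add: rho_sum rho_scale)
      then have eq: "\<alpha> k = (\<Sum>s\<in>J. (\<omega> s \<bullet> ?v) *\<^sub>R \<rho> (inv x) (\<alpha> s))" using x by simp
      have "\<exists>s\<in>J. \<rho> (inv x) (\<alpha> s) = \<alpha> k"
      proof (rule simple_root_indecomposable[OF kS fin(1) _ _ nn eq])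
        show "0 \<le> \<omega> s \<bullet> ?v" if "s \<in> J" for s using nnK[OF k] that J by (auto simp: nonneg_def)
        show "\<rho> (inv x) (\<alpha> s) \<in> roots" if "s \<in> J" for s using that J x by auto
      qed
      then show "\<alpha> k \<in> \<rho> (inv x) ` \<alpha> ` J" by force
    qed
  qed
qed

section \<open>Conjugating subsets of S into S\<close>

lemma conj_by_simple:
  assumes "s \<in> S" "k \<in> S" "x \<in> carrier W" "\<rho> (inv x) (\<alpha> s) = \<alpha> k"
  shows "conj_by W s x = k"
proof -
  have T: "conj_by W s x \<in> T" "k \<in> T" using assms S_subset_T by simp_all
  have "root_of (conj_by W s x) = \<alpha> k \<or> root_of (conj_by W s x) = - \<alpha> k"
    using root_of_conj_by[OF S_subset_T[OF assms(1)] assms(3)] assms by simp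
  then have "root_of (conj_by W s x) = \<alpha> k"
    using root_of_nonneg[OF T(1)] nonneg_antisym[of "\<alpha> k"] assms by auto
  then show ?thesis using root_of_inj[OF T] assms by simp
qed

lemma rho_inv_alpha_cases:
  assumes "s \<in> S" "k \<in> S" "x \<in> carrier W" "conj_by W s x = k"
  shows "\<rho> (inv x) (\<alpha> s) = \<alpha> k \<or> \<rho> (inv x) (\<alpha> s) = - \<alpha> k"
  using root_of_conj_by[OF S_subset_T[OF assms(1)] assms(3)] assms by auto

lemma rho_inv_alpha_eq:
  assumes "s \<in> S" "k \<in> S" "x \<in> carrier W" "conj_by W s x = k" "nonneg (\<rho> (inv x) (\<alpha> s))"
  shows "\<rho> (inv x) (\<alpha> s) = \<alpha> k"
  using rho_inv_alpha_cases[OF assms(1-4)] assms nonneg_antisym[of "\<alpha> k"] by auto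

lemma conj_set_simple:
  assumes J: "J \<subseteq> S" and K: "K \<subseteq> S" and x: "x \<in> carrier W" "\<rho> (inv x) ` \<alpha> ` J = \<alpha> ` K"
  shows "conj_set W J x = K"
proof
  show "conj_set W J x \<subseteq> K"
  proof
    fix y assume "y \<in> conj_set W J x"
    then obtain s where s: "s \<in> J" "y = conj_by W s x" by (auto simp: conj_set_def)
    have "\<rho> (inv x) (\<alpha> s) \<in> \<alpha> ` K" using s x(2) by blast
    then obtain k where k: "k \<in> K" "\<rho> (inv x) (\<alpha> s) = \<alpha> k" by blast
    then have "conj_by W s x = k" using conj_by_simple[of s k x] s J K x by auto
    then show "y \<in> K" using k s by simp
  qed
  show "K \<subseteq> conj_set W J x"
  proof
    fix k assume k: "k \<in> K"
    then have "\<alpha> k \<in> \<rho> (inv x) ` \<alpha> ` J" using x(2) by blast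
    then obtain s where s: "s \<in> J" "\<rho> (inv x) (\<alpha> s) = \<alpha> k" by auto
    then have "conj_by W s x = k" using conj_by_simple[of s k x] k J K x by auto
    then show "k \<in> conj_set W J x" using s by (auto simp: conj_set_def)
  qed
qed

lemma flat_transport:
  assumes J: "J \<subseteq> S" and K: "K \<subseteq> S" and x: "x \<in> carrier W" "conj_set W J x = K"
  shows "\<rho> x ` flat K = flat J"
proof -
  have "v \<in> flat K \<longleftrightarrow> \<rho> x v \<in> flat J" for v
  proof -
    have "v \<in> flat K \<longleftrightarrow> (\<forall>k\<in>conj_set W J x. v \<in> hyperplane \<rho> k)"
      unfolding x(2) using K hyperplane_iff[OF S_subset_T] by (auto simp: flat_def inner_commute subset_iff)
    also have "\<dots> \<longleftrightarrow> (\<forall>s\<in>J. v \<in> hyperplane \<rho> (conj_by W s x))" by (simp add: conj_set_def)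
    also have "\<dots> \<longleftrightarrow> \<rho> x v \<in> flat J"
      using J x hyperplane_S_conj_by_iff by (auto simp: flat_def subset_iff)
    finally show ?thesis .
  qed
  note * = this
  show ?thesis
  proof
    show "\<rho> x ` flat K \<subseteq> flat J" using * by blast
    show "flat J \<subseteq> \<rho> x ` flat K"
    proof
      fix v assume "v \<in> flat J"
      then have "\<rho> (inv x) v \<in> flat K" using * x by simp
      moreover have "v = \<rho> x (\<rho> (inv x) v)" using x by simp
      ultimately show "v \<in> \<rho> x ` flat K" by (rule image_eqI[rotated])
    qed
  qed
qed

lemma rho_image_flat:
  assumes "J \<subseteq> S" "u \<in> generate W J"
  shows "\<rho> u ` flat J = flat J"
proof -
  have "\<rho> u v = v" if "v \<in> flat J" for v
    using that by (intro rho_fixes_if_orthogonal[OF assms]) (auto simp: flat_def)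
  then show ?thesis by simp
qed

lemma rho_image_mult: "x \<in> carrier W \<Longrightarrow> y \<in> carrier W \<Longrightarrow> \<rho> (x \<otimes> y) ` A = \<rho> x ` \<rho> y ` A"
  by (simp add: image_image)

lemma rho_image_inv_iff:
  "x \<in> carrier W \<Longrightarrow> \<rho> (inv x) ` A = B \<longleftrightarrow> A = \<rho> x ` B"
  by (auto simp: image_image)

text \<open>Demanding that roots, and not only reflections, become simple also fixes their signs;
  such x are therefore minimal in W_J x.\<close>

definition simple_translates :: "'g set \<Rightarrow> 'g set" where
  "simple_translates J = {x \<in> carrier W. \<rho> (inv x) ` \<alpha> ` J \<subseteq> \<alpha> ` S}"

lemma simple_translatesE:
  assumes "x \<in> simple_translates J"
  obtains K where "K \<subseteq> S" "\<rho> (inv x) ` \<alpha> ` J = \<alpha> ` K"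
  using assms by (auto simp: simple_translates_def subset_image_iff)

lemma simple_translates_positive:
  assumes "x \<in> simple_translates J"
  shows "positive_on J x"
  unfolding positive_on_def
proof
  fix s assume "s \<in> J"
  then have "\<rho> (inv x) (\<alpha> s) \<in> \<alpha> ` S" using assms unfolding simple_translates_def by blast
  then show "nonneg (\<rho> (inv x) (\<alpha> s))" by auto
qed

text \<open>Minimality fixes the signs, so that normalizing J becomes permuting its simple roots. In
  this form the set is visibly a group.\<close>

lemma X_set_eq:
  assumes J: "J \<subseteq> S"
  shows "X_set W S S J = {x \<in> carrier W. \<rho> (inv x) ` \<alpha> ` J = \<alpha> ` J}"
proof
  show "X_set W S S J \<subseteq> {x \<in> carrier W. \<rho> (inv x) ` \<alpha> ` J = \<alpha> ` J}"
  proof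
    fix x assume "x \<in> X_set W S S J"
    then have x: "x \<in> carrier W" "positive_on J x" "conj_set W J x = J"
      using min_coset_reps_iff[OF J] by (auto simp: X_set_def)
    have "\<rho> (inv x) ` \<alpha> ` J = \<alpha> ` J"
      using simple_roots_transport[OF J J x(1,2) flat_transport[OF J J x(1,3)]] .
    then show "x \<in> {x \<in> carrier W. \<rho> (inv x) ` \<alpha> ` J = \<alpha> ` J}" using x by simp
  qed
  show "{x \<in> carrier W. \<rho> (inv x) ` \<alpha> ` J = \<alpha> ` J} \<subseteq> X_set W S S J"
  proof
    fix x assume "x \<in> {x \<in> carrier W. \<rho> (inv x) ` \<alpha> ` J = \<alpha> ` J}"
    then have x: "x \<in> carrier W" "\<rho> (inv x) ` \<alpha> ` J = \<alpha> ` J" by auto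
    then have x': "\<rho> (inv (inv x)) ` \<alpha> ` J = \<alpha> ` J" using rho_image_inv_iff[of x "\<alpha> ` J" "\<alpha> ` J"] by simp
    have pos: "positive_on J y" if "\<rho> (inv y) ` \<alpha> ` J = \<alpha> ` J" for y
      unfolding positive_on_def
    proof
      fix s assume "s \<in> J"
      then have "\<rho> (inv y) (\<alpha> s) \<in> \<alpha> ` J" using that by blast
      then show "nonneg (\<rho> (inv y) (\<alpha> s))" using J by auto
    qed
    have "x \<in> min_coset_reps W S J" "inv x \<in> min_coset_reps W S J"
      using min_coset_reps_iff[OF J] pos[OF x(2)] pos[OF x'] x(1) by simp_all
    moreover from this(2) have "x \<in> m_inv W ` min_coset_reps W S J"
      using x(1) by (intro image_eqI[of _ _ "inv x"]) simp_all
    moreover have "conj_set W J x = J" by (rule conj_set_simple[OF J J x])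
    ultimately show "x \<in> X_set W S S J" using x(1) generate_S by (simp add: X_set_def)
  qed
qed

text \<open>Over each K in [J] the map taking x to the conjugate of J by x has a coset of X(S, J) as
  its fibre.\<close>

lemma card_simple_translates:
  assumes J: "J \<subseteq> S"
  shows "card (simple_translates J) = card (conj_subsets W S J) * card (X_set W S S J)"
proof (rule card_constant_fibres[where f = "\<lambda>x. conj_set W J x"])
  show "finite (simple_translates J)" using finite_W by (simp add: simple_translates_def)
  show "finite (conj_subsets W S J)"
    by (rule finite_subset[of _ "Pow S"]) (auto simp: conj_subsets_def finite_S)
  show "(\<lambda>x. conj_set W J x) ` simple_translates J \<subseteq> conj_subsets W S J"
  proof clarify
    fix x assume x: "x \<in> simple_translates J"
    then have xc: "x \<in> carrier W" by (simp add: simple_translates_def)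
    obtain K where K: "K \<subseteq> S" "\<rho> (inv x) ` \<alpha> ` J = \<alpha> ` K" using x by (rule simple_translatesE)
    then have "conj_set W J x = K" using conj_set_simple[OF J K(1) xc] by blast
    then show "conj_set W J x \<in> conj_subsets W S J" using K(1) xc by (auto simp: conj_subsets_def)
  qed
  fix K assume "K \<in> conj_subsets W S J"
  then obtain y where y: "y \<in> carrier W" "conj_set W J y = K" and K: "K \<subseteq> S"
    by (auto simp: conj_subsets_def)
  let ?F = "{x \<in> simple_translates J. conj_set W J x = K}"
  have F: "?F = {x \<in> carrier W. \<rho> (inv x) ` \<alpha> ` J = \<alpha> ` K}"
  proof
    show "?F \<subseteq> {x \<in> carrier W. \<rho> (inv x) ` \<alpha> ` J = \<alpha> ` K}"
    proof
      fix x assume x: "x \<in> ?F"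
      then have xc: "x \<in> carrier W" "x \<in> simple_translates J" "conj_set W J x = K"
        by (auto simp: simple_translates_def)
      obtain L where L: "L \<subseteq> S" "\<rho> (inv x) ` \<alpha> ` J = \<alpha> ` L" using xc(2) by (rule simple_translatesE)
      then have "L = K" using conj_set_simple[OF J L(1) xc(1)] xc(3) by simp
      then show "x \<in> {x \<in> carrier W. \<rho> (inv x) ` \<alpha> ` J = \<alpha> ` K}" using L xc by simp
    qed
    show "{x \<in> carrier W. \<rho> (inv x) ` \<alpha> ` J = \<alpha> ` K} \<subseteq> ?F"
    proof
      fix x assume "x \<in> {x \<in> carrier W. \<rho> (inv x) ` \<alpha> ` J = \<alpha> ` K}"
      then have x: "x \<in> carrier W" "\<rho> (inv x) ` \<alpha> ` J = \<alpha> ` K" by auto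
      have "\<alpha> ` K \<subseteq> \<alpha> ` S" using K by (rule image_mono)
      then show "x \<in> ?F" using x conj_set_simple[OF J K x] by (simp add: simple_translates_def)
    qed
  qed
  \<comment> \<open>An arbitrary y conjugating J to K may send simple roots to negative ones;
    removing its W_J-part leaves an x whose inverse maps the simple roots of J onto those of
    K.\<close>
  obtain u x where ux: "u \<in> generate W J" "x \<in> carrier W" "positive_on J x" "y = u \<otimes> x"
    using J y(1) by (rule parabolic_decomposition)
  have uc: "u \<in> carrier W" using generate_closed[OF J ux(1)] .
  have "\<rho> u ` \<rho> x ` flat K = flat J"
    using flat_transport[OF J K y] rho_image_mult[OF uc ux(2)] ux(4) by simp
  then have "\<rho> x ` flat K = \<rho> (inv u) ` flat J" using rho_image_inv_iff[OF uc] by metis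
  then have "\<rho> x ` flat K = flat J" using rho_image_flat[OF J generate_inv[OF J ux(1)]] by simp
  then have xK: "\<rho> (inv x) ` \<alpha> ` J = \<alpha> ` K" by (rule simple_roots_transport[OF J K ux(2,3)])
  then have Kx: "\<rho> x ` \<alpha> ` K = \<alpha> ` J" using rho_image_inv_iff[OF ux(2)] by metis
  have "bij_betw (\<lambda>z. z \<otimes> x) (X_set W S S J) ?F"
    unfolding F X_set_eq[OF J]
  proof (rule bij_betwI[of _ _ _ "\<lambda>z. z \<otimes> inv x"])
    show "(\<lambda>z. z \<otimes> x) \<in> {x \<in> carrier W. \<rho> (inv x) ` \<alpha> ` J = \<alpha> ` J} \<rightarrow> {x \<in> carrier W. \<rho> (inv x) ` \<alpha> ` J = \<alpha> ` K}"
    proof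
      fix z assume "z \<in> {x \<in> carrier W. \<rho> (inv x) ` \<alpha> ` J = \<alpha> ` J}"
      then have z: "z \<in> carrier W" "\<rho> (inv z) ` \<alpha> ` J = \<alpha> ` J" by auto
      have "\<rho> (inv (z \<otimes> x)) ` \<alpha> ` J = \<rho> (inv x) ` \<rho> (inv z) ` \<alpha> ` J"
        using z(1) ux(2) by (simp add: inv_mult_group rho_image_mult del: rho_mult)
      then show "z \<otimes> x \<in> {x \<in> carrier W. \<rho> (inv x) ` \<alpha> ` J = \<alpha> ` K}" using z ux(2) xK by simp
    qed
    show "(\<lambda>z. z \<otimes> inv x) \<in> {x \<in> carrier W. \<rho> (inv x) ` \<alpha> ` J = \<alpha> ` K} \<rightarrow> {x \<in> carrier W. \<rho> (inv x) ` \<alpha> ` J = \<alpha> ` J}"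
    proof
      fix z assume "z \<in> {x \<in> carrier W. \<rho> (inv x) ` \<alpha> ` J = \<alpha> ` K}"
      then have z: "z \<in> carrier W" "\<rho> (inv z) ` \<alpha> ` J = \<alpha> ` K" by auto
      have "\<rho> (inv (z \<otimes> inv x)) ` \<alpha> ` J = \<rho> x ` \<rho> (inv z) ` \<alpha> ` J"
        using z(1) ux(2) by (simp add: inv_mult_group rho_image_mult del: rho_mult)
      then show "z \<otimes> inv x \<in> {x \<in> carrier W. \<rho> (inv x) ` \<alpha> ` J = \<alpha> ` J}" using z ux(2) Kx by simp
    qed
  qed (use ux(2) in \<open>auto simp: m_assoc\<close>)
  then show "card ?F = card (X_set W S S J)" by (rule bij_betw_same_card[symmetric])
qed

text \<open>On the span of the simple roots in J, \<open>inv x\<close> merely renames simple roots,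
  so the coefficients of the root of t are carried along unchanged.\<close>

lemma support_conj_by_simple_translate:
  assumes J: "J \<subseteq> S" and t: "t \<in> T" "t \<in> generate W J" and x: "x \<in> simple_translates J"
  shows "support W S (conj_by W t x) = conj_set W (support W S t) x"
proof -
  have xc: "x \<in> carrier W" using x by (simp add: simple_translates_def)
  let ?\<beta> = "root_of t"
  have sp: "spanned J ?\<beta>" using reflection_in_parabolic_iff[OF J t(1)] t(2) by blast
  have finJ: "finite J" using J finite_S finite_subset by blast
  have image: "conj_by W s x \<in> S \<and> \<rho> (inv x) (\<alpha> s) = \<alpha> (conj_by W s x)" if s: "s \<in> J" for s
  proof -
    have "\<rho> (inv x) (\<alpha> s) \<in> \<alpha> ` S" using x s by (auto simp: simple_translates_def)
    then obtain k where k: "k \<in> S" "\<rho> (inv x) (\<alpha> s) = \<alpha> k" by blast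
    then have "conj_by W s x = k" using conj_by_simple[of s k x] s J xc by auto
    then show ?thesis using k by simp
  qed
  have expand: "\<rho> (inv x) ?\<beta> = (\<Sum>s\<in>J. (\<omega> s \<bullet> ?\<beta>) *\<^sub>R \<alpha> (conj_by W s x))"
    using arg_cong[OF spanned_expansion[OF J sp], of "\<rho> (inv x)"] xc image
    by (simp add: rho_sum rho_scale)
  have coeff: "\<omega> k \<bullet> \<rho> (inv x) ?\<beta> = (\<Sum>s\<in>J. if conj_by W s x = k then \<omega> s \<bullet> ?\<beta> else 0)" for k
    unfolding expand inner_sum_right inner_scaleR_right
    by (rule sum.cong) (use image omega_alpha in auto)
  have inj: "conj_by W r x = conj_by W s x \<longleftrightarrow> r = s" if "r \<in> J" "s \<in> J" for r s
    using that J xc by (simp add: subset_iff)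
  have hit: "\<omega> (conj_by W s x) \<bullet> \<rho> (inv x) ?\<beta> = \<omega> s \<bullet> ?\<beta>" if s: "s \<in> J" for s
  proof -
    have "(\<Sum>r\<in>J. if conj_by W r x = conj_by W s x then \<omega> r \<bullet> ?\<beta> else 0) = (\<Sum>r\<in>J. if r = s then \<omega> r \<bullet> ?\<beta> else 0)"
      using inj s by (intro sum.cong) auto
    then show ?thesis unfolding coeff using finJ s by simp
  qed
  have supp: "support W S t = {s \<in> J. \<omega> s \<bullet> ?\<beta> \<noteq> 0}"
    unfolding support_reflection[OF t(1)] using sp J by (auto simp: spanned_def)
  show ?thesis
    unfolding support_conj_by[OF t(1) xc] supp conj_set_def
  proof
    show "{k \<in> S. \<omega> k \<bullet> \<rho> (inv x) ?\<beta> \<noteq> 0} \<subseteq> (\<lambda>a. conj_by W a x) ` {s \<in> J. \<omega> s \<bullet> ?\<beta> \<noteq> 0}"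
    proof
      fix k assume k: "k \<in> {k \<in> S. \<omega> k \<bullet> \<rho> (inv x) ?\<beta> \<noteq> 0}"
      then have "\<exists>s\<in>J. (if conj_by W s x = k then \<omega> s \<bullet> ?\<beta> else 0) \<noteq> 0"
        unfolding coeff using sum.neutral[of J "\<lambda>s. if conj_by W s x = k then \<omega> s \<bullet> ?\<beta> else 0"] by blast
      then show "k \<in> (\<lambda>a. conj_by W a x) ` {s \<in> J. \<omega> s \<bullet> ?\<beta> \<noteq> 0}" by (auto split: if_splits)
    qed
    show "(\<lambda>a. conj_by W a x) ` {s \<in> J. \<omega> s \<bullet> ?\<beta> \<noteq> 0} \<subseteq> {k \<in> S. \<omega> k \<bullet> \<rho> (inv x) ?\<beta> \<noteq> 0}"
      using image hit by auto
  qed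
qed

section \<open>Counting\<close>

lemma parabolic_if_subset_hyperplane:
  assumes J: "J \<subseteq> S" and t: "t \<in> T" and w: "w \<in> carrier W"
    and sub: "\<rho> (inv w) ` flat J \<subseteq> hyperplane \<rho> t"
  shows "conj_by W t (inv w) \<in> generate W J"
proof -
  have "flat J \<subseteq> hyperplane \<rho> (conj_by W t (inv w))"
    using sub t w by (auto simp: hyperplane_conj_by_iff)
  then show ?thesis using flat_subset_hyperplane_iff[OF J conj_by_T[OF t]] w by simp
qed

text \<open>In y = \<open>inv w\<close> u x, equality of the edges forces x to be a simple
  translate. Conjugation by x then only renames the support, so the remaining condition concerns u
  alone and the count is a product.\<close>

lemma card_edge_chambers:
  assumes J: "J \<subseteq> S" and t: "t \<in> T" and w: "w \<in> carrier W"
    and sub: "\<rho> (inv w) ` flat J \<subseteq> hyperplane \<rho> t"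
  shows "card {y \<in> carrier W. \<rho> y ` flat (support W S (conj_by W t y)) = \<rho> (inv w) ` flat J} =
    full_support_count J (conj_by W t (inv w)) * card (simple_translates J)"
proof -
  let ?t = "conj_by W t (inv w)"
  let ?Q = "{y \<in> carrier W. \<rho> y ` flat (support W S (conj_by W t y)) = \<rho> (inv w) ` flat J}"
  let ?U = "{u \<in> generate W J. support W S (conj_by W ?t u) = J}"
  have tJ: "?t \<in> generate W J" by (rule parabolic_if_subset_hyperplane[OF J t w sub])
  have tT: "?t \<in> T" using t w by simp
  have Gc: "u \<in> carrier W" if "u \<in> generate W J" for u using generate_closed[OF J that] .
  have conj: "conj_by W t (inv w \<otimes> u \<otimes> x) = conj_by W (conj_by W ?t u) x"
    if "u \<in> carrier W" "x \<in> carrier W" for u x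
    using that t w by (simp add: conj_by_mult m_assoc)
  have "bij_betw (\<lambda>(u, x). inv w \<otimes> u \<otimes> x) (?U \<times> simple_translates J) ?Q"
    unfolding bij_betw_def
  proof
    show "inj_on (\<lambda>(u, x). inv w \<otimes> u \<otimes> x) (?U \<times> simple_translates J)"
    proof (rule inj_onI)
      fix p q assume p: "p \<in> ?U \<times> simple_translates J" and q: "q \<in> ?U \<times> simple_translates J"
        and eq: "(\<lambda>(u, x). inv w \<otimes> u \<otimes> x) p = (\<lambda>(u, x). inv w \<otimes> u \<otimes> x) q"
      obtain u x where u: "p = (u, x)" "u \<in> generate W J" "x \<in> simple_translates J" using p by auto
      obtain v y where v: "q = (v, y)" "v \<in> generate W J" "y \<in> simple_translates J" using q by auto
      have c: "u \<in> carrier W" "v \<in> carrier W" "x \<in> carrier W" "y \<in> carrier W"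
        using u v Gc by (auto simp: simple_translates_def)
      have "u \<otimes> x = v \<otimes> y" using eq u(1) v(1) c w by (simp add: m_assoc)
      then have y: "y = (inv v \<otimes> u) \<otimes> x" using c by (simp add: m_assoc inv_solve_left)
      have "inv v \<otimes> u = \<one>"
      proof (rule positive_on_unique[OF J c(3) simple_translates_positive[OF u(3)]])
        show "inv v \<otimes> u \<in> generate W J" by (rule generate.eng[OF generate_inv[OF J v(2)] u(2)])
        show "positive_on J ((inv v \<otimes> u) \<otimes> x)" using simple_translates_positive[OF v(3)] y by simp
      qed
      then have "u = v" using c by (metis inv_closed inv_equality inv_inv)
      moreover have "x = y" using y c \<open>inv v \<otimes> u = \<one>\<close> by simp
      ultimately show "p = q" using u v by simp
    qed
    show "(\<lambda>(u, x). inv w \<otimes> u \<otimes> x) ` (?U \<times> simple_translates J) = ?Q"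
    proof
      show "(\<lambda>(u, x). inv w \<otimes> u \<otimes> x) ` (?U \<times> simple_translates J) \<subseteq> ?Q"
      proof (rule image_subsetI)
        fix p assume "p \<in> ?U \<times> simple_translates J"
        then obtain u x where p: "p = (u, x)" and u: "u \<in> generate W J" "support W S (conj_by W ?t u) = J"
          and x: "x \<in> simple_translates J" by (cases p) simp
        have c: "u \<in> carrier W" "x \<in> carrier W" using u x Gc by (auto simp: simple_translates_def)
        obtain K where K: "K \<subseteq> S" "\<rho> (inv x) ` \<alpha> ` J = \<alpha> ` K" using x by (rule simple_translatesE)
        have K': "conj_set W J x = K" by (rule conj_set_simple[OF J K(1) c(2) K(2)])
        have "support W S (conj_by W t (inv w \<otimes> u \<otimes> x)) = K"
          unfolding conj[OF c]
          using support_conj_by_simple_translate[OF J _ conj_by_in_generate[OF J tJ u(1)] x] tT c u(2) K' by simp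
        then have "\<rho> (inv w \<otimes> u \<otimes> x) ` flat (support W S (conj_by W t (inv w \<otimes> u \<otimes> x)))
          = \<rho> (inv w) ` \<rho> u ` \<rho> x ` flat K"
          using c w by (simp add: rho_image_mult del: rho_mult)
        also have "\<dots> = \<rho> (inv w) ` flat J"
          unfolding flat_transport[OF J K(1) c(2) K'] rho_image_flat[OF J u(1)] ..
        finally show "(\<lambda>(u, x). inv w \<otimes> u \<otimes> x) p \<in> ?Q"
          using c w unfolding p by simp
      qed
      show "?Q \<subseteq> (\<lambda>(u, x). inv w \<otimes> u \<otimes> x) ` (?U \<times> simple_translates J)"
      proof
        fix y assume "y \<in> ?Q"
        then have y: "y \<in> carrier W" "\<rho> y ` flat (support W S (conj_by W t y)) = \<rho> (inv w) ` flat J" by auto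
        let ?L = "support W S (conj_by W t y)"
        have L: "?L \<subseteq> S" by (rule support_subset)
        have wy: "w \<otimes> y \<in> carrier W" using w y by simp
        obtain u x where ux: "u \<in> generate W J" "x \<in> carrier W" "positive_on J x" "w \<otimes> y = u \<otimes> x"
          using J wy by (rule parabolic_decomposition)
        have uc: "u \<in> carrier W" using Gc ux(1) .
        have y_eq: "y = inv w \<otimes> u \<otimes> x"
          using ux(2,4) uc w y(1) by (metis inv_closed inv_solve_left m_assoc m_closed)
        have "\<rho> u ` \<rho> x ` flat ?L = \<rho> w ` \<rho> y ` flat ?L"
          using ux(2,4) uc w y(1) by (metis rho_image_mult)
        also have "\<dots> = flat J" unfolding y(2) using w by (simp add: image_image)
        finally have "\<rho> x ` flat ?L = \<rho> (inv u) ` flat J" using rho_image_inv_iff[OF uc] by metis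
        then have "\<rho> x ` flat ?L = flat J" using rho_image_flat[OF J generate_inv[OF J ux(1)]] by simp
        then have xL: "\<rho> (inv x) ` \<alpha> ` J = \<alpha> ` ?L" by (rule simple_roots_transport[OF J L ux(2,3)])
        then have x: "x \<in> simple_translates J" using L ux(2) by (auto simp: simple_translates_def)
        have uT: "conj_by W ?t u \<in> T" using tT uc by simp
        have "conj_set W (support W S (conj_by W ?t u)) x = ?L"
          using support_conj_by_simple_translate[OF J uT conj_by_in_generate[OF J tJ ux(1)] x]
            conj[OF uc ux(2)] y_eq by simp
        also have "\<dots> = conj_set W J x" using conj_set_simple[OF J L ux(2) xL] by simp
        finally have "(\<lambda>a. conj_by W a x) ` support W S (conj_by W ?t u) = (\<lambda>a. conj_by W a x) ` J"
          by (simp add: conj_set_def)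
        moreover have "inj_on (\<lambda>a. conj_by W a x) S" using ux(2) by (auto simp: inj_on_def)
        ultimately have "support W S (conj_by W ?t u) = J"
          using inj_on_image_eq_iff[of _ S] support_subset J by metis
        then show "y \<in> (\<lambda>(u, x). inv w \<otimes> u \<otimes> x) ` (?U \<times> simple_translates J)"
          using ux(1) x y_eq by (intro image_eqI[of _ _ "(u, x)"]) auto
      qed
    qed
  qed
  then have "card (?U \<times> simple_translates J) = card ?Q" by (rule bij_betw_same_card)
  then show ?thesis by (simp add: full_support_count_def card_cartesian_product)
qed

text \<open>An element centralizing s sends \<alpha> s to itself or to its negative. The first case
  is X(J, {s}), and left multiplication by s exchanges the two cases.\<close>

lemma card_simple_centralizer:
  assumes J: "J \<subseteq> S" and s: "s \<in> J"
  shows "card {c \<in> generate W J. conj_by W s c = s} = 2 * card (X_set W S J {s})"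
proof -
  let ?C = "{c \<in> generate W J. conj_by W s c = s}"
  have sS: "s \<in> S" "{s} \<subseteq> S" using s J by auto
  define X where "X = {c \<in> ?C. \<rho> (inv c) (\<alpha> s) = \<alpha> s}"
  have Gc: "c \<in> carrier W" if "c \<in> generate W J" for c using generate_closed[OF J that] .
  have finC: "finite ?C" using finite_generate[OF J] by simp
  have "X_set W S J {s} = X"
  proof
    show "X_set W S J {s} \<subseteq> X"
    proof
      fix c assume "c \<in> X_set W S J {s}"
      then have c: "c \<in> generate W J" "c \<in> min_coset_reps W S {s}" "conj_set W {s} c = {s}"
        by (auto simp: X_set_def)
      have cs: "conj_by W s c = s" using c(3) by (simp add: conj_set_def)
      have "nonneg (\<rho> (inv c) (\<alpha> s))"
        using c(2) unfolding min_coset_reps_iff[OF sS(2)] by (simp add: positive_on_def)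
      then have "\<rho> (inv c) (\<alpha> s) = \<alpha> s" using rho_inv_alpha_eq[OF sS(1) sS(1) Gc[OF c(1)] cs] by blast
      then show "c \<in> X" using c(1) cs by (simp add: X_def)
    qed
    show "X \<subseteq> X_set W S J {s}"
    proof
      fix c assume "c \<in> X"
      then have c: "c \<in> generate W J" "conj_by W s c = s" "\<rho> (inv c) (\<alpha> s) = \<alpha> s" by (auto simp: X_def)
      have cc: "c \<in> carrier W" using Gc c(1) .
      have "\<rho> c (\<alpha> s) = \<alpha> s" using c(3) cc by (metis rho_inv_cancel(2))
      then have m: "c \<in> min_coset_reps W S {s}" "inv c \<in> min_coset_reps W S {s}"
        unfolding min_coset_reps_iff[OF sS(2)] using c(3) cc sS(1) by (simp_all add: positive_on_def)
      have "c \<in> m_inv W ` min_coset_reps W S {s}" using m(2) cc by (intro image_eqI[of _ _ "inv c"]) simp_all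
      then show "c \<in> X_set W S J {s}" using m(1) c by (simp add: X_set_def conj_set_def)
    qed
  qed
  moreover have "card (?C - X) = card X"
  proof (rule bij_betw_same_card[of "\<lambda>c. s \<otimes> c"])
    have sc: "s \<otimes> c \<in> ?C \<and> \<rho> (inv (s \<otimes> c)) (\<alpha> s) = - \<rho> (inv c) (\<alpha> s)" if c: "c \<in> ?C" for c
    proof -
      have cc: "c \<in> carrier W" "c \<in> generate W J" "conj_by W s c = s" using c Gc by auto
      have "s \<otimes> c \<in> generate W J" by (rule generate.eng[OF generate.incl[OF s] cc(2)])
      moreover have "conj_by W s (s \<otimes> c) = s"
      proof -
        have "conj_by W s (s \<otimes> c) = conj_by W (conj_by W s s) c" using sS(1) cc(1) by (simp add: conj_by_mult)
        also have "conj_by W s s = s" using sS(1) by (simp add: conj_by_def S_square)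
        finally show ?thesis using cc(3) by simp
      qed
      moreover have "\<rho> (inv (s \<otimes> c)) (\<alpha> s) = - \<rho> (inv c) (\<alpha> s)"
        using sS(1) cc(1) by (simp add: inv_mult_group)
      ultimately show ?thesis by simp
    qed
    have neg: "\<rho> (inv c) (\<alpha> s) = - \<alpha> s" if "c \<in> ?C - X" for c
      using rho_inv_alpha_cases[OF sS(1) sS(1), of c] that Gc by (auto simp: X_def)
    have ne: "- \<alpha> s \<noteq> \<alpha> s" using sS(1) nonneg_antisym[of "\<alpha> s"] nonneg_alpha[of s] by force
    show "bij_betw (\<lambda>c. s \<otimes> c) (?C - X) X"
    proof (rule bij_betwI[of _ _ _ "\<lambda>c. s \<otimes> c"])
      show "(\<lambda>c. s \<otimes> c) \<in> ?C - X \<rightarrow> X"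
      proof
        fix c assume c: "c \<in> ?C - X"
        then show "s \<otimes> c \<in> X" using sc[of c] neg[OF c] by (simp add: X_def)
      qed
      show "(\<lambda>c. s \<otimes> c) \<in> X \<rightarrow> ?C - X"
      proof
        fix c assume c: "c \<in> X"
        then have "c \<in> ?C" "\<rho> (inv c) (\<alpha> s) = \<alpha> s" by (auto simp: X_def)
        then show "s \<otimes> c \<in> ?C - X" using sc[of c] ne by (simp add: X_def)
      qed
      show "s \<otimes> (s \<otimes> c) = c" if "c \<in> ?C - X" for c using that Gc sS(1) by simp
      show "s \<otimes> (s \<otimes> c) = c" if "c \<in> X" for c using that Gc sS(1) by (simp add: X_def)
    qed
  qed
  moreover have "card ?C = card X + card (?C - X)"
  proof -
    have "X \<subseteq> ?C" by (auto simp: X_def)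
    moreover have "finite X" using finite_subset[OF \<open>X \<subseteq> ?C\<close> finC] .
    ultimately show ?thesis using card_Diff_subset[of X ?C] card_mono[OF finC, of X] by linarith
  qed
  ultimately show ?thesis by simp
qed

text \<open>The fibres of the map taking u to \<open>conj_by W s u\<close> are cosets of the
  centralizer of s in W_J. That every element of the class is hit is the delicate part, since the
  class allows conjugation by all of W.\<close>

lemma full_support_count_simple:
  assumes J: "J \<subseteq> S" "irreducible_subset W J" and s: "s \<in> J"
    and v: "v \<in> generate W J" "support W S (conj_by W s v) = J"
  shows "full_support_count J s = card (support_class W S (conj_by W s v)) * (2 * card (X_set W S J {s}))"
  unfolding full_support_count_def
proof (rule card_constant_fibres[where f = "\<lambda>u. conj_by W s u"])
  let ?A = "{u \<in> generate W J. support W S (conj_by W s u) = J}"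
  let ?t = "conj_by W s v"
  have sS: "s \<in> S" using s J by blast
  have Gc: "c \<in> carrier W" if "c \<in> generate W J" for c using generate_closed[OF J(1) that] .
  have vc: "v \<in> carrier W" using Gc v(1) .
  have tT: "?t \<in> T" using S_subset_T[OF sS] vc by simp
  show "finite ?A" using finite_generate[OF J(1)] by simp
  show "finite (support_class W S ?t)" using finite_W by (simp add: support_class_def)
  show "(\<lambda>u. conj_by W s u) ` ?A \<subseteq> support_class W S ?t"
  proof (rule image_subsetI)
    fix u assume "u \<in> ?A"
    then have u: "u \<in> generate W J" "support W S (conj_by W s u) = J" by auto
    have uc: "u \<in> carrier W" using Gc u(1) .
    have "conj_by W s u = conj_by W ?t (inv v \<otimes> u)"
      using sS uc vc by (simp add: conj_by_mult m_assoc[symmetric])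
    then show "conj_by W s u \<in> support_class W S ?t"
      unfolding support_class_def using u v sS uc vc by (auto intro!: bexI[of _ "inv v \<otimes> u"])
  qed
  fix y assume "y \<in> support_class W S ?t"
  then obtain z where z: "y \<in> carrier W" "support W S y = J" "z \<in> carrier W" "y = conj_by W ?t z"
    using v(2) unfolding support_class_def by blast
  have yT: "y \<in> T" using z tT by simp
  have yJ: "y \<in> generate W J" using support_subset_iff[OF J(1) z(1)] z(2) by simp
  \<comment> \<open>Inside W_J the element y is conjugate to a simple s', which is conjugate to s in
    W; \<open>fusion_controlled\<close> brings this second conjugacy into W_J.\<close>
  obtain u1 s' where u1: "u1 \<in> generate W J" "s' \<in> J" "conj_by W y u1 = s'"
    using reflection_conj_simple[OF J(1) yT yJ] by blast
  have u1c: "u1 \<in> carrier W" using Gc u1(1) .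
  have "s' = conj_by W s (v \<otimes> z \<otimes> u1)"
    using u1(3) z sS vc u1c by (simp add: conj_by_mult m_assoc)
  then obtain u2 where u2: "u2 \<in> generate W J" "conj_by W s u2 = s'"
    using fusion_controlled[OF J s u1(2), of "v \<otimes> z \<otimes> u1"] vc z u1c by auto
  have u2c: "u2 \<in> carrier W" using Gc u2(1) .
  define u0 where "u0 = u2 \<otimes> inv u1"
  have u0: "u0 \<in> generate W J" "u0 \<in> carrier W"
    unfolding u0_def using generate.eng[OF u2(1) generate_inv[OF J(1) u1(1)]] u2c u1c by simp_all
  have su0: "conj_by W s u0 = y"
  proof -
    have "conj_by W s u0 = conj_by W (conj_by W y u1) (inv u1)"
      unfolding u0_def u1(3) u2(2)[symmetric] using sS u2c u1c by (simp add: conj_by_mult)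
    then show ?thesis using z(1) u1c by simp
  qed
  have "bij_betw (\<lambda>c. c \<otimes> u0) {c \<in> generate W J. conj_by W s c = s} {u \<in> ?A. conj_by W s u = y}"
  proof (rule bij_betwI[of _ _ _ "\<lambda>u. u \<otimes> inv u0"])
    show "(\<lambda>c. c \<otimes> u0) \<in> {c \<in> generate W J. conj_by W s c = s} \<rightarrow> {u \<in> ?A. conj_by W s u = y}"
    proof
      fix c assume "c \<in> {c \<in> generate W J. conj_by W s c = s}"
      then have c: "c \<in> generate W J" "conj_by W s c = s" "c \<in> carrier W" using Gc by auto
      have "conj_by W s (c \<otimes> u0) = y"
        using conj_by_mult[of s c u0] c sS u0(2) su0 by simp
      moreover have "c \<otimes> u0 \<in> generate W J" by (rule generate.eng[OF c(1) u0(1)])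
      ultimately show "c \<otimes> u0 \<in> {u \<in> ?A. conj_by W s u = y}" using z(2) by simp
    qed
    show "(\<lambda>u. u \<otimes> inv u0) \<in> {u \<in> ?A. conj_by W s u = y} \<rightarrow> {c \<in> generate W J. conj_by W s c = s}"
    proof
      fix u assume "u \<in> {u \<in> ?A. conj_by W s u = y}"
      then have u: "u \<in> generate W J" "conj_by W s u = y" "u \<in> carrier W" using Gc by auto
      have "conj_by W s (u \<otimes> inv u0) = conj_by W (conj_by W s u0) (inv u0)"
        using conj_by_mult[of s u "inv u0"] u sS u0(2) su0 by simp
      also have "\<dots> = s" using sS u0(2) by simp
      finally have "conj_by W s (u \<otimes> inv u0) = s" .
      moreover have "u \<otimes> inv u0 \<in> generate W J" by (rule generate.eng[OF u(1) generate_inv[OF J(1) u0(1)]])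
      ultimately show "u \<otimes> inv u0 \<in> {c \<in> generate W J. conj_by W s c = s}" by simp
    qed
  qed (use u0(2) Gc in \<open>auto simp: m_assoc\<close>)
  then have "card {u \<in> ?A. conj_by W s u = y} = card {c \<in> generate W J. conj_by W s c = s}"
    by (rule bij_betw_same_card[symmetric])
  then show "card {u \<in> ?A. conj_by W s u = y} = 2 * card (X_set W S J {s})"
    using card_simple_centralizer[OF J(1) s] by simp
qed

section \<open>Nonvanishing, weight and value of the multiplicity\<close>

lemma arrangementE:
  assumes "H \<in> arrangement"
  obtains t where "t \<in> T" "H = hyperplane \<rho> t"
  using assms by (auto simp: coxeter_arrangement_def)

lemma multiplicity_nonzero_iff:
  assumes H: "H \<in> arrangement" and E: "E \<subseteq> H"
  shows "multiplicity_via arrangement H E \<noteq> 0 \<longleftrightarrow>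
    (\<exists>J w. J \<subseteq> S \<and> irreducible_subset W J \<and> w \<in> carrier W \<and>
      E = edge_cut_by \<rho> (conj_set W (parabolic_reflections W S J) w))"
proof -
  obtain t where t: "t \<in> T" "H = hyperplane \<rho> t" using H by (rule arrangementE)
  let ?Q = "{w \<in> carrier W. \<rho> w ` flat (support W S (conj_by W t w)) = E}"
  have "finite ?Q" using finite_W by simp
  then have nz: "multiplicity_via arrangement H E \<noteq> 0 \<longleftrightarrow> ?Q \<noteq> {}"
    unfolding t(2) multiplicity_via_eq[OF t(1)] by simp
  show ?thesis
  proof
    assume "multiplicity_via arrangement H E \<noteq> 0"
    then obtain w where w: "w \<in> carrier W" "\<rho> w ` flat (support W S (conj_by W t w)) = E" using nz by blast
    let ?J = "support W S (conj_by W t w)"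
    have "?J \<subseteq> S" by (rule support_subset)
    moreover have "irreducible_subset W ?J" using t w by (intro support_irreducible) simp
    moreover have "E = edge_cut_by \<rho> (conj_set W (parabolic_reflections W S ?J) (inv w))"
      using edge_cut_by_parabolic[OF support_subset, of "inv w" "conj_by W t w"] w by simp
    ultimately show "\<exists>J w. J \<subseteq> S \<and> irreducible_subset W J \<and> w \<in> carrier W \<and>
      E = edge_cut_by \<rho> (conj_set W (parabolic_reflections W S J) w)" using w by blast
  next
    assume "\<exists>J w. J \<subseteq> S \<and> irreducible_subset W J \<and> w \<in> carrier W \<and>
      E = edge_cut_by \<rho> (conj_set W (parabolic_reflections W S J) w)"
    then obtain J w where J: "J \<subseteq> S" "irreducible_subset W J" and w: "w \<in> carrier W"
      "E = edge_cut_by \<rho> (conj_set W (parabolic_reflections W S J) w)" by blast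
    have Ew: "E = \<rho> (inv w) ` flat J" using w edge_cut_by_parabolic[OF J(1) w(1)] by simp
    have tJ: "conj_by W t (inv w) \<in> generate W J"
      using parabolic_if_subset_hyperplane[OF J(1) t(1) w(1)] E unfolding Ew t(2) by blast
    have tT: "conj_by W t (inv w) \<in> T" using t w by simp
    obtain u where u: "u \<in> generate W J" "support W S (conj_by W (conj_by W t (inv w)) u) = J"
      using ex_full_support[OF J tT tJ] by blast
    have uc: "u \<in> carrier W" using generate_closed[OF J(1) u(1)] .
    have "support W S (conj_by W t (inv w \<otimes> u)) = J" using u t w uc by (simp add: conj_by_mult)
    then have "\<rho> (inv w \<otimes> u) ` flat (support W S (conj_by W t (inv w \<otimes> u))) = E"
      using rho_image_flat[OF J(1) u(1)] rho_image_mult[of "inv w" u] uc w(1) Ew by simp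
    then have "inv w \<otimes> u \<in> ?Q" using uc w(1) by simp
    then show "multiplicity_via arrangement H E \<noteq> 0" unfolding nz by (metis empty_iff)
  qed
qed

lemma edge_weight_parabolic:
  assumes J: "J \<subseteq> S" and w: "w \<in> carrier W"
    and E: "E = edge_cut_by \<rho> (conj_set W (parabolic_reflections W S J) w)"
  shows "edge_weight arrangement a E = (\<Prod>u\<in>parabolic_reflections W S J. a (hyperplane \<rho> (conj_by W u w)))"
proof -
  let ?f = "\<lambda>u. hyperplane \<rho> (conj_by W u w)"
  have Ew: "E = \<rho> (inv w) ` flat J" using E edge_cut_by_parabolic[OF J w] by simp
  have inj: "inj_on ?f (parabolic_reflections W S J)"
  proof (rule inj_onI)
    fix u v assume uv: "u \<in> parabolic_reflections W S J" "v \<in> parabolic_reflections W S J" "?f u = ?f v"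
    then have T: "u \<in> T" "v \<in> T" by (auto simp: parabolic_reflections_def)
    have "conj_by W u w = conj_by W v w" using hyperplane_inj[OF _ _ uv(3)] T w by simp
    then show "u = v" using T w by simp
  qed
  have "{H \<in> arrangement. E \<subseteq> H} = ?f ` parabolic_reflections W S J"
  proof
    show "{H \<in> arrangement. E \<subseteq> H} \<subseteq> ?f ` parabolic_reflections W S J"
    proof
      fix H assume "H \<in> {H \<in> arrangement. E \<subseteq> H}"
      then have H: "H \<in> arrangement" "E \<subseteq> H" by auto
      obtain t where t: "t \<in> T" "H = hyperplane \<rho> t" using H(1) by (rule arrangementE)
      have "conj_by W t (inv w) \<in> generate W J"
        using parabolic_if_subset_hyperplane[OF J t(1) w] H(2) unfolding Ew t(2) by blast
      then have "conj_by W t (inv w) \<in> parabolic_reflections W S J"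
        using t w by (simp add: parabolic_reflections_def)
      moreover have "H = ?f (conj_by W t (inv w))" using t w by simp
      ultimately show "H \<in> ?f ` parabolic_reflections W S J" by blast
    qed
    show "?f ` parabolic_reflections W S J \<subseteq> {H \<in> arrangement. E \<subseteq> H}"
      using w unfolding E edge_cut_by_def conj_set_def
      by (auto simp: coxeter_arrangement_def parabolic_reflections_def)
  qed
  then show ?thesis unfolding edge_weight_def by (simp add: prod.reindex[OF inj])
qed

lemma multiplicity_formula:
  assumes J: "J \<subseteq> S" "irreducible_subset W J" and w: "w \<in> carrier W"
    and E: "E = edge_cut_by \<rho> (conj_set W (parabolic_reflections W S J) w)"
    and H: "H \<in> arrangement" "E \<subseteq> H"
    and tJ: "support W S t\<^sub>J = J" and sJ: "s\<^sub>J \<in> S" and v: "v \<in> carrier W" "reduced_expression W S v vs"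
    and red: "reduced_expression W S t\<^sub>J (rev vs @ [s\<^sub>J] @ vs)"
  shows "multiplicity_via arrangement H E = real (card (support_class W S t\<^sub>J) * card (conj_subsets W S J) *
    card (X_set W S S J) * card (X_set W S J {s\<^sub>J}))"
proof -
  have Ew: "E = \<rho> (inv w) ` flat J" using E edge_cut_by_parabolic[OF J(1) w] by simp
  obtain t where t: "t \<in> T" "H = hyperplane \<rho> t" using H(1) by (rule arrangementE)
  have sub: "\<rho> (inv w) ` flat J \<subseteq> hyperplane \<rho> t" using H(2) Ew t(2) by simp
  let ?t = "conj_by W t (inv w)"
  have vs: "vs \<in> lists S" "word_prod W vs = v" using v(2) by (auto simp: reduced_expression_def)
  have "word_prod W (rev vs @ [s\<^sub>J] @ vs) = conj_by W s\<^sub>J v"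
    using vs sJ v(1) by (simp add: word_prod_append word_prod_rev conj_by_def m_assoc)
  then have tv: "t\<^sub>J = conj_by W s\<^sub>J v" using red by (simp add: reduced_expression_def)
  \<comment> \<open>All letters of a reduced expression lie in the support, so the given expression
    of \<open>t\<^sub>J\<close> forces \<open>s\<^sub>J\<close> \<in> J and v \<in> W_J.\<close>
  have letters: "set (rev vs @ [s\<^sub>J] @ vs) \<subseteq> J" using red tJ unfolding support_def by blast
  then have s: "s\<^sub>J \<in> J" by simp
  have "vs \<in> lists J" using letters by auto
  then have vJ: "v \<in> generate W J" using generate_eq_words[OF J(1)] vs(2) by blast
  \<comment> \<open>The hyperplane H enters only through the reflection \<open>?t\<close>, which may
    be traded for \<open>s\<^sub>J\<close>.\<close>
  have "full_support_count J ?t = full_support_count J s\<^sub>J"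
  proof (rule full_support_count_indep[OF J(1)])
    show "?t \<in> generate W J" by (rule parabolic_if_subset_hyperplane[OF J(1) t(1) w sub])
    show "s\<^sub>J \<in> generate W J" using s by (rule generate.incl)
  qed (use t w S_subset_T[OF sJ] in auto)
  \<comment> \<open>The factor 2 coming from the centralizer cancels the half in the
    multiplicity.\<close>
  then show ?thesis
    using full_support_count_simple[OF J s vJ] tJ tv card_simple_translates[OF J(1)]
      card_edge_chambers[OF J(1) t(1) w sub] multiplicity_via_eq[OF t(1), of E] Ew t(2)
    by simp
qed

end

theorem theorem1:
  fixes W :: "('g, 'b) monoid_scheme"
    and S :: "'g set"
    and \<rho> :: "'g \<Rightarrow> real^'n \<Rightarrow> real^'n"
    and a :: "(real^'n) set \<Rightarrow> 'r::comm_monoid_mult"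
  assumes "coxeter_system W S"
    and "finite (carrier W)"
    and "reflection_realization W S \<rho>"
  shows
    "(\<forall>E H. E \<in> edges (coxeter_arrangement W S \<rho>) \<and> H \<in> coxeter_arrangement W S \<rho> \<and> E \<subseteq> H \<longrightarrow>
        (multiplicity_via (coxeter_arrangement W S \<rho>) H E \<noteq> 0 \<longleftrightarrow>
          (\<exists>J w. J \<subseteq> S \<and> irreducible_subset W J \<and> w \<in> carrier W \<and>
             E = edge_cut_by \<rho> (conj_set W (parabolic_reflections W S J) w)))) \<and>
     (\<forall>J w E.
        J \<subseteq> S \<and> irreducible_subset W J \<and> w \<in> carrier W \<and>
        E = edge_cut_by \<rho> (conj_set W (parabolic_reflections W S J) w) \<longrightarrow>
          edge_weight (coxeter_arrangement W S \<rho>) a E =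
            (\<Prod>u\<in>parabolic_reflections W S J. a (hyperplane \<rho> (conj_by W u w))) \<and>
          (\<forall>H t\<^sub>J s\<^sub>J v vs.
             H \<in> coxeter_arrangement W S \<rho> \<and> E \<subseteq> H \<and>
             t\<^sub>J \<in> reflections W S \<and> support W S t\<^sub>J = J \<and>
             s\<^sub>J \<in> S \<and> v \<in> carrier W \<and> reduced_expression W S v vs \<and>
             reduced_expression W S t\<^sub>J (rev vs @ [s\<^sub>J] @ vs) \<longrightarrow>
               multiplicity_via (coxeter_arrangement W S \<rho>) H E =
                 real (card (support_class W S t\<^sub>J) * card (conj_subsets W S J) *
                       card (X_set W S S J) * card (X_set W S J {s\<^sub>J}))))"
proof -
  obtain \<alpha> where \<alpha>: "\<forall>s\<in>S. \<rho> s = reflection_along (\<alpha> s)"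
    "\<forall>s\<in>S. \<forall>t\<in>S. \<alpha> s \<bullet> \<alpha> t = - cos (pi / real (coxeter_exponent W s t))"
    using assms(3) unfolding reflection_realization_def by blast
  have "group W" using assms(1) by (simp add: coxeter_system_def)
  then interpret coxeter_realization W S \<rho> \<alpha>
    using assms \<alpha> unfolding reflection_realization_def
    by (intro coxeter_realization.intro coxeter_realization_axioms.intro) auto
  show ?thesis
    by (intro conjI allI impI; elim conjE)
      (rule multiplicity_nonzero_iff edge_weight_parabolic multiplicity_formula; assumption)+
qed

end
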